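(* Let $\mu$ be a nonzero real constant. The complete point symmetry pseudogroup $G$ of the (1+1)-dimensional linear heat equation with inverse square potential $$u_t=u_{xx}+\frac{\mu}{x^2}u$$ consists of the point transformations of the form $$\tilde t=\frac{\alpha t+\beta}{\gamma t+\delta},\qquad \tilde x=\frac{x}{\gamma t+\delta},\qquad \tilde u=\sigma\sqrt{|\gamma t+\delta|}\,\bigl(u+h(t,x)\bigr)\exp\frac{\gamma x^2}{4(\gamma t+\delta)},$$ where $\alpha,\beta,\gamma,\delta$ and $\sigma$ are arbitrary real constants with $\alpha\delta-\beta\gamma=1$ and $\sigma\ne0$, and $h$ is an arbitrary solution of the equation $h_t=h_{xx}+\mu x^{-2}h$.
   Context: The equation is for a real function $u=u(t,x)$ of two real independent variables, $x\neq0$. A point transformation is a (local) diffeomorphism of the space with coordinates $(t,x,u)$, written $(t,x,u)\mapsto(\tilde t,\tilde x,\tilde u)$. The complete point symmetry pseudogroup of the equation is the set of all point transformations that map the equation to itself, i.e., to the same equation (with the same $\mu$) written in the variables with tildes. All functions are smooth and considered locally. *)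

theory Defs
  imports "HOL-Analysis.Analysis"
begin

text \<open>
  Smoothness on an open set. For maps between finite-dimensional spaces, continuity of all
  iterated directional derivatives in fixed directions is continuity of all Frechet derivatives.
\<close>

primrec C_k_on :: "nat \<Rightarrow> 'a set \<Rightarrow> ('a::real_normed_vector \<Rightarrow> 'b::real_normed_vector) \<Rightarrow> bool"
  where
    "C_k_on 0 S f \<longleftrightarrow> continuous_on S f"
  | "C_k_on (Suc k) S f \<longleftrightarrow>
      (\<forall>x\<in>S. f differentiable (at x)) \<and>
      (\<forall>v. C_k_on k S (\<lambda>x. frechet_derivative f (at x) v))"

definition smooth_on :: "'a set \<Rightarrow> ('a::real_normed_vector \<Rightarrow> 'b::real_normed_vector) \<Rightarrow> bool"
  where "smooth_on S f \<longleftrightarrow> (\<forall>k. C_k_on k S f)"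

text \<open>
  A point transformation is a pair of an open set \<open>U\<close> and a diffeomorphism \<open>\<Phi>\<close> of \<open>U\<close> onto an
  open set. Only the values of \<open>\<Phi>\<close> on \<open>U\<close> matter. Points are triples \<open>(t, x, u)\<close>.
\<close>

type_synonym point = "real \<times> real \<times> real"

definition point_transformation :: "point set \<Rightarrow> (point \<Rightarrow> point) \<Rightarrow> bool"
  where "point_transformation U \<Phi> \<longleftrightarrow>
    open U \<and> smooth_on U \<Phi> \<and> open (\<Phi> ` U) \<and>
    (\<exists>\<Psi>. smooth_on (\<Phi> ` U) \<Psi> \<and> (\<forall>p\<in>U. \<Psi> (\<Phi> p) = p))"

definition equation_domain :: "point set"
  where "equation_domain = {(t, x, u). x \<noteq> 0}"

definition heat_solution :: "real \<Rightarrow> (real \<times> real) set \<Rightarrow> (real \<times> real \<Rightarrow> real) \<Rightarrow> bool"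
  where "heat_solution \<mu> D u \<longleftrightarrow>
    open D \<and> (\<forall>(t, x)\<in>D. x \<noteq> 0) \<and> smooth_on D u \<and>
    (\<forall>(t, x)\<in>D. deriv (\<lambda>s. u (s, x)) t =
      deriv (deriv (\<lambda>y. u (t, y))) x + \<mu> / x\<^sup>2 * u (t, x))"

definition graph_over :: "(real \<times> real) set \<Rightarrow> (real \<times> real \<Rightarrow> real) \<Rightarrow> point set"
  where "graph_over D u = (\<lambda>(t, x). (t, x, u (t, x))) ` D"

text \<open>
  Whenever \<open>\<Phi>\<close> carries the graph of a function \<open>u\<close> onto the graph of a function \<open>v\<close>,
  the equation for \<open>u\<close> is equivalent to the same equation for \<open>v\<close> in the new variables.
  The domains \<open>D\<close> and \<open>E\<close> may be arbitrarily small, so that this is a condition on local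
  functions. Graphs whose image is not a graph impose no condition.
\<close>

definition maps_equation_to_itself :: "real \<Rightarrow> point set \<Rightarrow> (point \<Rightarrow> point) \<Rightarrow> bool"
  where "maps_equation_to_itself \<mu> U \<Phi> \<longleftrightarrow>
    (\<forall>D u E v. open D \<longrightarrow> open E \<longrightarrow> smooth_on D u \<longrightarrow> smooth_on E v \<longrightarrow>
      graph_over D u \<subseteq> U \<longrightarrow> \<Phi> ` graph_over D u = graph_over E v \<longrightarrow>
      (heat_solution \<mu> D u \<longleftrightarrow> heat_solution \<mu> E v))"

definition point_symmetry_pseudogroup :: "real \<Rightarrow> (point set \<times> (point \<Rightarrow> point)) set"
  where "point_symmetry_pseudogroup \<mu> =
    {(U, \<Phi>). point_transformation U \<Phi> \<and> U \<subseteq> equation_domain \<and> \<Phi> ` U \<subseteq> equation_domain \<and>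
      maps_equation_to_itself \<mu> U \<Phi>}"

definition has_symmetry_form :: "real \<Rightarrow> point set \<Rightarrow> (point \<Rightarrow> point) \<Rightarrow> bool"
  where "has_symmetry_form \<mu> U \<Phi> \<longleftrightarrow>
    open U \<and> U \<subseteq> equation_domain \<and>
    (\<exists>\<alpha> \<beta> \<gamma> \<delta> \<sigma> :: real. \<exists>h.
      \<alpha> * \<delta> - \<beta> * \<gamma> = 1 \<and> \<sigma> \<noteq> 0 \<and>
      heat_solution \<mu> {(t, x). \<exists>u. (t, x, u) \<in> U} h \<and>
      (\<forall>(t, x, u)\<in>U. \<gamma> * t + \<delta> \<noteq> 0 \<and>
        \<Phi> (t, x, u) =
          ((\<alpha> * t + \<beta>) / (\<gamma> * t + \<delta>),
           x / (\<gamma> * t + \<delta>),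
           \<sigma> * sqrt \<bar>\<gamma> * t + \<delta>\<bar> * (u + h (t, x)) * exp (\<gamma> * x\<^sup>2 / (4 * (\<gamma> * t + \<delta>))))))"

end

theory Submission
  imports Defs
begin

text \<open>
  Through every point there are local solutions with arbitrary values of \<open>u\<close>, \<open>u_t\<close>, \<open>u_x\<close> and
  \<open>u_tt\<close>: take \<open>u = f0 + (t - t0) f1 + (t - t0)^2/2 f2\<close> with \<open>L f2 = 0\<close>, \<open>L f1 = f2\<close>, \<open>L f0 = f1\<close> for
  the operator \<open>L = d^2/dx^2 + \<mu>/x^2\<close>. Let a symmetry \<open>(T, X, V)\<close> carry \<open>u\<close> to \<open>v\<close>. Differentiating
  \<open>v(T, X) = V\<close> twice along a line on which \<open>T\<close> is stationary expresses the equation for \<open>v\<close> by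
  the jet of \<open>u\<close>. Varying \<open>u_tt\<close> gives \<open>T = T(t)\<close>, varying \<open>u_t\<close> gives \<open>X = s(t) x + r(t)\<close> with
  \<open>s^2 = T'\<close>, and varying \<open>u_x\<close> gives \<open>V = A u + B\<close>, where \<open>A_x/A\<close> is affine in \<open>x\<close>. The equation
  for \<open>A\<close> then says that \<open>\<mu>/(x + r/s)^2 - \<mu>/x^2\<close> is quadratic in \<open>x\<close>, so \<open>r = 0\<close> because
  \<open>\<mu> \<noteq> 0\<close>, and the remaining coefficients say that \<open>1/s\<close> is affine in \<open>t\<close>.

  Conversely, the displayed maps intertwine the heat operators. The parameters are determined by
  the map on any nonempty open set, so the local forms agree on a connected domain; connected
  fibres make \<open>h\<close> single-valued.
\<close>

section \<open>Smooth maps\<close>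


text \<open>A line on which \<open>T\<close> is stationary is used because the second derivative of
  v(T, X) along it contains neither v_TT nor v_TX, about which nothing is known, while v_XX is
  eliminated by the equation. In the steps for u_tt and u_t the degenerate case is excluded in the
  same way: it would make dV a combination of dT and dX, against invertibility. The symmetry
  condition speaks only of actual functions, so each jet must come from a genuine solution, and the
  image of its graph must again be a graph. The latter is the condition \<open>J\<close>, which is
  affine in (u_t, u_x) and fails at most on a line of values. In the last step m = s'/s satisfies
  the Riccati equation m' = m^2, and this makes 1/s affine. For \<mu> = 0 the shift r would survive
  as translations and Galilean boosts; the pole of the potential at x = 0 excludes it.\<close>

lemma C_k_on_SucD: "C_k_on (Suc k) S f \<Longrightarrow> C_k_on k S f"
proof (induction k arbitrary: f)
  case 0
  then show ?case
    by (auto intro!: continuous_at_imp_continuous_on differentiable_imp_continuous_within)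
next
  case (Suc k)
  then show ?case by (metis C_k_on.simps(2))
qed

lemma C_k_on_cong:
  assumes "open S" "\<And>x. x \<in> S \<Longrightarrow> f x = g x" "C_k_on k S f"
  shows "C_k_on k S g"
  using assms(2,3)
proof (induction k arbitrary: f g)
  case 0
  then show ?case by (metis C_k_on.simps(1) continuous_on_cong)
next
  case (Suc k)
  have d: "(g has_derivative frechet_derivative f (at x)) (at x)" if "x \<in> S" for x
    using Suc.prems that assms(1)
    by (metis C_k_on.simps(2) frechet_derivative_works has_derivative_transform_within_open)
  have e: "frechet_derivative g (at x) = frechet_derivative f (at x)" if "x \<in> S" for x
    using d[OF that] by (metis frechet_derivative_at)
  show ?case
    using Suc.prems(2) d e Suc.IH[of "\<lambda>x. frechet_derivative f (at x) v" "\<lambda>x. frechet_derivative g (at x) v" for v]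
    by (auto simp: differentiable_def)
qed

text \<open>Replaces the choice operator \<open>frechet_derivative\<close> by an explicit formula
  for the derivative. All later smoothness proofs by induction on the order go through this rule or
  its real version.\<close>

lemma C_k_on_SucI:
  assumes "open S" "\<And>x. x \<in> S \<Longrightarrow> (f has_derivative f' x) (at x)" "\<And>v. C_k_on k S (\<lambda>x. f' x v)"
  shows "C_k_on (Suc k) S f"
proof -
  have "f' x = frechet_derivative f (at x)" if "x \<in> S" for x
    using assms(2)[OF that] by (metis frechet_derivative_at)
  then have "C_k_on k S (\<lambda>x. frechet_derivative f (at x) v)" for v
    using assms(1,3) by (intro C_k_on_cong[OF assms(1) _ assms(3)]) auto
  then show ?thesis using assms(2) by (auto simp: differentiable_def)
qed

lemma C_k_on_subset: "C_k_on k S f \<Longrightarrow> T \<subseteq> S \<Longrightarrow> C_k_on k T f"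
  by (induction k arbitrary: f) (auto intro: continuous_on_subset)

text \<open>Differentiability and continuity at a point see only an open neighbourhood. This is what
  allows the function \<open>h\<close> to be glued from local pieces at the end.\<close>

lemma C_k_on_local:
  assumes "\<And>x. x \<in> S \<Longrightarrow> \<exists>T. open T \<and> x \<in> T \<and> C_k_on k T f"
  shows "C_k_on k S f"
  using assms
proof (induction k arbitrary: f)
  case 0
  have "continuous (at x) f" if "x \<in> S" for x
    using 0[OF that] by (metis C_k_on.simps(1) continuous_on_eq_continuous_at)
  then show ?case by (simp add: continuous_at_imp_continuous_on)
next
  case (Suc k)
  have "f differentiable at x" if "x \<in> S" for x
    using Suc.prems[OF that] by auto
  moreover have "C_k_on k S (\<lambda>x. frechet_derivative f (at x) v)" for v
    by (rule Suc.IH) (use Suc.prems in fastforce)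
  ultimately show ?case by auto
qed

lemma C_k_on_const: "C_k_on k S (\<lambda>x. c)"
  by (induction k arbitrary: c) auto

lemma C_k_on_add: 
  assumes "open S"
  shows "C_k_on k S f \<Longrightarrow> C_k_on k S g \<Longrightarrow> C_k_on k S (\<lambda>x. f x + g x)"
proof (induction k arbitrary: f g)
  case 0 then show ?case by (auto intro: continuous_intros)
next
  case (Suc k)
  show ?case
  proof (rule C_k_on_SucI[OF assms])
    show "((\<lambda>x. f x + g x) has_derivative (\<lambda>v. frechet_derivative f (at x) v + frechet_derivative g (at x) v)) (at x)"
      if "x \<in> S" for x
      using Suc.prems that by (auto intro!: has_derivative_add simp: frechet_derivative_works)
  qed (use Suc in auto)
qed

lemma C_k_on_bounded_bilinear:
  assumes "open S" "bounded_bilinear m"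
  shows "C_k_on k S f \<Longrightarrow> C_k_on k S g \<Longrightarrow> C_k_on k S (\<lambda>x. m (f x) (g x))"
proof (induction k arbitrary: f g)
  case 0 then show ?case using assms(2) by (auto intro: bounded_bilinear.continuous_on)
next
  case (Suc k)
  show ?case
  proof (rule C_k_on_SucI[OF assms(1)])
    show "((\<lambda>x. m (f x) (g x)) has_derivative (\<lambda>v. m (f x) (frechet_derivative g (at x) v) + m (frechet_derivative f (at x) v) (g x))) (at x)"
      if "x \<in> S" for x
      using Suc.prems that by (auto intro!: bounded_bilinear.FDERIV[OF assms(2)] simp: frechet_derivative_works)
    show "C_k_on k S (\<lambda>x. m (f x) (frechet_derivative g (at x) v) + m (frechet_derivative f (at x) v) (g x))" for v
      using Suc C_k_on_SucD[OF Suc.prems(1)] C_k_on_SucD[OF Suc.prems(2)]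
      by (intro C_k_on_add[OF assms(1)] Suc.IH) auto
  qed
qed

lemma C_k_on_bounded_linear:
  assumes "open S" "bounded_linear h" "C_k_on k S f"
  shows "C_k_on k S (\<lambda>x. h (f x))"
  using assms(3)
proof (induction k arbitrary: f)
  case 0 then show ?case using assms(2) by (auto intro: bounded_linear.continuous_on)
next
  case (Suc k)
  show ?case
  proof (rule C_k_on_SucI[OF assms(1)])
    show "((\<lambda>x. h (f x)) has_derivative (\<lambda>v. h (frechet_derivative f (at x) v))) (at x)"
      if "x \<in> S" for x
      using Suc.prems that by (auto intro!: bounded_linear.has_derivative[OF assms(2)] simp: frechet_derivative_works)
  qed (use Suc in auto)
qed

lemma C_k_on_ident: "open S \<Longrightarrow> C_k_on k S (\<lambda>x. x)"
proof (induction k)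
  case (Suc k)
  then show ?case by (intro C_k_on_SucI[where f'="\<lambda>_ v. v"] C_k_on_const) auto
qed auto

lemma C_k_on_sum:
  assumes "open S" "finite B" "\<And>b. b \<in> B \<Longrightarrow> C_k_on k S (f b)"
  shows "C_k_on k S (\<lambda>x. \<Sum>b\<in>B. f b x)"
  using assms(2,3) by (induction B) (auto intro!: C_k_on_const C_k_on_add[OF assms(1)])

text \<open>Expanding the inner derivative in a basis reduces the derivative of a composition to
  compositions with directional derivatives in fixed directions.\<close>

lemma C_k_on_compose:
  fixes f :: "'a::real_normed_vector \<Rightarrow> 'b::euclidean_space"
  assumes "open S" "open T" "f ` S \<subseteq> T"
  shows "C_k_on k S f \<Longrightarrow> C_k_on k T g \<Longrightarrow> C_k_on k S (\<lambda>x. g (f x))"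
proof (induction k arbitrary: g)
  case 0 then show ?case using assms(3) by (auto intro: continuous_on_compose2)
next
  case (Suc k)
  let ?g' = "\<lambda>x. frechet_derivative g (at x)"
  let ?f' = "\<lambda>x. frechet_derivative f (at x)"
  have f: "(f has_derivative ?f' x) (at x)" if "x \<in> S" for x
    using Suc.prems(1) that by (auto simp: frechet_derivative_works)
  have g: "(g has_derivative ?g' x) (at x)" if "x \<in> T" for x
    using Suc.prems(2) that by (auto simp: frechet_derivative_works)
  show ?case
  proof (rule C_k_on_SucI[OF assms(1)])
    fix x assume x: "x \<in> S"
    then have gx: "(g has_derivative ?g' (f x)) (at (f x))" using g assms(3) by blast
    have lin: "linear (?g' (f x))" using gx by (rule has_derivative_linear)
    have "?g' (f x) (?f' x v) = (\<Sum>b\<in>Basis. (?f' x v \<bullet> b) *\<^sub>R ?g' (f x) b)" for v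
    proof -
      have "?g' (f x) (?f' x v) = ?g' (f x) (\<Sum>b\<in>Basis. (?f' x v \<bullet> b) *\<^sub>R b)"
        by (simp add: euclidean_representation)
      then show ?thesis by (simp add: linear_sum[OF lin] linear_cmul[OF lin])
    qed
    then show "((\<lambda>x. g (f x)) has_derivative (\<lambda>v. \<Sum>b\<in>Basis. (?f' x v \<bullet> b) *\<^sub>R ?g' (f x) b)) (at x)"
      using has_derivative_compose[OF f[OF x] gx] by simp
  next
    fix v
    show "C_k_on k S (\<lambda>x. \<Sum>b\<in>Basis. (?f' x v \<bullet> b) *\<^sub>R ?g' (f x) b)"
    proof (intro C_k_on_sum[OF assms(1)] C_k_on_bounded_bilinear[OF assms(1) bounded_bilinear_scaleR])
      fix b :: 'b
      show "C_k_on k S (\<lambda>x. ?f' x v \<bullet> b)"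
        using Suc.prems(1) by (intro C_k_on_bounded_linear[OF assms(1) bounded_linear_inner_left]) simp
      show "C_k_on k S (\<lambda>x. ?g' (f x) b)"
        using Suc.prems(2) by (intro Suc.IH[OF C_k_on_SucD[OF Suc.prems(1)]]) simp
    qed simp
  qed
qed

lemma smooth_on_subset: "smooth_on S f \<Longrightarrow> T \<subseteq> S \<Longrightarrow> smooth_on T f"
  by (auto simp: smooth_on_def intro: C_k_on_subset)

lemma smooth_on_cong:
  "open S \<Longrightarrow> smooth_on S f \<Longrightarrow> (\<And>x. x \<in> S \<Longrightarrow> f x = g x) \<Longrightarrow> smooth_on S g"
  by (auto simp: smooth_on_def intro: C_k_on_cong[of S f g])

lemma smooth_on_local:
  "(\<And>x. x \<in> S \<Longrightarrow> \<exists>T. open T \<and> x \<in> T \<and> smooth_on T f) \<Longrightarrow> smooth_on S f"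
  unfolding smooth_on_def by (meson C_k_on_local)

lemma smooth_on_const: "smooth_on S (\<lambda>x. c)"
  by (auto simp: smooth_on_def C_k_on_const)

lemma smooth_on_ident: "open S \<Longrightarrow> smooth_on S (\<lambda>x. x)"
  by (auto simp: smooth_on_def C_k_on_ident)

lemma smooth_on_add: "open S \<Longrightarrow> smooth_on S f \<Longrightarrow> smooth_on S g \<Longrightarrow> smooth_on S (\<lambda>x. f x + g x)"
  by (auto simp: smooth_on_def C_k_on_add)

lemma smooth_on_mult:
  fixes f g :: "'a::real_normed_vector \<Rightarrow> real"
  shows "open S \<Longrightarrow> smooth_on S f \<Longrightarrow> smooth_on S g \<Longrightarrow> smooth_on S (\<lambda>x. f x * g x)"
  by (auto simp: smooth_on_def intro: C_k_on_bounded_bilinear[OF _ bounded_bilinear_mult])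

lemma smooth_on_bounded_linear:
  "open S \<Longrightarrow> bounded_linear h \<Longrightarrow> smooth_on S f \<Longrightarrow> smooth_on S (\<lambda>x. h (f x))"
  by (auto simp: smooth_on_def intro: C_k_on_bounded_linear)

lemma smooth_on_minus: "open S \<Longrightarrow> smooth_on S f \<Longrightarrow> smooth_on S (\<lambda>x. - f x)"
  by (intro smooth_on_bounded_linear[OF _ bounded_linear_minus[OF bounded_linear_ident]])

lemma smooth_on_diff:
  "open S \<Longrightarrow> smooth_on S f \<Longrightarrow> smooth_on S g \<Longrightarrow> smooth_on S (\<lambda>x. f x - g x)"
  using smooth_on_add[of S f "\<lambda>x. - g x"] smooth_on_minus[of S g] by simp

lemma smooth_on_fst: "open S \<Longrightarrow> smooth_on S f \<Longrightarrow> smooth_on S (\<lambda>x. fst (f x))"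
  by (intro smooth_on_bounded_linear[OF _ bounded_linear_fst])

lemma smooth_on_snd: "open S \<Longrightarrow> smooth_on S f \<Longrightarrow> smooth_on S (\<lambda>x. snd (f x))"
  by (intro smooth_on_bounded_linear[OF _ bounded_linear_snd])

lemma smooth_on_Pair:
  assumes "open S" "smooth_on S f" "smooth_on S g"
  shows "smooth_on S (\<lambda>x. (f x, g x))"
proof -
  have "smooth_on S (\<lambda>x. (f x, 0) + (0, g x))"
    by (intro smooth_on_add assms smooth_on_bounded_linear[where h="\<lambda>x. (x, 0)"]
        smooth_on_bounded_linear[where h="\<lambda>x. (0, x)"] bounded_linear_intros)
  then show ?thesis by simp
qed

lemma smooth_on_compose:
  fixes f :: "'a::real_normed_vector \<Rightarrow> 'b::euclidean_space"
  shows "smooth_on T g \<Longrightarrow> open S \<Longrightarrow> open T \<Longrightarrow> smooth_on S f \<Longrightarrow> (\<And>x. x \<in> S \<Longrightarrow> f x \<in> T) \<Longrightarrow>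
    smooth_on S (\<lambda>x. g (f x))"
  unfolding smooth_on_def by (rule allI, rule C_k_on_compose[of S T]) auto

lemma smooth_on_imp_continuous_on: "smooth_on S f \<Longrightarrow> continuous_on S f"
  unfolding smooth_on_def by (metis C_k_on.simps(1))

lemma smooth_on_imp_differentiable: "smooth_on S f \<Longrightarrow> x \<in> S \<Longrightarrow> f differentiable at x"
  unfolding smooth_on_def by (metis C_k_on.simps(2))

lemma smooth_on_frechet_derivative:
  "smooth_on S f \<Longrightarrow> smooth_on S (\<lambda>x. frechet_derivative f (at x) v)"
  unfolding smooth_on_def by (metis C_k_on.simps(2))

section \<open>Smoothness of elementary functions\<close>

lemma C_k_on_SucI_real:
  fixes f :: "real \<Rightarrow> real"
  assumes "open S" "\<And>x. x \<in> S \<Longrightarrow> (f has_real_derivative f' x) (at x)" "C_k_on k S f'"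
  shows "C_k_on (Suc k) S f"
proof (rule C_k_on_SucI[OF assms(1)])
  show "(f has_derivative (\<lambda>v. f' x * v)) (at x)" if "x \<in> S" for x
    using assms(2)[OF that] by (simp add: has_field_derivative_def)
  show "C_k_on k S (\<lambda>x. f' x * v)" for v
    by (rule C_k_on_bounded_linear[OF assms(1) bounded_linear_mult_left assms(3)])
qed

lemma smooth_on_exp: "smooth_on UNIV (exp :: real \<Rightarrow> real)"
  unfolding smooth_on_def
proof
  show "C_k_on k UNIV (exp :: real \<Rightarrow> real)" for k
  proof (induction k)
    case (Suc k)
    show ?case by (rule C_k_on_SucI_real[OF _ _ Suc]) (auto intro: DERIV_exp)
  qed (auto intro: continuous_intros)
qed

text \<open>The induction closes because the derivative of \<open>inverse\<close> is minus its own
  square, and products preserve the class reached so far.\<close>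

lemma smooth_on_inverse: "smooth_on (- {0}) (inverse :: real \<Rightarrow> real)"
  unfolding smooth_on_def
proof
  show "C_k_on k (- {0}) (inverse :: real \<Rightarrow> real)" for k
  proof (induction k)
    case (Suc k)
    have "C_k_on k (- {0}) (\<lambda>x::real. - (inverse x * inverse x))"
      by (intro C_k_on_bounded_linear[OF _ bounded_linear_minus[OF bounded_linear_ident]]
          C_k_on_bounded_bilinear[OF _ bounded_bilinear_mult] Suc) auto
    then show ?case
      by (rule C_k_on_SucI_real[rotated 2]) (auto intro!: derivative_eq_intros)
  qed (auto intro: continuous_intros)
qed

lemma smooth_on_ln: "smooth_on {0<..} (ln :: real \<Rightarrow> real)"
  unfolding smooth_on_def
proof
  show "C_k_on k {0<..} (ln :: real \<Rightarrow> real)" for k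
  proof (cases k)
    case 0
    then show ?thesis by (auto intro!: continuous_intros)
  next
    case (Suc k)
    have "C_k_on k {0<..} (inverse :: real \<Rightarrow> real)"
      using smooth_on_inverse by (auto simp: smooth_on_def intro: C_k_on_subset)
    then show ?thesis unfolding Suc
      by (rule C_k_on_SucI_real[rotated 2]) (auto intro!: derivative_eq_intros simp: field_simps)
  qed
qed

lemma smooth_on_divide:
  fixes f g :: "'a::real_normed_vector \<Rightarrow> real"
  assumes "open S" "smooth_on S f" "smooth_on S g" "\<And>x. x \<in> S \<Longrightarrow> g x \<noteq> 0"
  shows "smooth_on S (\<lambda>x. f x / g x)"
  unfolding divide_inverse
  using assms by (auto intro!: smooth_on_mult smooth_on_compose[OF smooth_on_inverse])

lemma smooth_on_exp_comp:
  fixes f :: "'a::real_normed_vector \<Rightarrow> real"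
  shows "open S \<Longrightarrow> smooth_on S f \<Longrightarrow> smooth_on S (\<lambda>x. exp (f x))"
  by (intro smooth_on_compose[OF smooth_on_exp]) auto

lemma smooth_on_ln_comp:
  fixes f :: "'a::real_normed_vector \<Rightarrow> real"
  shows "open S \<Longrightarrow> smooth_on S f \<Longrightarrow> (\<And>x. x \<in> S \<Longrightarrow> 0 < f x) \<Longrightarrow> smooth_on S (\<lambda>x. ln (f x))"
  by (intro smooth_on_compose[OF smooth_on_ln]) auto

lemma smooth_on_power:
  fixes f :: "'a::real_normed_vector \<Rightarrow> real"
  shows "open S \<Longrightarrow> smooth_on S f \<Longrightarrow> smooth_on S (\<lambda>x. f x ^ n)"
  by (induction n) (auto intro: smooth_on_const smooth_on_mult)

text \<open>Away from the zeros of f the function equals exp(ln(f^2) / 4), in which neither an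
  absolute value nor the sign of f occurs.\<close>

lemma smooth_on_sqrt_abs:
  fixes f :: "'a::real_normed_vector \<Rightarrow> real"
  assumes "open S" "smooth_on S f" "\<And>x. x \<in> S \<Longrightarrow> f x \<noteq> 0"
  shows "smooth_on S (\<lambda>x. sqrt \<bar>f x\<bar>)"
proof -
  have e: "exp (ln ((f x)\<^sup>2) / 4) = sqrt \<bar>f x\<bar>" if "x \<in> S" for x
  proof (rule power2_eq_imp_eq)
    have "(exp (ln ((f x)\<^sup>2) / 4))\<^sup>2 = exp (ln (\<bar>f x\<bar>\<^sup>2) / 2)"
      by (simp add: exp_double[symmetric])
    also have "\<dots> = (sqrt \<bar>f x\<bar>)\<^sup>2" using assms(3)[OF that] by (subst ln_realpow) auto
    finally show "(exp (ln ((f x)\<^sup>2) / 4))\<^sup>2 = (sqrt \<bar>f x\<bar>)\<^sup>2" .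
  qed auto
  have "smooth_on S (\<lambda>x. exp (ln ((f x)\<^sup>2) / 4))"
    using assms
    by (intro smooth_on_exp_comp smooth_on_divide smooth_on_const smooth_on_ln_comp smooth_on_power) auto
  then show ?thesis by (rule smooth_on_cong[OF assms(1)]) (rule e)
qed

lemmas smooth_intros = smooth_on_const smooth_on_ident smooth_on_add smooth_on_mult smooth_on_minus
  smooth_on_diff smooth_on_fst smooth_on_snd smooth_on_Pair smooth_on_divide smooth_on_exp_comp
  smooth_on_power smooth_on_sqrt_abs


section \<open>Partial derivatives\<close>

text \<open>Built from \<open>deriv\<close> exactly as in \<open>heat_solution\<close>, so that its
  equation becomes one between operators on functions of the plane, and these can be
  iterated.\<close>

definition dt :: "(real \<times> real \<Rightarrow> real) \<Rightarrow> real \<times> real \<Rightarrow> real"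
  where "dt u = (\<lambda>(t, x). deriv (\<lambda>s. u (s, x)) t)"

definition dx :: "(real \<times> real \<Rightarrow> real) \<Rightarrow> real \<times> real \<Rightarrow> real"
  where "dx u = (\<lambda>(t, x). deriv (\<lambda>y. u (t, y)) x)"

definition Dt :: "(point \<Rightarrow> real) \<Rightarrow> point \<Rightarrow> real"
  where "Dt f = (\<lambda>(t, x, u). deriv (\<lambda>s. f (s, x, u)) t)"

definition Dx :: "(point \<Rightarrow> real) \<Rightarrow> point \<Rightarrow> real"
  where "Dx f = (\<lambda>(t, x, u). deriv (\<lambda>y. f (t, y, u)) x)"

definition Du :: "(point \<Rightarrow> real) \<Rightarrow> point \<Rightarrow> real"
  where "Du f = (\<lambda>(t, x, u). deriv (\<lambda>w. f (t, x, w)) u)"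

lemma partial2_frechet:
  assumes "u differentiable at (t, x)"
  shows "((\<lambda>s. u (s, x)) has_real_derivative frechet_derivative u (at (t, x)) (1, 0)) (at t)"
    and "((\<lambda>y. u (t, y)) has_real_derivative frechet_derivative u (at (t, x)) (0, 1)) (at x)"
proof -
  let ?L = "frechet_derivative u (at (t, x))"
  have L: "(u has_derivative ?L) (at (t, x))" using assms frechet_derivative_works by blast
  have lin: "linear ?L" using L by (rule has_derivative_linear)
  have "((\<lambda>s. u (s, x)) has_derivative (\<lambda>s. ?L (s, 0))) (at t)"
    by (rule has_derivative_compose[of "\<lambda>s. (s, x)" "\<lambda>s. (s, 0)" _ _ u ?L])
       (auto intro!: has_derivative_Pair has_derivative_ident has_derivative_const L)
  moreover have "(\<lambda>s. ?L (s, 0)) = (*) (?L (1, 0))"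
  proof
    show "?L (s, 0) = ?L (1, 0) * s" for s
      using linear_cmul[OF lin, of s "(1, 0)"] by simp
  qed
  ultimately show "((\<lambda>s. u (s, x)) has_real_derivative ?L (1, 0)) (at t)"
    by (simp add: has_field_derivative_def)
  have "((\<lambda>y. u (t, y)) has_derivative (\<lambda>s. ?L (0, s))) (at x)"
    by (rule has_derivative_compose[of "\<lambda>s. (t, s)" "\<lambda>s. (0, s)" _ _ u ?L])
       (auto intro!: has_derivative_Pair has_derivative_ident has_derivative_const L)
  moreover have "(\<lambda>s. ?L (0, s)) = (*) (?L (0, 1))"
  proof
    show "?L (0, s) = ?L (0, 1) * s" for s
      using linear_cmul[OF lin, of s "(0, 1)"] by simp
  qed
  ultimately show "((\<lambda>y. u (t, y)) has_real_derivative ?L (0, 1)) (at x)"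
    by (simp add: has_field_derivative_def)
qed

lemma partial2_eq_frechet:
  assumes "u differentiable at p"
  shows "dt u p = frechet_derivative u (at p) (1, 0)" "dx u p = frechet_derivative u (at p) (0, 1)"
  using partial2_frechet[of u "fst p" "snd p"] assms
  by (auto simp: dt_def dx_def split: prod.splits intro: DERIV_imp_deriv)

lemma has_derivative_partial2:
  assumes "u differentiable at p"
  shows "(u has_derivative (\<lambda>(a, b). dt u p * a + dx u p * b)) (at p)"
proof -
  let ?L = "frechet_derivative u (at p)"
  have L: "(u has_derivative ?L) (at p)" using assms frechet_derivative_works by blast
  have lin: "linear ?L" using L by (rule has_derivative_linear)
  have "?L (a, b) = dt u p * a + dx u p * b" for a b
  proof -
    have "?L (a, b) = ?L (a *\<^sub>R (1, 0) + b *\<^sub>R (0, 1))" by simp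
    also have "\<dots> = dt u p * a + dx u p * b"
      by (simp only: linear_add[OF lin] linear_cmul[OF lin] partial2_eq_frechet[OF assms]) simp
    finally show ?thesis .
  qed
  then have "?L = (\<lambda>(a, b). dt u p * a + dx u p * b)" by auto
  with L show ?thesis by simp
qed

lemma partial3_frechet:
  assumes "f differentiable at (t, x, u)"
  shows "((\<lambda>s. f (s, x, u)) has_real_derivative frechet_derivative f (at (t, x, u)) (1, 0, 0)) (at t)"
    and "((\<lambda>y. f (t, y, u)) has_real_derivative frechet_derivative f (at (t, x, u)) (0, 1, 0)) (at x)"
    and "((\<lambda>w. f (t, x, w)) has_real_derivative frechet_derivative f (at (t, x, u)) (0, 0, 1)) (at u)"
proof -
  let ?L = "frechet_derivative f (at (t, x, u))"
  have L: "(f has_derivative ?L) (at (t, x, u))" using assms frechet_derivative_works by blast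
  have lin: "linear ?L" using L by (rule has_derivative_linear)
  have "((\<lambda>s. f (s, x, u)) has_derivative (\<lambda>s. ?L (s, 0, 0))) (at t)"
    by (rule has_derivative_compose[of "\<lambda>s. (s, x, u)" "\<lambda>s. (s, 0, 0)" _ _ f ?L])
       (auto simp: zero_prod_def intro!: has_derivative_Pair has_derivative_ident has_derivative_const L)
  moreover have "(\<lambda>s. ?L (s, 0, 0)) = (*) (?L (1, 0, 0))"
  proof
    show "?L (s, 0, 0) = ?L (1, 0, 0) * s" for s
      using linear_cmul[OF lin, of s "(1, 0, 0)"] by simp
  qed
  ultimately show "((\<lambda>s. f (s, x, u)) has_real_derivative ?L (1, 0, 0)) (at t)"
    by (simp add: has_field_derivative_def)
  have "((\<lambda>y. f (t, y, u)) has_derivative (\<lambda>s. ?L (0, s, 0))) (at x)"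
    by (rule has_derivative_compose[of "\<lambda>s. (t, s, u)" "\<lambda>s. (0, s, 0)" _ _ f ?L])
       (auto intro!: has_derivative_Pair has_derivative_ident has_derivative_const L)
  moreover have "(\<lambda>s. ?L (0, s, 0)) = (*) (?L (0, 1, 0))"
  proof
    show "?L (0, s, 0) = ?L (0, 1, 0) * s" for s
      using linear_cmul[OF lin, of s "(0, 1, 0)"] by simp
  qed
  ultimately show "((\<lambda>y. f (t, y, u)) has_real_derivative ?L (0, 1, 0)) (at x)"
    by (simp add: has_field_derivative_def)
  have "((\<lambda>w. f (t, x, w)) has_derivative (\<lambda>s. ?L (0, 0, s))) (at u)"
    by (rule has_derivative_compose[of "\<lambda>s. (t, x, s)" "\<lambda>s. (0, 0, s)" _ _ f ?L])
       (auto intro!: has_derivative_Pair has_derivative_ident has_derivative_const L)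
  moreover have "(\<lambda>s. ?L (0, 0, s)) = (*) (?L (0, 0, 1))"
  proof
    show "?L (0, 0, s) = ?L (0, 0, 1) * s" for s
      using linear_cmul[OF lin, of s "(0, 0, 1)"] by simp
  qed
  ultimately show "((\<lambda>w. f (t, x, w)) has_real_derivative ?L (0, 0, 1)) (at u)"
    by (simp add: has_field_derivative_def)
qed

lemma partial3_eq_frechet:
  assumes "f differentiable at p"
  shows "Dt f p = frechet_derivative f (at p) (1, 0, 0)" "Dx f p = frechet_derivative f (at p) (0, 1, 0)"
    "Du f p = frechet_derivative f (at p) (0, 0, 1)"
  using partial3_frechet[of f "fst p" "fst (snd p)" "snd (snd p)"] assms
  by (auto simp: Dt_def Dx_def Du_def split: prod.splits intro: DERIV_imp_deriv)

lemma has_derivative_partial3: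
  assumes "f differentiable at p"
  shows "(f has_derivative (\<lambda>(a, b, c). Dt f p * a + Dx f p * b + Du f p * c)) (at p)"
proof -
  let ?L = "frechet_derivative f (at p)"
  have L: "(f has_derivative ?L) (at p)" using assms frechet_derivative_works by blast
  have lin: "linear ?L" using L by (rule has_derivative_linear)
  have "?L (a, b, c) = Dt f p * a + Dx f p * b + Du f p * c" for a b c
  proof -
    have "?L (a, b, c) = ?L (a *\<^sub>R (1, 0, 0) + b *\<^sub>R (0, 1, 0) + c *\<^sub>R (0, 0, 1))" by simp
    also have "\<dots> = Dt f p * a + Dx f p * b + Du f p * c"
      by (simp only: linear_add[OF lin] linear_cmul[OF lin] partial3_eq_frechet[OF assms]) simp
    finally show ?thesis .
  qed
  then have "?L = (\<lambda>(a, b, c). Dt f p * a + Dx f p * b + Du f p * c)" by auto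
  with L show ?thesis by simp
qed

text \<open>On S the partial derivatives coincide with Frechet derivatives in fixed directions,
  whose smoothness is built into \<open>C_k_on\<close>.\<close>

lemma smooth_on_partial2:
  assumes "open S" "smooth_on S u"
  shows "smooth_on S (dt u)" "smooth_on S (dx u)"
  using smooth_on_imp_differentiable[OF assms(2)]
  by (auto intro!: smooth_on_cong[OF assms(1) smooth_on_frechet_derivative[OF assms(2)]]
      simp: partial2_eq_frechet)

lemma smooth_on_partial3:
  assumes "open S" "smooth_on S f"
  shows "smooth_on S (Dt f)" "smooth_on S (Dx f)" "smooth_on S (Du f)"
  using smooth_on_imp_differentiable[OF assms(2)]
  by (auto intro!: smooth_on_cong[OF assms(1) smooth_on_frechet_derivative[OF assms(2)]]
      simp: partial3_eq_frechet)

section \<open>Chain rules and second derivatives along curves\<close>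

lemma DERIV_compose2:
  assumes "u differentiable at (a s, b s)"
    "(a has_real_derivative a') (at s)" "(b has_real_derivative b') (at s)"
  shows "((\<lambda>s. u (a s, b s)) has_real_derivative dt u (a s, b s) * a' + dx u (a s, b s) * b') (at s)"
proof -
  have "((\<lambda>s. u (a s, b s)) has_derivative (\<lambda>h. dt u (a s, b s) * (a' * h) + dx u (a s, b s) * (b' * h))) (at s)"
    using has_derivative_compose[of "\<lambda>s. (a s, b s)" "\<lambda>h. (a' * h, b' * h)" s UNIV u,
        OF _ has_derivative_partial2[OF assms(1)]] assms(2,3)
    by (auto simp: has_field_derivative_def intro!: has_derivative_Pair)
  moreover have "(\<lambda>h. dt u (a s, b s) * (a' * h) + dx u (a s, b s) * (b' * h)) =
     (*) (dt u (a s, b s) * a' + dx u (a s, b s) * b')"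
    by (auto simp: algebra_simps)
  ultimately show ?thesis by (simp add: has_field_derivative_def)
qed

lemma DERIV_compose3:
  assumes "f differentiable at (a s, b s, c s)"
    "(a has_real_derivative a') (at s)" "(b has_real_derivative b') (at s)" "(c has_real_derivative c') (at s)"
  shows "((\<lambda>s. f (a s, b s, c s)) has_real_derivative
    Dt f (a s, b s, c s) * a' + Dx f (a s, b s, c s) * b' + Du f (a s, b s, c s) * c') (at s)"
proof -
  let ?p = "(a s, b s, c s)"
  have "((\<lambda>s. f (a s, b s, c s)) has_derivative (\<lambda>h. Dt f ?p * (a' * h) + Dx f ?p * (b' * h) + Du f ?p * (c' * h))) (at s)"
    using has_derivative_compose[of "\<lambda>s. (a s, b s, c s)" "\<lambda>h. (a' * h, b' * h, c' * h)" s UNIV f,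
        OF has_derivative_Pair[OF _ has_derivative_Pair] has_derivative_partial3[OF assms(1)]] assms(2-)
    by (simp add: has_field_derivative_def)
  moreover have "(\<lambda>h. Dt f ?p * (a' * h) + Dx f ?p * (b' * h) + Du f ?p * (c' * h)) =
     (*) (Dt f ?p * a' + Dx f ?p * b' + Du f ?p * c')"
    by (auto simp: algebra_simps)
  ultimately show ?thesis by (simp add: has_field_derivative_def)
qed

text \<open>The first derivative is a function on the neighbourhood N of 0, the second only a
  number: differentiating an identity twice at 0 needs the first derivatives near 0 but the second
  ones at 0 alone.\<close>

definition has_2jet :: "real set \<Rightarrow> (real \<Rightarrow> real) \<Rightarrow> (real \<Rightarrow> real) \<Rightarrow> real \<Rightarrow> bool"
  where "has_2jet N f f1 f2 \<longleftrightarrow> open N \<and> 0 \<in> N \<and>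
    (\<forall>h\<in>N. (f has_real_derivative f1 h) (at h)) \<and> (f1 has_real_derivative f2) (at 0)"

lemma has_2jet_unique:
  assumes "has_2jet N f f1 f2" "has_2jet N g g1 g2" "\<And>h. h \<in> N \<Longrightarrow> f h = g h"
  shows "f1 0 = g1 0" "f2 = g2"
proof -
  have *: "f1 h = g1 h" if "h \<in> N" for h
  proof (rule DERIV_unique)
    show "(f has_real_derivative f1 h) (at h)" using assms(1) that by (auto simp: has_2jet_def)
    show "(f has_real_derivative g1 h) (at h)"
      by (rule has_field_derivative_transform_within_open[of g _ _ N])
         (use assms that in \<open>auto simp: has_2jet_def\<close>)
  qed
  show "f1 0 = g1 0" using * assms(1) by (auto simp: has_2jet_def)
  show "f2 = g2"
  proof (rule DERIV_unique)
    show "(f1 has_real_derivative f2) (at 0)" using assms(1) by (auto simp: has_2jet_def)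
    show "(f1 has_real_derivative g2) (at 0)"
      by (rule has_field_derivative_transform_within_open[of g1 _ _ N])
         (use assms * in \<open>auto simp: has_2jet_def\<close>)
  qed
qed

lemma has_2jet_line:
  assumes "open N" "0 \<in> N"
  shows "has_2jet N (\<lambda>h. a + h * b) (\<lambda>_. b) 0"
  using assms by (auto simp: has_2jet_def intro!: derivative_eq_intros)

text \<open>The two mixed derivatives arise separately, one from differentiating each summand of the
  first derivative, and are recorded in both orders.\<close>

lemma has_2jet_compose2:
  assumes S: "open S" "smooth_on S f" and a: "has_2jet N a a1 a2" and b: "has_2jet N b b1 b2"
    and m: "\<And>h. h \<in> N \<Longrightarrow> (a h, b h) \<in> S"
  shows "has_2jet N (\<lambda>h. f (a h, b h)) (\<lambda>h. dt f (a h, b h) * a1 h + dx f (a h, b h) * b1 h)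
    (dt (dt f) (a 0, b 0) * (a1 0)\<^sup>2 + (dx (dt f) (a 0, b 0) + dt (dx f) (a 0, b 0)) * a1 0 * b1 0
     + dx (dx f) (a 0, b 0) * (b1 0)\<^sup>2 + dt f (a 0, b 0) * a2 + dx f (a 0, b 0) * b2)"
proof -
  note ds = smooth_on_partial2[OF S]
  have z: "0 \<in> N" and N: "open N" using a by (auto simp: has_2jet_def)
  have a0: "(a has_real_derivative a1 h) (at h)" and b0: "(b has_real_derivative b1 h) (at h)" if "h \<in> N" for h
    using a b that by (auto simp: has_2jet_def)
  have d: "g differentiable at (a h, b h)" if "smooth_on S g" "h \<in> N" for g :: "real \<times> real \<Rightarrow> real" and h
    using that m by (blast intro: smooth_on_imp_differentiable)
  show ?thesis
    unfolding has_2jet_def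
  proof (intro conjI ballI N z)
    fix h assume "h \<in> N"
    then show "((\<lambda>h. f (a h, b h)) has_real_derivative dt f (a h, b h) * a1 h + dx f (a h, b h) * b1 h) (at h)"
      by (intro DERIV_compose2 d S a0 b0)
  next
    show "((\<lambda>h. dt f (a h, b h) * a1 h + dx f (a h, b h) * b1 h) has_real_derivative
     (dt (dt f) (a 0, b 0) * (a1 0)\<^sup>2 + (dx (dt f) (a 0, b 0) + dt (dx f) (a 0, b 0)) * a1 0 * b1 0
     + dx (dx f) (a 0, b 0) * (b1 0)\<^sup>2 + dt f (a 0, b 0) * a2 + dx f (a 0, b 0) * b2)) (at 0)"
      by (rule DERIV_cong[OF DERIV_add[OF
            DERIV_mult[OF DERIV_compose2[OF d[OF ds(1) z] a0[OF z] b0[OF z]], of a1 a2]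
            DERIV_mult[OF DERIV_compose2[OF d[OF ds(2) z] a0[OF z] b0[OF z]], of b1 b2]]])
         (use a b in \<open>auto simp: has_2jet_def algebra_simps power2_eq_square\<close>)
  qed
qed

lemma has_2jet_compose3:
  assumes S: "open S" "smooth_on S f" and a: "has_2jet N a a1 a2" and b: "has_2jet N b b1 b2"
    and c: "has_2jet N c c1 c2"
    and m: "\<And>h. h \<in> N \<Longrightarrow> (a h, b h, c h) \<in> S" and p: "p = (a 0, b 0, c 0)"
  shows "has_2jet N (\<lambda>h. f (a h, b h, c h))
    (\<lambda>h. Dt f (a h, b h, c h) * a1 h + Dx f (a h, b h, c h) * b1 h + Du f (a h, b h, c h) * c1 h)
    (Dt (Dt f) p * (a1 0)\<^sup>2 + (Dx (Dt f) p + Dt (Dx f) p) * a1 0 * b1 0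
     + (Du (Dt f) p + Dt (Du f) p) * a1 0 * c1 0 + (Du (Dx f) p + Dx (Du f) p) * b1 0 * c1 0
     + Dx (Dx f) p * (b1 0)\<^sup>2 + Du (Du f) p * (c1 0)\<^sup>2
     + Dt f p * a2 + Dx f p * b2 + Du f p * c2)"
proof -
  note ds = smooth_on_partial3[OF S]
  have z: "0 \<in> N" and N: "open N" using a by (auto simp: has_2jet_def)
  have a0: "(a has_real_derivative a1 h) (at h)" and b0: "(b has_real_derivative b1 h) (at h)"
    and c0: "(c has_real_derivative c1 h) (at h)" if "h \<in> N" for h
    using a b c that by (auto simp: has_2jet_def)
  have d: "g differentiable at (a h, b h, c h)" if "smooth_on S g" "h \<in> N" for g :: "point \<Rightarrow> real" and h
    using that m by (blast intro: smooth_on_imp_differentiable)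
  show ?thesis
    unfolding has_2jet_def
  proof (intro conjI ballI N z)
    fix h assume "h \<in> N"
    then show "((\<lambda>h. f (a h, b h, c h)) has_real_derivative 
       Dt f (a h, b h, c h) * a1 h + Dx f (a h, b h, c h) * b1 h + Du f (a h, b h, c h) * c1 h) (at h)"
      by (intro DERIV_compose3 d S a0 b0 c0)
  next
    show "((\<lambda>h. Dt f (a h, b h, c h) * a1 h + Dx f (a h, b h, c h) * b1 h + Du f (a h, b h, c h) * c1 h)
      has_real_derivative
     (Dt (Dt f) p * (a1 0)\<^sup>2 + (Dx (Dt f) p + Dt (Dx f) p) * a1 0 * b1 0
     + (Du (Dt f) p + Dt (Du f) p) * a1 0 * c1 0 + (Du (Dx f) p + Dx (Du f) p) * b1 0 * c1 0
     + Dx (Dx f) p * (b1 0)\<^sup>2 + Du (Du f) p * (c1 0)\<^sup>2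
     + Dt f p * a2 + Dx f p * b2 + Du f p * c2)) (at 0)"
      by (rule DERIV_cong[OF DERIV_add[OF DERIV_add[OF
            DERIV_mult[OF DERIV_compose3[OF d[OF ds(1) z] a0[OF z] b0[OF z] c0[OF z]], of a1 a2]
            DERIV_mult[OF DERIV_compose3[OF d[OF ds(2) z] a0[OF z] b0[OF z] c0[OF z]], of b1 b2]]
            DERIV_mult[OF DERIV_compose3[OF d[OF ds(3) z] a0[OF z] b0[OF z] c0[OF z]], of c1 c2]]])
         (use a b c in \<open>auto simp: has_2jet_def algebra_simps power2_eq_square p\<close>)
  qed
qed


section \<open>Local inverses of smooth plane maps\<close>

text \<open>The inverse function theorem supplies a differentiable inverse g with derivative
  \<open>I (g y)\<close>. As this expresses the derivative of g through g itself, smoothness follows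
  one order at a time.\<close>

lemma smooth_local_inverse:
  fixes F G :: "real \<times> real \<Rightarrow> real"
  assumes D: "open D" "smooth_on D F" "smooth_on D G" "p \<in> D"
    and J: "dt F p * dx G p - dx F p * dt G p \<noteq> 0"
  obtains D' E g where "open D'" "D' \<subseteq> D" "p \<in> D'" "open E" "(\<lambda>q. (F q, G q)) ` D' = E"
    "smooth_on E g" "\<And>q. q \<in> E \<Longrightarrow> g q \<in> D'" "\<And>q. q \<in> E \<Longrightarrow> F (g q) = fst q \<and> G (g q) = snd q"
    "\<And>q. q \<in> D' \<Longrightarrow> g (F q, G q) = q"
proof -
  define j where "j = (\<lambda>q. dt F q * dx G q - dx F q * dt G q)"
  define D0 where "D0 = {q \<in> D. j q \<noteq> 0}"
  define M where "M = (\<lambda>q. (F q, G q))"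
  note sF = smooth_on_partial2[OF D(1,2)] and sG = smooth_on_partial2[OF D(1,3)]
  have sj: "smooth_on D j" unfolding j_def by (intro smooth_intros D sF sG)
  have D0: "open D0"
  proof -
    have "D0 = D \<inter> j -` (- {0})" by (auto simp: D0_def)
    then show ?thesis
      using continuous_open_preimage[OF smooth_on_imp_continuous_on[OF sj] D(1), of "- {0}"] by auto
  qed
  have pD0: "p \<in> D0" using D(4) J by (simp add: D0_def j_def)
  have sub: "D0 \<subseteq> D" by (auto simp: D0_def)
  define L where "L = (\<lambda>q (a, b). (dt F q * a + dx F q * b, dt G q * a + dx G q * b))"
  \<comment> \<open>\<open>L q\<close> is the Jacobian of (F, G) at q, and \<open>I q\<close> is its
    inverse by Cramer's rule: the adjugate divided by the determinant \<open>j q\<close>.\<close>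
  define I where "I = (\<lambda>q (c, d). ((dx G q * c - dx F q * d) / j q, (dt F q * d - dt G q * c) / j q))"
  have blL: "bounded_linear (L q)" for q
    by (rule linear_conv_bounded_linear[THEN iffD1], rule linearI) (auto simp: L_def algebra_simps)
  have blI: "bounded_linear (I q)" for q
    by (rule linear_conv_bounded_linear[THEN iffD1], rule linearI)
       (auto simp: I_def algebra_simps diff_divide_distrib add_divide_distrib)
  have IL: "I q (L q z) = z" if "q \<in> D0" for q z
  proof -
    have "j q \<noteq> 0" using that by (simp add: D0_def)
    moreover have "dx G q * (dt F q * a + dx F q * b) - dx F q * (dt G q * a + dx G q * b) = a * j q"
      "dt F q * (dt G q * a + dx G q * b) - dt G q * (dt F q * a + dx F q * b) = b * j q" for a b
      by (simp_all add: j_def algebra_simps)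
    ultimately show ?thesis by (cases z) (simp add: I_def L_def)
  qed
  have derM: "(M has_derivative L q) (at q)" if "q \<in> D" for q
    using has_derivative_Pair[OF has_derivative_partial2[OF smooth_on_imp_differentiable[OF D(2) that]]
        has_derivative_partial2[OF smooth_on_imp_differentiable[OF D(3) that]]]
    unfolding M_def L_def by (simp add: case_prod_unfold)
  obtain U' V g g' where U': "open U'" "U' \<subseteq> D0" "p \<in> U'" and V: "open V" and
    hom: "homeomorphism U' V M g" and
    der: "\<And>y. y \<in> V \<Longrightarrow> (g has_derivative (g' y)) (at y)" and
    g': "\<And>y. y \<in> V \<Longrightarrow> g' y = inv (blinfun_apply (Blinfun (L (g y))))" and
    bij: "\<And>y. y \<in> V \<Longrightarrow> bij (blinfun_apply (Blinfun (L (g y))))"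
  proof (rule inverse_function_theorem[of D0 M "\<lambda>q. Blinfun (L q)" p "Blinfun (I p)"])
    show "(M has_derivative blinfun_apply (Blinfun (L x))) (at x)" if "x \<in> D0" for x
      using derM[OF subsetD[OF sub that]] by (simp add: bounded_linear_Blinfun_apply[OF blL])
    show "continuous_on D0 (\<lambda>q. Blinfun (L q))"
    proof (rule continuous_on_blinfun_componentwise)
      fix i :: "real \<times> real"
      have "continuous_on D0 (\<lambda>q. L q i)"
        using smooth_on_imp_continuous_on[OF sF(1)] smooth_on_imp_continuous_on[OF sF(2)]
          smooth_on_imp_continuous_on[OF sG(1)] smooth_on_imp_continuous_on[OF sG(2)]
        unfolding L_def case_prod_beta
        by (intro continuous_intros continuous_on_subset[OF _ sub])
      then show "continuous_on D0 (\<lambda>q. blinfun_apply (Blinfun (L q)) i)"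
        by (simp add: bounded_linear_Blinfun_apply[OF blL])
    qed
    show "Blinfun (I p) o\<^sub>L Blinfun (L p) = id_blinfun"
      by (rule blinfun_eqI) (simp add: bounded_linear_Blinfun_apply[OF blL] bounded_linear_Blinfun_apply[OF blI] IL[OF pD0])
  qed (use D0 pD0 in auto)
  have gV: "g q \<in> U'" "M (g q) = q" if "q \<in> V" for q
    using hom that by (auto simp: homeomorphism_def)
  have derg: "(g has_derivative I (g y)) (at y)" if "y \<in> V" for y
  proof -
    have "I (g y) = inv (L (g y))"
      using bij[OF that] IL[of "g y"] gV[OF that] U'(2)
      unfolding bounded_linear_Blinfun_apply[OF blL]
      by (metis (no_types, lifting) bij_inv_eq_iff ext subsetD)
    then show ?thesis using der[OF that] g'[OF that] by (simp add: bounded_linear_Blinfun_apply[OF blL])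
  qed
  have sI: "smooth_on D0 (\<lambda>q. I q v)" for v
    unfolding I_def case_prod_beta
    by (intro smooth_intros D0 smooth_on_subset[OF sF(1) sub] smooth_on_subset[OF sF(2) sub]
        smooth_on_subset[OF sG(1) sub] smooth_on_subset[OF sG(2) sub] smooth_on_subset[OF sj sub])
       (auto simp: D0_def)
  \<comment> \<open>If g is of class k, so is its derivative \<open>I (g x) v\<close>, being g
    followed by a smooth map; hence g is of class k + 1.\<close>
  have "C_k_on k V g" for k
  proof (induction k)
    case 0
    then show ?case using hom by (simp add: homeomorphism_def)
  next
    case (Suc k)
    show ?case
    proof (rule C_k_on_SucI[OF V derg])
      show "C_k_on k V (\<lambda>x. I (g x) v)" for v
        using sI[of v] gV U'(2)
        by (intro C_k_on_compose[OF V D0 _ Suc]) (auto simp: smooth_on_def)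
    qed
  qed
  then have "smooth_on V g" by (simp add: smooth_on_def)
  moreover have "F (g q) = fst q \<and> G (g q) = snd q" if "q \<in> V" for q
    using gV(2)[OF that] unfolding M_def by (metis fst_conv snd_conv)
  moreover have "g (F q, G q) = q" if "q \<in> U'" for q
    using hom that by (auto simp: homeomorphism_def M_def)
  moreover have "M ` U' = V" using hom by (auto simp: homeomorphism_def)
  ultimately show thesis
    using that[of U' V g] U' V gV sub unfolding M_def by blast
qed

lemma partial_cong:
  assumes "open D" "p \<in> D" "\<And>q. q \<in> D \<Longrightarrow> f q = g q"
  shows "dt f p = dt g p" "dx f p = dx g p"
proof -
  obtain t x where p: "p = (t, x)" by (cases p)
  have "open {s. (s, x) \<in> D}" "open {y. (t, y) \<in> D}"
    using open_vimage[OF assms(1), of "\<lambda>s. (s, x)"] open_vimage[OF assms(1), of "\<lambda>y. (t, y)"]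
    by (simp_all add: vimage_def continuous_on_Pair)
  then have "\<forall>\<^sub>F s in nhds t. f (s, x) = g (s, x)" "\<forall>\<^sub>F y in nhds x. f (t, y) = g (t, y)"
    using assms(2,3) by (auto simp: eventually_nhds p)
  then show "dt f p = dt g p" "dx f p = dx g p"
    by (auto simp: dt_def dx_def p intro: deriv_cong_ev)
qed

lemma partial3_cong:
  assumes "open D" "p \<in> D" "\<And>q. q \<in> D \<Longrightarrow> f q = g q"
  shows "Dt f p = Dt g p" "Dx f p = Dx g p" "Du f p = Du g p"
proof -
  obtain t x u where p: "p = (t, x, u)" by (cases p)
  have "open {s. (s, x, u) \<in> D}" "open {y. (t, y, u) \<in> D}" "open {w. (t, x, w) \<in> D}"
    using open_vimage[OF assms(1), of "\<lambda>s. (s, x, u)"] open_vimage[OF assms(1), of "\<lambda>y. (t, y, u)"]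
      open_vimage[OF assms(1), of "\<lambda>w. (t, x, w)"]
    by (simp_all add: vimage_def continuous_on_Pair)
  then have "\<forall>\<^sub>F s in nhds t. f (s, x, u) = g (s, x, u)" "\<forall>\<^sub>F y in nhds x. f (t, y, u) = g (t, y, u)"
    "\<forall>\<^sub>F w in nhds u. f (t, x, w) = g (t, x, w)"
    using assms(2,3) by (auto simp: eventually_nhds p)
  then show "Dt f p = Dt g p" "Dx f p = Dx g p" "Du f p = Du g p"
    by (auto simp: Dt_def Dx_def Du_def p intro: deriv_cong_ev)
qed

section \<open>Solutions with a prescribed jet\<close>

lemma dt_eqI: "((\<lambda>s. u (s, x)) has_real_derivative d) (at t) \<Longrightarrow> dt u (t, x) = d"
  by (simp add: dt_def DERIV_imp_deriv)

lemma dx_eqI: "((\<lambda>y. u (t, y)) has_real_derivative d) (at x) \<Longrightarrow> dx u (t, x) = d"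
  by (simp add: dx_def DERIV_imp_deriv)

lemma heat_solution_iff:
  "heat_solution \<mu> D u \<longleftrightarrow> open D \<and> (\<forall>p\<in>D. snd p \<noteq> 0) \<and> smooth_on D u \<and>
    (\<forall>p\<in>D. dt u p = dx (dx u) p + \<mu> / (snd p)\<^sup>2 * u p)"
  by (auto simp: heat_solution_def dt_def dx_def split: prod.splits)

text \<open>The solutions C and S, normalised at 0, are polynomial, hyperbolic or trigonometric
  according to the sign of \<kappa>. All three cases occur, since \<kappa> = 1/4 - \<mu> will be
  inserted.\<close>

lemma ex_constant_coefficient_ode:
  fixes \<kappa> :: real
  obtains C C1 S S1 where
    "\<And>z. (C has_real_derivative C1 z) (at z)" "\<And>z. (C1 has_real_derivative \<kappa> * C z) (at z)"
    "\<And>z. (S has_real_derivative S1 z) (at z)" "\<And>z. (S1 has_real_derivative \<kappa> * S z) (at z)"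
    "C 0 = 1" "C1 0 = 0" "S 0 = 0" "S1 0 = 1"
proof -
  consider "\<kappa> = 0" | w where "w > 0" "\<kappa> = w\<^sup>2" | w where "w > 0" "\<kappa> = - w\<^sup>2"
    by (metis linorder_neqE_linordered_idom minus_minus neg_0_less_iff_less real_sqrt_gt_zero real_sqrt_pow2 less_imp_le)
  then show thesis
  proof cases
    case 1
    show ?thesis
      by (rule that[of "\<lambda>_. 1" "\<lambda>_. 0" "\<lambda>z. z" "\<lambda>_. 1"]) (auto simp: 1)
  next
    case 2
    show ?thesis
      by (rule that[of "\<lambda>z. cosh (w * z)" "\<lambda>z. w * sinh (w * z)" "\<lambda>z. sinh (w * z) / w" "\<lambda>z. cosh (w * z)"])
         (use 2 in \<open>auto intro!: derivative_eq_intros simp: power2_eq_square\<close>)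
  next
    case 3
    show ?thesis
      by (rule that[of "\<lambda>z. cos (w * z)" "\<lambda>z. - w * sin (w * z)" "\<lambda>z. sin (w * z) / w" "\<lambda>z. cos (w * z)"])
         (use 3 in \<open>auto intro!: derivative_eq_intros simp: power2_eq_square\<close>)
  qed
qed

text \<open>The substitution \<open>z = ln (x / x0)\<close> makes the equation one with constant coefficients.\<close>

lemma ex_homogeneous_ode:
  fixes \<mu> x0 a b :: real
  assumes x0: "x0 \<noteq> 0"
  obtains f f1 where
    "\<And>x. x * x0 > 0 \<Longrightarrow> (f has_real_derivative f1 x) (at x)"
    "\<And>x. x * x0 > 0 \<Longrightarrow> (f1 has_real_derivative - (\<mu> / x\<^sup>2 * f x)) (at x)"
    "f x0 = a" "f1 x0 = b"
proof -
  obtain C C1 S S1 where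
    C: "\<And>z. (C has_real_derivative C1 z) (at z)" "\<And>z. (C1 has_real_derivative (1/4 - \<mu>) * C z) (at z)"
    "\<And>z. (S has_real_derivative S1 z) (at z)" "\<And>z. (S1 has_real_derivative (1/4 - \<mu>) * S z) (at z)"
    and C0: "C 0 = 1" "C1 0 = 0" "S 0 = 0" "S1 0 = 1"
    using ex_constant_coefficient_ode[where \<kappa>="1/4 - \<mu>"] by blast
  \<comment> \<open>The initial slope of F: with f = exp(z/2) F(z) and z' = 1/x, the requirement
    f'(x0) = b reads (F(0)/2 + F'(0)) / x0 = b, where F(0) = a.\<close>
  define k where "k = x0 * b - a / 2"
  define F where "F = (\<lambda>z. a * C z + k * S z)"
  define F1 where "F1 = (\<lambda>z. a * C1 z + k * S1 z)"
  have F: "(F has_real_derivative F1 z) (at z)" for z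
    unfolding F_def F1_def by (auto intro!: derivative_eq_intros C)
  have F1: "(F1 has_real_derivative (1/4 - \<mu>) * F z) (at z)" for z
    unfolding F_def F1_def by (auto intro!: derivative_eq_intros C simp: algebra_simps)
  define z where "z = (\<lambda>x. ln (x / x0))"
  have z: "(z has_real_derivative 1 / x) (at x)" if "x * x0 > 0" for x
    unfolding z_def using that
    by (auto intro!: derivative_eq_intros simp: zero_less_divide_iff zero_less_mult_iff)
  have Fz: "((\<lambda>x. F (z x)) has_real_derivative F1 (z x) * (1 / x)) (at x)" 
    and F1z: "((\<lambda>x. F1 (z x)) has_real_derivative ((1/4 - \<mu>) * F (z x)) * (1 / x)) (at x)" 
    and Ez: "((\<lambda>x. exp (z x / 2)) has_real_derivative exp (z x / 2) / (2 * x)) (at x)" if "x * x0 > 0" for x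
    using DERIV_chain2[OF F z[OF that]] DERIV_chain2[OF F1 z[OF that]]
      DERIV_chain2[OF DERIV_exp DERIV_cdivide[OF z[OF that], of 2]] by (simp_all add: field_simps)
  \<comment> \<open>The factor exp(z/2), which is the square root of x/x0, cancels the first-order
    term produced by the change of variable; what remains is F'' = (1/4 - \<mu>) F.\<close>
  define f where "f = (\<lambda>x. exp (z x / 2) * F (z x))"
  define f1 where "f1 = (\<lambda>x. exp (z x / 2) * (F (z x) / 2 + F1 (z x)) / x)"
  show thesis
  proof (rule that[of f f1])
    fix x assume x: "x * x0 > 0"
    then have [simp]: "x \<noteq> 0" by auto
    show "(f has_real_derivative f1 x) (at x)"
      unfolding f_def f1_def
      by (rule DERIV_cong[OF DERIV_mult[OF Ez[OF x] Fz[OF x]]]) (simp add: field_simps)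
    show "(f1 has_real_derivative - (\<mu> / x\<^sup>2 * f x)) (at x)"
      unfolding f_def f1_def
      by (rule DERIV_cong[OF DERIV_divide[OF DERIV_mult[OF Ez[OF x]
              DERIV_add[OF DERIV_cdivide[OF Fz[OF x]] F1z[OF x]]] DERIV_ident]])
         (auto simp: field_simps power2_eq_square)
  next
    show "f x0 = a" "f1 x0 = b" using x0
      by (auto simp: f_def f1_def z_def F_def F1_def C0 k_def field_simps)
  qed
qed

text \<open>The condition \<open>x * x0 > 0\<close> describes the half-line containing x0 for either
  sign of x0. It is rewritten as an interval with extended real endpoints, on which a continuous
  function has an antiderivative.\<close>

lemma ex_antiderivative_halfline:
  fixes k :: "real \<Rightarrow> real"
  assumes x0: "x0 \<noteq> 0" and k: "continuous_on {x. x * x0 > 0} k"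
  obtains K where "\<And>x. x * x0 > 0 \<Longrightarrow> (K has_real_derivative k x) (at x)" "K x0 = 0"
proof -
  have o: "open {x. x * x0 > 0}" by (intro open_Collect_less continuous_intros)
  have c: "isCont k x" if "x * x0 > 0" for x
    using k o that by (simp add: continuous_on_eq_continuous_at)
  define a b :: ereal where "a = (if x0 > 0 then 0 else - \<infinity>)" and "b = (if x0 > 0 then \<infinity> else 0)"
  have ab: "a < ereal x \<and> ereal x < b \<longleftrightarrow> x * x0 > 0" for x
    using x0 by (auto simp: a_def b_def zero_less_mult_iff zero_ereal_def)
  have "a < b" by (auto simp: a_def b_def)
  then obtain F where F: "\<forall>x. a < ereal x \<longrightarrow> ereal x < b \<longrightarrow> (F has_vector_derivative k x) (at x)"
    using einterval_antiderivative[of a b k] c ab by blast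
  show thesis
  proof (rule that[of "\<lambda>x. F x - F x0"])
    fix x assume "x * x0 > 0"
    then have "(F has_real_derivative k x) (at x)"
      using F ab[of x] by (simp add: has_real_derivative_iff_has_vector_derivative)
    then show "((\<lambda>x. F x - F x0) has_real_derivative k x) (at x)"
      by (auto intro!: derivative_eq_intros)
  qed simp
qed

text \<open>Bootstrapping: the derivatives of f and f1 are f1 and g - \<mu>/x^2 f, so if both
  functions are of class k, both are of class k + 1. The induction has to carry the two
  together.\<close>

lemma smooth_on_ode_solution:
  assumes S: "open S" "0 \<notin> S" "smooth_on S g"
    and f: "\<And>x::real. x \<in> S \<Longrightarrow> (f has_real_derivative f1 x) (at x)"
    and f1: "\<And>x. x \<in> S \<Longrightarrow> (f1 has_real_derivative g x - \<mu> / x\<^sup>2 * f x) (at x)"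
  shows "smooth_on S f" "smooth_on S f1"
proof -
  have s: "smooth_on S (\<lambda>x. - \<mu> / x\<^sup>2)"
    using S by (intro smooth_intros) auto
  have *: "C_k_on k S f \<and> C_k_on k S f1" for k
  proof (induction k)
    case 0
    then show ?case using f f1 by (auto intro!: continuous_at_imp_continuous_on DERIV_isCont)
  next
    case (Suc k)
    have "C_k_on k S (\<lambda>x. g x + (- \<mu> / x\<^sup>2) * f x)"
      using Suc S(3) s
      by (intro C_k_on_add[OF S(1)] C_k_on_bounded_bilinear[OF S(1) bounded_bilinear_mult]) (auto simp: smooth_on_def)
    then have "C_k_on k S (\<lambda>x. g x - \<mu> / x\<^sup>2 * f x)" by simp
    then show ?case
      using Suc C_k_on_SucI_real[OF S(1) f] C_k_on_SucI_real[OF S(1) f1] by blast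
  qed
  then show "smooth_on S f" "smooth_on S f1" by (auto simp: smooth_on_def)
qed

text \<open>Variation of parameters; the Wronskian of the two homogeneous solutions is \<open>1\<close>.\<close>

lemma ex_inhomogeneous_ode:
  fixes \<mu> x0 a b :: real
  assumes x0: "x0 \<noteq> 0" and g: "smooth_on {x. x * x0 > 0} g"
  obtains f f1 where
    "\<And>x. x * x0 > 0 \<Longrightarrow> (f has_real_derivative f1 x) (at x)"
    "\<And>x. x * x0 > 0 \<Longrightarrow> (f1 has_real_derivative g x - \<mu> / x\<^sup>2 * f x) (at x)"
    "f x0 = a" "f1 x0 = b" "smooth_on {x. x * x0 > 0} f" "smooth_on {x. x * x0 > 0} f1"
proof -
  let ?H = "{x. x * x0 > 0}"
  have o: "open ?H" by (intro open_Collect_less continuous_intros)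
  have x0H: "x0 * x0 > 0" using x0 by (metis not_real_square_gt_zero)
  obtain p p1 where p: "\<And>x. x * x0 > 0 \<Longrightarrow> (p has_real_derivative p1 x) (at x)"
    "\<And>x. x * x0 > 0 \<Longrightarrow> (p1 has_real_derivative - (\<mu> / x\<^sup>2 * p x)) (at x)" and p0: "p x0 = 1" "p1 x0 = 0"
    using ex_homogeneous_ode[OF x0] by blast
  obtain q q1 where q: "\<And>x. x * x0 > 0 \<Longrightarrow> (q has_real_derivative q1 x) (at x)"
    "\<And>x. x * x0 > 0 \<Longrightarrow> (q1 has_real_derivative - (\<mu> / x\<^sup>2 * q x)) (at x)" and q0: "q x0 = 0" "q1 x0 = 1"
    using ex_homogeneous_ode[OF x0] by blast
  have cp: "continuous_on ?H p" and cq: "continuous_on ?H q"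
    using p(1) q(1) by (auto intro!: continuous_at_imp_continuous_on DERIV_isCont)
  note cg = smooth_on_imp_continuous_on[OF g]
  obtain P where P: "\<And>x. x * x0 > 0 \<Longrightarrow> (P has_real_derivative p x * g x) (at x)" "P x0 = 0"
    using ex_antiderivative_halfline[OF x0 continuous_on_mult[OF cp cg]] by blast
  obtain Q where Q: "\<And>x. x * x0 > 0 \<Longrightarrow> (Q has_real_derivative q x * g x) (at x)" "Q x0 = 0"
    using ex_antiderivative_halfline[OF x0 continuous_on_mult[OF cq cg]] by blast
  \<comment> \<open>The homogeneous equation has no first-order term, so the Wronskian is constant
    on the half-line; its value is read off at x0.\<close>
  have W: "p x * q1 x - p1 x * q x = 1" if "x * x0 > 0" for x
  proof -
    have "p x * q1 x - p1 x * q x = p x0 * q1 x0 - p1 x0 * q x0"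
    proof (rule has_field_derivative_zero_constant[of ?H, THEN exE])
      show "convex ?H"
      proof (cases "x0 > 0")
        case True
        then have "?H = {0<..}" by (auto simp: zero_less_mult_iff)
        then show ?thesis by simp
      next
        case False
        then have "?H = {..<0}" using x0 by (auto simp: zero_less_mult_iff)
        then show ?thesis by simp
      qed
      show "((\<lambda>x. p x * q1 x - p1 x * q x) has_real_derivative 0) (at x within ?H)" if "x \<in> ?H" for x
      proof -
        have x: "x * x0 > 0" using that by simp
        have "((\<lambda>x. p x * q1 x - p1 x * q x) has_real_derivative 0) (at x)"
          by (rule derivative_eq_intros p[OF x] q[OF x] refl)+ (simp add: algebra_simps)
        then show ?thesis by (rule has_field_derivative_at_within)
      qed
      show "p x * q1 x - p1 x * q x = p x0 * q1 x0 - p1 x0 * q x0"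
        if "\<forall>x\<in>?H. p x * q1 x - p1 x * q x = c" for c
        using that \<open>x * x0 > 0\<close> x0H by simp
    qed
    then show ?thesis using p0 q0 by simp
  qed
  \<comment> \<open>P and Q are antiderivatives of p g and q g vanishing at x0. The last two terms
    form the particular solution with zero initial data, so a and b alone determine the value and
    slope at x0.\<close>
  define f where "f = (\<lambda>x. a * p x + b * q x - p x * Q x + q x * P x)"
  define f1 where "f1 = (\<lambda>x. a * p1 x + b * q1 x - p1 x * Q x + q1 x * P x)"
  have f: "(f has_real_derivative f1 x) (at x)" if x: "x * x0 > 0" for x
    unfolding f_def f1_def
    by (rule derivative_eq_intros p[OF x] q[OF x] P(1)[OF x] Q(1)[OF x] refl)+ (simp add: algebra_simps)
  have f1: "(f1 has_real_derivative g x - \<mu> / x\<^sup>2 * f x) (at x)" if x: "x * x0 > 0" for x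
  proof -
    \<comment> \<open>Writing g as g times the Wronskian turns the claim into an identity that holds
      term by term after differentiation.\<close>
    have e: "g x = g x * (p x * q1 x - p1 x * q x)" using W[OF x] by simp
    show ?thesis
      apply (subst e)
      unfolding f_def f1_def
      by (rule derivative_eq_intros p[OF x] q[OF x] P(1)[OF x] Q(1)[OF x] refl)+ (simp add: algebra_simps)
  qed
  have s: "smooth_on ?H f" "smooth_on ?H f1"
    using smooth_on_ode_solution[OF o _ g, of f f1 \<mu>] f f1 by auto
  show thesis
    by (rule that[of f f1]) (use f f1 s in \<open>auto simp: f_def f1_def p0 q0 P(2) Q(2)\<close>)
qed

text \<open>The series in t - t0 stops because the operator L annihilates its last coefficient f2.
  Thus an ordinary differential equation in x replaces any existence theory for the heat equation,
  and u_xx is left to be dictated by the equation.\<close>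

lemma ex_heat_solution_jet:
  fixes \<mu> t0 x0 c a b e :: real
  assumes x0: "x0 \<noteq> 0"
  obtains D u where "heat_solution \<mu> D u" "(t0, x0) \<in> D"
    "u (t0, x0) = c" "dt u (t0, x0) = a" "dx u (t0, x0) = b"
    "dt (dt u) (t0, x0) = e" "dx (dt u) (t0, x0) = 0" "dt (dx u) (t0, x0) = 0"
proof -
  let ?H = "{x. x * x0 > 0}"
  have o: "open ?H" by (intro open_Collect_less continuous_intros)
  obtain f2 f2' where f2: "\<And>x. x * x0 > 0 \<Longrightarrow> (f2 has_real_derivative f2' x) (at x)"
    "\<And>x. x * x0 > 0 \<Longrightarrow> (f2' has_real_derivative 0 - \<mu> / x\<^sup>2 * f2 x) (at x)"
    "f2 x0 = e" "f2' x0 = 0" "smooth_on ?H f2" "smooth_on ?H f2'"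
    using ex_inhomogeneous_ode[OF x0 smooth_on_const] by blast
  \<comment> \<open>The slope 0 of f1 at x0 makes both mixed derivatives vanish at (t0, x0); its
    value there is u_t, as the value of f2 is u_tt.\<close>
  obtain f1 f1' where f1: "\<And>x. x * x0 > 0 \<Longrightarrow> (f1 has_real_derivative f1' x) (at x)"
    "\<And>x. x * x0 > 0 \<Longrightarrow> (f1' has_real_derivative f2 x - \<mu> / x\<^sup>2 * f1 x) (at x)"
    "f1 x0 = a" "f1' x0 = 0" "smooth_on ?H f1" "smooth_on ?H f1'"
    using ex_inhomogeneous_ode[OF x0 f2(5)] by blast
  obtain f0 f0' where f0: "\<And>x. x * x0 > 0 \<Longrightarrow> (f0 has_real_derivative f0' x) (at x)"
    "\<And>x. x * x0 > 0 \<Longrightarrow> (f0' has_real_derivative f1 x - \<mu> / x\<^sup>2 * f0 x) (at x)"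
    "f0 x0 = c" "f0' x0 = b" "smooth_on ?H f0" "smooth_on ?H f0'"
    using ex_inhomogeneous_ode[OF x0 f1(5)] by blast
  define D where "D = (UNIV :: real set) \<times> ?H"
  have D: "open D" unfolding D_def by (intro open_Times o) auto
  have x0D: "(t, x0) \<in> D" for t using x0 by (auto simp: D_def zero_less_mult_iff linorder_neq_iff)
  define u where "u = (\<lambda>p. f0 (snd p) + (fst p - t0) * f1 (snd p) + (fst p - t0)\<^sup>2 / 2 * f2 (snd p))"
  define ut where "ut = (\<lambda>p. f1 (snd p) + (fst p - t0) * f2 (snd p))"
  define ux where "ux = (\<lambda>p. f0' (snd p) + (fst p - t0) * f1' (snd p) + (fst p - t0)\<^sup>2 / 2 * f2' (snd p))"
  have s: "smooth_on D (\<lambda>p. k (snd p))" if "smooth_on ?H k" for k :: "real \<Rightarrow> real"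
    by (intro smooth_on_compose[OF that D o] smooth_intros D) (auto simp: D_def)
  have su: "smooth_on D u"
    unfolding u_def by (intro smooth_intros s D f0 f1 f2) auto
  have ut: "dt u p = ut p" if "p \<in> D" for p
  proof (cases p)
    case (Pair t x)
    show ?thesis unfolding Pair
      by (rule dt_eqI) (auto simp: u_def ut_def intro!: derivative_eq_intros)
  qed
  have ux: "dx u p = ux p" if "p \<in> D" for p
  proof (cases p)
    case (Pair t x)
    then have x: "x * x0 > 0" using that by (simp add: D_def)
    show ?thesis unfolding Pair
      by (rule dx_eqI, unfold u_def ux_def fst_conv snd_conv)
         (rule derivative_eq_intros f0(1)[OF x] f1(1)[OF x] f2(1)[OF x] refl | simp)+
  qed
  have uxx: "dx (dx u) p = ut p - \<mu> / (snd p)\<^sup>2 * u p" if "p \<in> D" for p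
  proof (cases p)
    case (Pair t x)
    then have x: "x * x0 > 0" using that by (simp add: D_def)
    have "dx (dx u) p = dx ux p" using partial_cong(2)[OF D that ux] .
    also have "\<dots> = ut p - \<mu> / (snd p)\<^sup>2 * u p"
      unfolding Pair
      by (rule dx_eqI, unfold u_def ux_def ut_def fst_conv snd_conv)
         (rule derivative_eq_intros f0(2)[OF x] f1(2)[OF x] f2(2)[OF x] refl | simp add: algebra_simps add_divide_distrib diff_divide_distrib)+
    finally show ?thesis .
  qed
  have x0': "x0 * x0 > 0" using x0 by (metis not_real_square_gt_zero)
  show thesis
  proof (rule that[of D u])
    show "heat_solution \<mu> D u"
      unfolding heat_solution_iff using D su ut uxx by (auto simp: D_def)
    have "dt (dt u) (t0, x0) = dt ut (t0, x0)" using partial_cong(1)[OF D x0D ut] .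
    also have "\<dots> = e" 
      by (rule dt_eqI, unfold ut_def fst_conv snd_conv) (auto intro!: derivative_eq_intros simp: f2)
    finally show "dt (dt u) (t0, x0) = e" .
    have "dx (dt u) (t0, x0) = dx ut (t0, x0)" using partial_cong(2)[OF D x0D ut] .
    also have "\<dots> = 0" 
      by (rule dx_eqI, unfold ut_def fst_conv snd_conv)
        (rule derivative_eq_intros f1(1)[OF x0'] f2(1)[OF x0'] refl | simp add: f1)+
    finally show "dx (dt u) (t0, x0) = 0" .
    have "dt (dx u) (t0, x0) = dt ux (t0, x0)" using partial_cong(1)[OF D x0D ux] .
    also have "\<dots> = 0" 
      by (rule dt_eqI, unfold ux_def fst_conv snd_conv) (auto intro!: derivative_eq_intros simp: f1)
    finally show "dt (dx u) (t0, x0) = 0" .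
  qed (use x0D ut ux in \<open>auto simp: u_def ut_def ux_def f0 f1 f2\<close>)
qed


section \<open>Conditions on a symmetry at a point\<close>

lemma heat_solution_subset:
  "heat_solution \<mu> D u \<Longrightarrow> open D' \<Longrightarrow> D' \<subseteq> D \<Longrightarrow> heat_solution \<mu> D' u"
  unfolding heat_solution_iff by (auto intro: smooth_on_subset)

text \<open>The Hessian quadratic form of f on the vector (a, b, c): the second derivative of f
  along a curve with this velocity, apart from the terms due to its acceleration.\<close>

definition hess :: "(point \<Rightarrow> real) \<Rightarrow> point \<Rightarrow> real \<Rightarrow> real \<Rightarrow> real \<Rightarrow> real"
  where "hess f p a b c = Dt (Dt f) p * a\<^sup>2 + (Dx (Dt f) p + Dt (Dx f) p) * a * b
     + (Du (Dt f) p + Dt (Du f) p) * a * c + (Du (Dx f) p + Dx (Du f) p) * b * c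
     + Dx (Dx f) p * b\<^sup>2 + Du (Du f) p * c\<^sup>2"

locale heat_symmetry =
  fixes \<mu> :: real and U :: "point set" and T X V :: "point \<Rightarrow> real"
  assumes transformation: "point_transformation U (\<lambda>p. (T p, X p, V p))"
    and domain: "U \<subseteq> equation_domain"
    and codomain: "p \<in> U \<Longrightarrow> X p \<noteq> 0"
    and maps: "maps_equation_to_itself \<mu> U (\<lambda>p. (T p, X p, V p))"
begin

lemma open_U: "open U"
  using transformation by (simp add: point_transformation_def)

lemma smooth: "smooth_on U T" "smooth_on U X" "smooth_on U V"
proof -
  have "smooth_on U (\<lambda>p. (T p, X p, V p))" using transformation by (simp add: point_transformation_def)
  then show "smooth_on U T" "smooth_on U X" "smooth_on U V"
    using smooth_on_fst[OF open_U, of "\<lambda>p. (T p, X p, V p)"]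
     smooth_on_fst[OF open_U smooth_on_snd[OF open_U, of "\<lambda>p. (T p, X p, V p)"]]
     smooth_on_snd[OF open_U smooth_on_snd[OF open_U, of "\<lambda>p. (T p, X p, V p)"]]
    by simp_all
qed

text \<open>The determinant in \<open>J\<close> is the Jacobian at (t0, x0) of (t, x) -> (T, X)
  along the graph of u. Where it is nonzero, this base map can be inverted near (t0, x0), so the
  image of a small piece of the graph is again a graph and the symmetry condition applies to
  it.\<close>

lemma ex_push_forward:
  assumes u: "heat_solution \<mu> D u" "(t0, x0) \<in> D" and P: "P = (t0, x0, u (t0, x0))" "P \<in> U"
    and a: "a = dt u (t0, x0)" and b: "b = dx u (t0, x0)"
    and J: "(Dt T P + a * Du T P) * (Dx X P + b * Du X P) - (Dx T P + b * Du T P) * (Dt X P + a * Du X P) \<noteq> 0"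
  obtains D' E v where "open D'" "D' \<subseteq> D" "(t0, x0) \<in> D'" "heat_solution \<mu> E v"
    "\<And>t x. (t, x) \<in> D' \<Longrightarrow> (t, x, u (t, x)) \<in> U"
    "\<And>t x. (t, x) \<in> D' \<Longrightarrow> (T (t, x, u (t, x)), X (t, x, u (t, x))) \<in> E"
    "\<And>t x. (t, x) \<in> D' \<Longrightarrow> v (T (t, x, u (t, x)), X (t, x, u (t, x))) = V (t, x, u (t, x))"
proof -
  have D: "open D" and su: "smooth_on D u" using u(1) by (auto simp: heat_solution_iff)
  define gr where "gr = (\<lambda>q. (fst q, snd q, u q))"
  have sgr: "smooth_on D gr" unfolding gr_def by (intro smooth_intros D su)
  define D1 where "D1 = D \<inter> gr -` U"
  have D1: "open D1"
    unfolding D1_def using continuous_open_preimage[OF smooth_on_imp_continuous_on[OF sgr] D open_U] .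
  have sub: "D1 \<subseteq> D" by (auto simp: D1_def)
  have sf: "smooth_on D1 (\<lambda>q. f (gr q))" if "smooth_on U f" for f :: "point \<Rightarrow> real"
    using smooth_on_compose[OF that D1 open_U smooth_on_subset[OF sgr sub]] by (auto simp: D1_def)
  have p: "(t0, x0) \<in> D1" using P u(2) by (auto simp: D1_def gr_def)
  have grp: "gr (t0, x0) = P" by (simp add: gr_def P)
  have du: "((\<lambda>s. u (s, x0)) has_real_derivative a) (at t0)" "((\<lambda>y. u (t0, y)) has_real_derivative b) (at x0)"
    using partial2_frechet[OF smooth_on_imp_differentiable[OF su u(2)]]
      partial2_eq_frechet[OF smooth_on_imp_differentiable[OF su u(2)]] by (auto simp: a b)
  have d: "dt (\<lambda>q. f (gr q)) (t0, x0) = Dt f P + a * Du f P" 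
    "dx (\<lambda>q. f (gr q)) (t0, x0) = Dx f P + b * Du f P" if "smooth_on U f" for f
  proof -
    have df: "f differentiable at P" using smooth_on_imp_differentiable[OF that P(2)] .
    have "((\<lambda>s. f (s, x0, u (s, x0))) has_real_derivative Dt f P * 1 + Dx f P * 0 + Du f P * a) (at t0)"
      using DERIV_compose3[of f "\<lambda>s. s" t0 "\<lambda>s. x0" "\<lambda>s. u (s, x0)" 1 0 a] df du by (simp add: P)
    then show "dt (\<lambda>q. f (gr q)) (t0, x0) = Dt f P + a * Du f P"
      by (intro dt_eqI) (simp add: gr_def mult.commute)
    have "((\<lambda>y. f (t0, y, u (t0, y))) has_real_derivative Dt f P * 0 + Dx f P * 1 + Du f P * b) (at x0)"
      using DERIV_compose3[of f "\<lambda>s. t0" x0 "\<lambda>s. s" "\<lambda>s. u (t0, s)" 0 1 b] df du by (simp add: P)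
    then show "dx (\<lambda>q. f (gr q)) (t0, x0) = Dx f P + b * Du f P"
      by (intro dx_eqI) (simp add: gr_def mult.commute)
  qed
  have J': "dt (\<lambda>q. T (gr q)) (t0, x0) * dx (\<lambda>q. X (gr q)) (t0, x0) -
     dx (\<lambda>q. T (gr q)) (t0, x0) * dt (\<lambda>q. X (gr q)) (t0, x0) \<noteq> 0"
    using J by (simp add: d smooth)
  obtain D' E g where D': "open D'" "D' \<subseteq> D1" "(t0, x0) \<in> D'" and E: "open E"
    and img: "(\<lambda>q. (T (gr q), X (gr q))) ` D' = E" and g: "smooth_on E g" "\<And>q. q \<in> E \<Longrightarrow> g q \<in> D'"
      "\<And>q. q \<in> D' \<Longrightarrow> g (T (gr q), X (gr q)) = q"
    by (rule smooth_local_inverse[OF D1 sf[OF smooth(1)] sf[OF smooth(2)] p J']) blast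
  \<comment> \<open>The third component along the graph, read in the new variables through the local
    inverse g.\<close>
  define v where "v = (\<lambda>q. V (gr (g q)))"
  have sv: "smooth_on E v"
    unfolding v_def using D'(2) g(2) by (intro smooth_on_compose[OF sf[OF smooth(3)] E D1 g(1)]) auto
  have v: "v (T (gr q), X (gr q)) = V (gr q)" if "q \<in> D'" for q
    using g(3)[OF that] by (simp add: v_def)
  have grD: "graph_over D' u = gr ` D'"
    by (simp add: graph_over_def gr_def case_prod_unfold)
  have "graph_over E v = (\<lambda>q. (fst q, snd q, v q)) ` E"
    by (simp add: graph_over_def case_prod_unfold)
  also have "\<dots> = (\<lambda>p. (T p, X p, V p)) ` graph_over D' u"
    unfolding grD img[symmetric] image_image by (auto simp: v)
  finally have im: "(\<lambda>p. (T p, X p, V p)) ` graph_over D' u = graph_over E v" by simp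
  have inU: "gr q \<in> U" if "q \<in> D'" for q using that D'(2) by (auto simp: D1_def)
  have sol: "heat_solution \<mu> D' u"
    using heat_solution_subset[OF u(1) D'(1)] D'(2) sub by blast
  have hv: "heat_solution \<mu> E v"
    using maps[unfolded maps_equation_to_itself_def, rule_format, of D' E u v]
      D'(1) E sv sol im inU smooth_on_subset[OF su, of D'] D'(2) sub grD by force
  show thesis
  proof (rule that[OF D'(1) _ D'(3) hv])
    show "D' \<subseteq> D" using D'(2) sub by blast
  next
    fix t x assume q: "(t, x) \<in> D'"
    show "(t, x, u (t, x)) \<in> U" using inU[OF q] by (simp add: gr_def)
    show "(T (t, x, u (t, x)), X (t, x, u (t, x))) \<in> E" unfolding img[symmetric] using q by (intro image_eqI[of _ _ "(t, x)"]) (auto simp: gr_def)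
    show "v (T (t, x, u (t, x)), X (t, x, u (t, x))) = V (t, x, u (t, x))" using v[OF q] by (simp add: gr_def)
  qed
qed

text \<open>Here a and b are u_t and u_x, e is u_tt, and vT, vX are the first derivatives of v at
  the image point. The first two relations differentiate v(T, X) = V once. The third differentiates
  it twice along the line with direction (y, z); \<open>S f\<close> is the second derivative of f
  along the lifted line. The hypothesis on y and z makes T stationary, which leaves v_XX as the only
  second derivative of v.\<close>

lemma jet_conditions:
  assumes P: "P = (t0, x0, u0)" "P \<in> U"
    and J: "(Dt T P + a * Du T P) * (Dx X P + b * Du X P) - (Dx T P + b * Du T P) * (Dt X P + a * Du X P) \<noteq> 0"
  obtains vT vX where
    "vT * (Dt T P + a * Du T P) + vX * (Dt X P + a * Du X P) = Dt V P + a * Du V P"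
    "vT * (Dx T P + b * Du T P) + vX * (Dx X P + b * Du X P) = Dx V P + b * Du V P"
    "\<And>y z S. y * (Dt T P + a * Du T P) + z * (Dx T P + b * Du T P) = 0 \<Longrightarrow>
      S = (\<lambda>f. hess f P y z (y * a + z * b) + Du f P * (e * y\<^sup>2 + (a - \<mu> / x0\<^sup>2 * u0) * z\<^sup>2)) \<Longrightarrow>
      (y * (Dt X P + a * Du X P) + z * (Dx X P + b * Du X P))\<^sup>2 * (vT - \<mu> / (X P)\<^sup>2 * V P)
        + vT * S T + vX * S X = S V"
proof -
  have x0: "x0 \<noteq> 0" using P domain by (auto simp: equation_domain_def)
  obtain D u where u: "heat_solution \<mu> D u" "(t0, x0) \<in> D"
    and j: "u (t0, x0) = u0" "dt u (t0, x0) = a" "dx u (t0, x0) = b"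
    "dt (dt u) (t0, x0) = e" "dx (dt u) (t0, x0) = 0" "dt (dx u) (t0, x0) = 0"
    using ex_heat_solution_jet[OF x0] by blast
  have jxx: "dx (dx u) (t0, x0) = a - \<mu> / x0\<^sup>2 * u0"
    using u j by (fastforce simp: heat_solution_iff)
  obtain D' E v where D': "open D'" "D' \<subseteq> D" "(t0, x0) \<in> D'" and v: "heat_solution \<mu> E v"
    and m: "\<And>t x. (t, x) \<in> D' \<Longrightarrow> (t, x, u (t, x)) \<in> U"
    "\<And>t x. (t, x) \<in> D' \<Longrightarrow> (T (t, x, u (t, x)), X (t, x, u (t, x))) \<in> E"
    "\<And>t x. (t, x) \<in> D' \<Longrightarrow> v (T (t, x, u (t, x)), X (t, x, u (t, x))) = V (t, x, u (t, x))"
    by (rule ex_push_forward[OF u, of P a b]) (use P j J in auto)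
  have su: "smooth_on D' u" using u(1) D'(2) by (auto simp: heat_solution_iff intro: smooth_on_subset)
  have E: "open E" "smooth_on E v" using v by (auto simp: heat_solution_iff)
  define Q where "Q = (T P, X P)"
  have QE: "Q \<in> E" using m(2)[OF D'(3)] by (simp add: Q_def P j)
  have vQ: "v Q = V P" using m(3)[OF D'(3)] by (simp add: Q_def P j)
  define vT where "vT = dt v Q"
  define vX where "vX = dx v Q"
  have vXX: "dx (dx v) Q = vT - \<mu> / (X P)\<^sup>2 * V P"
    using v QE vQ by (auto simp: heat_solution_iff Q_def vT_def)
  \<comment> \<open>One computation for all directions. The second-order relation is guarded by
    \<open>t1 = 0\<close>, since otherwise v_TT and v_TX would enter.\<close>
  have key: "vT * t1 + vX * x1 = v1 \<and>
      (t1 = 0 \<longrightarrow> x1\<^sup>2 * (vT - \<mu> / (X P)\<^sup>2 * V P) + vT * S T + vX * S X = S V)"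
    if S: "S = (\<lambda>f. hess f P y z (y * a + z * b) + Du f P * (e * y\<^sup>2 + (a - \<mu> / x0\<^sup>2 * u0) * z\<^sup>2))"
      and 1: "t1 = y * (Dt T P + a * Du T P) + z * (Dx T P + b * Du T P)"
        "x1 = y * (Dt X P + a * Du X P) + z * (Dx X P + b * Du X P)"
        "v1 = y * (Dt V P + a * Du V P) + z * (Dx V P + b * Du V P)"
    for y z S t1 x1 v1
  proof -
    define N where "N = (\<lambda>h. (t0 + h * y, x0 + h * z)) -` D'"
    have N: "open N" "0 \<in> N"
      unfolding N_def using D' by (auto intro!: open_vimage continuous_intros)
    have ND: "(t0 + h * y, x0 + h * z) \<in> D'" if "h \<in> N" for h using that by (simp add: N_def)
    note lt = has_2jet_line[OF N, of t0 y] and lx = has_2jet_line[OF N, of x0 z]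
    define c where "c = (\<lambda>h. u (t0 + h * y, x0 + h * z))"
    obtain c1 where c: "has_2jet N c c1 (e * y\<^sup>2 + (a - \<mu> / x0\<^sup>2 * u0) * z\<^sup>2)" and c1: "c1 0 = y * a + z * b"
      using has_2jet_compose2[OF D'(1) su lt lx ND] 
      by (simp add: j jxx c_def mult.commute)
    have mU: "(t0 + h * y, x0 + h * z, c h) \<in> U" if "h \<in> N" for h using m(1) ND that by (simp add: c_def)
    have P': "P = (t0 + 0 * y, x0 + 0 * z, c 0)" by (simp add: P c_def j)
    then have P'': "(t0, x0, c 0) = P" by simp
    have jet: "\<exists>f1. has_2jet N (\<lambda>h. f (t0 + h * y, x0 + h * z, c h)) f1 (S f) \<and>
        f1 0 = y * (Dt f P + a * Du f P) + z * (Dx f P + b * Du f P)" if "smooth_on U f" for f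
      using has_2jet_compose3[OF open_U that lt lx c mU P']
      by (intro exI conjI) (assumption | simp add: S hess_def c1 P'' algebra_simps)+
    obtain T1 where T1: "has_2jet N (\<lambda>h. T (t0 + h * y, x0 + h * z, c h)) T1 (S T)" "T1 0 = t1"
      using jet[OF smooth(1)] 1 by auto
    obtain X1 where X1: "has_2jet N (\<lambda>h. X (t0 + h * y, x0 + h * z, c h)) X1 (S X)" "X1 0 = x1"
      using jet[OF smooth(2)] 1 by auto
    obtain V1 where V1: "has_2jet N (\<lambda>h. V (t0 + h * y, x0 + h * z, c h)) V1 (S V)" "V1 0 = v1"
      using jet[OF smooth(3)] 1 by auto
    have TXE: "(T (t0 + h * y, x0 + h * z, c h), X (t0 + h * y, x0 + h * z, c h)) \<in> E" if "h \<in> N" for h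
      using m(2) ND that by (simp add: c_def)
    have eq: "v (T (t0 + h * y, x0 + h * z, c h), X (t0 + h * y, x0 + h * z, c h)) = V (t0 + h * y, x0 + h * z, c h)"
      if "h \<in> N" for h using m(3) ND that by (simp add: c_def)
    have Q: "(T (t0 + 0 * y, x0 + 0 * z, c 0), X (t0 + 0 * y, x0 + 0 * z, c 0)) = Q"
      by (simp add: Q_def P'')
    note u12 = has_2jet_unique[OF has_2jet_compose2[OF E T1(1) X1(1) TXE] V1(1) eq, unfolded Q]
    have "vT * t1 + vX * x1 = v1" using u12(1) by (simp add: T1 X1 V1 vT_def vX_def)
    moreover have "x1\<^sup>2 * (vT - \<mu> / (X P)\<^sup>2 * V P) + vT * S T + vX * S X = S V" if "t1 = 0"
      using u12(2) by (simp add: T1 X1 V1 vXX that flip: vT_def vX_def) (simp add: algebra_simps)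
    ultimately show ?thesis by blast
  qed
  show thesis
  proof (rule that[of vT vX])
    show "vT * (Dt T P + a * Du T P) + vX * (Dt X P + a * Du X P) = Dt V P + a * Du V P"
      using key[OF refl refl refl refl, of 1 0] by simp
    show "vT * (Dx T P + b * Du T P) + vX * (Dx X P + b * Du X P) = Dx V P + b * Du V P"
      using key[OF refl refl refl refl, of 0 1] by simp
  qed (use key in blast)
qed

text \<open>Differentiating \<Psi> (\<Phi> p) = p shows that the derivative of \<Phi> is injective;
  between spaces of equal dimension it is then surjective.\<close>

lemma derivative_surjective:
  assumes "P \<in> U"
  obtains y z w where "Dt T P * y + Dx T P * z + Du T P * w = a" "Dt X P * y + Dx X P * z + Du X P * w = b"
    "Dt V P * y + Dx V P * z + Du V P * w = c"
proof -
  let ?\<Phi> = "\<lambda>p. (T p, X p, V p)"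
  obtain \<Psi> where \<Psi>: "open (?\<Phi> ` U)" "smooth_on (?\<Phi> ` U) \<Psi>" "\<forall>p\<in>U. \<Psi> (?\<Phi> p) = p"
    using transformation by (auto simp: point_transformation_def)
  define L where "L = (\<lambda>(y, z, w). (Dt T P * y + Dx T P * z + Du T P * w,
     Dt X P * y + Dx X P * z + Du X P * w, Dt V P * y + Dx V P * z + Du V P * w))"
  have L: "(?\<Phi> has_derivative L) (at P)"
    using has_derivative_Pair[OF has_derivative_partial3[OF smooth_on_imp_differentiable[OF smooth(1) assms]]
       has_derivative_Pair[OF has_derivative_partial3[OF smooth_on_imp_differentiable[OF smooth(2) assms]]
         has_derivative_partial3[OF smooth_on_imp_differentiable[OF smooth(3) assms]]]]
    unfolding L_def by (simp add: case_prod_unfold)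
  obtain M where M: "(\<Psi> has_derivative M) (at (?\<Phi> P))"
    using smooth_on_imp_differentiable[OF \<Psi>(2), of "?\<Phi> P"] assms by (auto simp: differentiable_def)
  have "((\<lambda>p. \<Psi> (?\<Phi> p)) has_derivative (\<lambda>h. M (L h))) (at P)"
    using has_derivative_compose[OF L M] .
  then have "((\<lambda>p. p) has_derivative (\<lambda>h. M (L h))) (at P)"
    by (rule has_derivative_transform_within_open[OF _ open_U assms]) (use \<Psi> in auto)
  then have "(\<lambda>h. M (L h)) = (\<lambda>h. h)"
    using has_derivative_ident has_derivative_unique by blast
  then have "inj L" by (metis injI)
  then have "surj L"
    using linear_injective_imp_surjective[OF has_derivative_linear[OF L]] by simp
  then obtain h where "L h = (a, b, c)" by (metis surjD)
  then show thesis using that by (cases h) (auto simp: L_def)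
qed

text \<open>The determinant is affine in a and b, with the 2x2 minors of the rows dT and dX as
  coefficients. These rows are independent, so some minor is nonzero. Two values of b are provided
  in order to separate the coefficients of relations affine in u_x.\<close>

lemma ex_transversal:
  assumes "P \<in> U"
  obtains a b b' where "b \<noteq> b'"
    "(Dt T P + a * Du T P) * (Dx X P + b * Du X P) - (Dx T P + b * Du T P) * (Dt X P + a * Du X P) \<noteq> 0"
    "(Dt T P + a * Du T P) * (Dx X P + b' * Du X P) - (Dx T P + b' * Du T P) * (Dt X P + a * Du X P) \<noteq> 0"
proof -
  define j0 j1 j2 where j: "j0 = Dt T P * Dx X P - Dx T P * Dt X P" "j1 = Du T P * Dx X P - Dx T P * Du X P"
    "j2 = Dt T P * Du X P - Du T P * Dt X P"
  have J: "(Dt T P + a * Du T P) * (Dx X P + b * Du X P) - (Dx T P + b * Du T P) * (Dt X P + a * Du X P)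
     = j0 + a * j1 + b * j2" for a b
    by (simp add: j algebra_simps)
  obtain y z w where 1: "Dt T P * y + Dx T P * z + Du T P * w = 1" "Dt X P * y + Dx X P * z + Du X P * w = 0"
    using derivative_surjective[OF assms] by metis
  obtain y' z' w' where 2: "Dt T P * y' + Dx T P * z' + Du T P * w' = 0" "Dt X P * y' + Dx X P * z' + Du X P * w' = 1"
    using derivative_surjective[OF assms] by metis
  \<comment> \<open>The Cauchy-Binet formula for the product of the 2x3 matrix with rows dT, dX and
    the two chosen columns; that product is the identity matrix.\<close>
  have "j0 * (y * z' - z * y') + j1 * (w * z' - z * w') + j2 * (y * w' - w * y') =
     (Dt T P * y + Dx T P * z + Du T P * w) * (Dt X P * y' + Dx X P * z' + Du X P * w') -
     (Dt X P * y + Dx X P * z + Du X P * w) * (Dt T P * y' + Dx T P * z' + Du T P * w')"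
    by (simp add: j algebra_simps)
  then have nz: "j0 \<noteq> 0 \<or> j1 \<noteq> 0 \<or> j2 \<noteq> 0" unfolding 1 2 by auto
  obtain a b where ab: "j0 + a * j1 + b * j2 \<noteq> 0"
  proof (cases "j0 = 0")
    case False then show ?thesis using that[of 0 0] by simp
  next
    case True
    then show ?thesis using that[of 1 0] that[of 0 1] nz by auto
  qed
  \<comment> \<open>The value at b is the mean of the values at b - 1 and b + 1, so these cannot
    both vanish.\<close>
  then have "j0 + a * j1 + (b + 1) * j2 \<noteq> 0 \<or> j0 + a * j1 + (b - 1) * j2 \<noteq> 0"
    by (auto simp: algebra_simps)
  then show thesis
    using that[of b "b + 1" a] that[of b "b - 1" a] ab unfolding J by auto
qed

text \<open>This is invertibility in the form used by the later contradictions: by surjectivity some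
  direction changes V to first order while T and X are stationary.\<close>

lemma no_annihilator:
  assumes "P \<in> U"
  shows "\<not> (\<alpha> * Dt T P + \<beta> * Dt X P = Dt V P \<and> \<alpha> * Dx T P + \<beta> * Dx X P = Dx V P \<and>
    \<alpha> * Du T P + \<beta> * Du X P = Du V P)"
proof
  assume *: "\<alpha> * Dt T P + \<beta> * Dt X P = Dt V P \<and> \<alpha> * Dx T P + \<beta> * Dx X P = Dx V P \<and>
    \<alpha> * Du T P + \<beta> * Du X P = Du V P"
  obtain y z w where 1: "Dt T P * y + Dx T P * z + Du T P * w = 0" "Dt X P * y + Dx X P * z + Du X P * w = 0"
    "Dt V P * y + Dx V P * z + Du V P * w = 1"
    using derivative_surjective[OF assms] by metis
  have "Dt V P * y + Dx V P * z + Du V P * w = \<alpha> * (Dt T P * y + Dx T P * z + Du T P * w) +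
     \<beta> * (Dt X P * y + Dx X P * z + Du X P * w)"
    using * by (simp add: algebra_simps flip: * )
  then show False using 1 by simp
qed

text \<open>The second derivative \<open>u_tt\<close> is not restricted by the equation; it would enter the
  transformed equation unless the direction with \<open>D T = 0\<close> is the \<open>x\<close>-direction.\<close>

lemma T_indep:
  assumes "P \<in> U"
  shows "Dx T P = 0" "Du T P = 0" "Dt T P \<noteq> 0"
proof -
  obtain t0 x0 u0 where P: "P = (t0, x0, u0)" by (cases P)
  have main: "Dx T P + b * Du T P = 0"
    if J: "(Dt T P + a * Du T P) * (Dx X P + b * Du X P) - (Dx T P + b * Du T P) * (Dt X P + a * Du X P) \<noteq> 0"
    for a b
  proof (rule ccontr)
    assume nz: "Dx T P + b * Du T P \<noteq> 0"
    \<comment> \<open>The direction (y, z) spans the kernel of dT restricted to the tangent plane of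
      the graph; if the claim fails, its t-component y is nonzero.\<close>
    define y where "y = - (Dx T P + b * Du T P)"
    define z where "z = Dt T P + a * Du T P"
    have yz: "y * (Dt T P + a * Du T P) + z * (Dx T P + b * Du T P) = 0" by (simp add: y_def z_def algebra_simps)
    define S where "S = (\<lambda>e f. hess f P y z (y * a + z * b) + Du f P * (e * y\<^sup>2 + (a - \<mu> / x0\<^sup>2 * u0) * z\<^sup>2))"
    define k where "k = y * (Dt X P + a * Du X P) + z * (Dx X P + b * Du X P)"
    obtain vT vX where 0: "vT * (Dt T P + a * Du T P) + vX * (Dt X P + a * Du X P) = Dt V P + a * Du V P"
      "vT * (Dx T P + b * Du T P) + vX * (Dx X P + b * Du X P) = Dx V P + b * Du V P"
      "k\<^sup>2 * (vT - \<mu> / (X P)\<^sup>2 * V P) + vT * S 0 T + vX * S 0 X = S 0 V"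
      using jet_conditions[OF P assms J, of 0] yz unfolding k_def S_def by metis
    obtain vT' vX' where 1: "vT' * (Dt T P + a * Du T P) + vX' * (Dt X P + a * Du X P) = Dt V P + a * Du V P"
      "vT' * (Dx T P + b * Du T P) + vX' * (Dx X P + b * Du X P) = Dx V P + b * Du V P"
      "k\<^sup>2 * (vT' - \<mu> / (X P)\<^sup>2 * V P) + vT' * S 1 T + vX' * S 1 X = S 1 V"
      using jet_conditions[OF P assms J, of 1] yz unfolding k_def S_def by metis
    \<comment> \<open>The solutions with u_tt = 0 and u_tt = 1 have different images v. Their first
      derivatives at the image point still agree, because the same linear system with determinant
      \<open>J\<close> determines them.\<close>
    have cramer: "c = c' \<and> d = d'"
      if "c * p + d * q = m" "c * r + d * s = n" "c' * p + d' * q = m" "c' * r + d' * s = n" "p * s - r * q \<noteq> 0"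
      for c d c' d' p q r s m n :: real
    proof -
      have "(c - c') * (p * s - r * q) = (c * p + d * q - (c' * p + d' * q)) * s - (c * r + d * s - (c' * r + d' * s)) * q"
        "(d - d') * (p * s - r * q) = (c * r + d * s - (c' * r + d' * s)) * p - (c * p + d * q - (c' * p + d' * q)) * r"
        by (simp_all add: algebra_simps)
      then show ?thesis using that by simp
    qed
    have v: "vT' = vT" "vX' = vX" using cramer[OF 1(1,2) 0(1,2) J] by auto
    have S1: "S 1 f = S 0 f + Du f P * y\<^sup>2" for f by (simp add: S_def algebra_simps)
    \<comment> \<open>The difference of the two second-order relations isolates the coefficient of
      u_tt.\<close>
    have "(vT * Du T P + vX * Du X P - Du V P) * y\<^sup>2 = 0"
      using 0(3) 1(3) unfolding v S1 by (simp add: algebra_simps)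
    then have u: "vT * Du T P + vX * Du X P = Du V P" using nz by (simp add: y_def)
    have "vT * Dt T P + vX * Dt X P = Dt V P + a * Du V P - a * (vT * Du T P + vX * Du X P)"
      "vT * Dx T P + vX * Dx X P = Dx V P + b * Du V P - b * (vT * Du T P + vX * Du X P)"
      using 0(1,2) by (simp_all add: algebra_simps)
    then show False using no_annihilator[OF assms, of vT vX] u by simp
  qed
  obtain a b b' where ab: "b \<noteq> b'"
    "(Dt T P + a * Du T P) * (Dx X P + b * Du X P) - (Dx T P + b * Du T P) * (Dt X P + a * Du X P) \<noteq> 0"
    "(Dt T P + a * Du T P) * (Dx X P + b' * Du X P) - (Dx T P + b' * Du T P) * (Dt X P + a * Du X P) \<noteq> 0"
    by (rule ex_transversal[OF assms])
  \<comment> \<open>An expression affine in the slope that vanishes for two slopes has both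
    coefficients zero.\<close>
  have "Dx T P + b * Du T P = 0" "Dx T P + b' * Du T P = 0" using main ab(2,3) by blast+
  moreover from this have "b * Du T P = b' * Du T P" by linarith
  ultimately show "Du T P = 0" "Dx T P = 0" using ab(1) by auto
  then show "Dt T P \<noteq> 0" using ab(2) by auto
qed

lemma T_second:
  assumes "P \<in> U"
  shows "Dx (Dx T) P = 0" "Du (Dx T) P = 0" "Dx (Du T) P = 0" "Du (Du T) P = 0"
  using partial3_cong[OF open_U assms, of "Dx T" "\<lambda>_. 0"] partial3_cong[OF open_U assms, of "Du T" "\<lambda>_. 0"] T_indep
  by (auto simp: Dx_def Du_def split: prod.splits)

text \<open>Since T depends on t alone, the x-direction is admissible. Put c = X_x + b X_u and
  compare u_t = 0 with u_t = 1: both T_t and c^2, multiplied by the change of vT, equal V_u - vX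
  X_u. Hence c^2 = T_t for every slope b with c nonzero, which leaves no room for X_u.\<close>

lemma X_indep:
  assumes "P \<in> U"
  shows "Du X P = 0" "(Dx X P)\<^sup>2 = Dt T P" "Dx X P \<noteq> 0"
proof -
  obtain t0 x0 u0 where P: "P = (t0, x0, u0)" by (cases P)
  note T = T_indep[OF assms] T_second[OF assms]
  have main: "(Dx X P + b * Du X P)\<^sup>2 = Dt T P" if c: "Dx X P + b * Du X P \<noteq> 0" for b
  proof -
    have ex: "\<exists>vT vX. vT * Dt T P + vX * (Dt X P + a * Du X P) = Dt V P + a * Du V P \<and>
      vX * (Dx X P + b * Du X P) = Dx V P + b * Du V P \<and>
      (Dx X P + b * Du X P)\<^sup>2 * (vT - \<mu> / (X P)\<^sup>2 * V P)
        + vX * (hess X P 0 1 b + Du X P * (a - \<mu> / x0\<^sup>2 * u0)) = hess V P 0 1 b + Du V P * (a - \<mu> / x0\<^sup>2 * u0)"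
      for a
    proof -
      have J: "(Dt T P + a * Du T P) * (Dx X P + b * Du X P) - (Dx T P + b * Du T P) * (Dt X P + a * Du X P) \<noteq> 0"
        using c T by simp
      obtain vT vX where 0: "vT * (Dt T P + a * Du T P) + vX * (Dt X P + a * Du X P) = Dt V P + a * Du V P"
        "vT * (Dx T P + b * Du T P) + vX * (Dx X P + b * Du X P) = Dx V P + b * Du V P"
        and S: "\<And>y z S. y * (Dt T P + a * Du T P) + z * (Dx T P + b * Du T P) = 0 \<Longrightarrow>
      S = (\<lambda>f. hess f P y z (y * a + z * b) + Du f P * (0 * y\<^sup>2 + (a - \<mu> / x0\<^sup>2 * u0) * z\<^sup>2)) \<Longrightarrow>
      (y * (Dt X P + a * Du X P) + z * (Dx X P + b * Du X P))\<^sup>2 * (vT - \<mu> / (X P)\<^sup>2 * V P)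
        + vT * S T + vX * S X = S V"
        using jet_conditions[OF P assms J, of 0] by blast
      have "hess T P 0 1 b = 0" by (simp add: hess_def T)
      then show ?thesis using S[OF _ refl, of 0 1] 0 T by (intro exI[of _ vT] exI[of _ vX]) simp
    qed
    obtain vT vX where 0: "vT * Dt T P + vX * Dt X P = Dt V P"
      "vX * (Dx X P + b * Du X P) = Dx V P + b * Du V P"
      "(Dx X P + b * Du X P)\<^sup>2 * (vT - \<mu> / (X P)\<^sup>2 * V P)
        + vX * (hess X P 0 1 b + Du X P * (- \<mu> / x0\<^sup>2 * u0)) = hess V P 0 1 b + Du V P * (- \<mu> / x0\<^sup>2 * u0)"
      using ex[of 0] by auto
    obtain vT' vX' where 1: "vT' * Dt T P + vX' * (Dt X P + Du X P) = Dt V P + Du V P"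
      "vX' * (Dx X P + b * Du X P) = Dx V P + b * Du V P"
      "(Dx X P + b * Du X P)\<^sup>2 * (vT' - \<mu> / (X P)\<^sup>2 * V P)
        + vX' * (hess X P 0 1 b + Du X P * (1 - \<mu> / x0\<^sup>2 * u0)) = hess V P 0 1 b + Du V P * (1 - \<mu> / x0\<^sup>2 * u0)"
      using ex[of 1] by auto
    have v: "vX' = vX" using 0(2) 1(2) c by (metis mult_right_cancel)
    have a: "(vT' - vT) * Dt T P = Du V P - vX * Du X P"
      using 0(1) 1(1) unfolding v by (simp add: algebra_simps)
    have "(Dx X P + b * Du X P)\<^sup>2 * (vT' - vT) = Du V P - vX * Du X P"
      using 0(3) 1(3) unfolding v by (simp add: algebra_simps)
    with a have *: "((Dx X P + b * Du X P)\<^sup>2 - Dt T P) * (vT' - vT) = 0" by (simp add: algebra_simps)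
    \<comment> \<open>If vT did not react to u_t, then dV would be a combination of dT and
      dX.\<close>
    have "vT' \<noteq> vT"
    proof
      assume "vT' = vT"
      then have 2: "vX * Du X P = Du V P" using a by simp
      then have 3: "vX * Dx X P = Dx V P" using 0(2) by (simp add: algebra_simps)
      show False using no_annihilator[OF assms, of vT vX] 0(1) 2 3 T by simp
    qed
    then show ?thesis using * by simp
  qed
  show u: "Du X P = 0"
  proof (rule ccontr)
    assume nz: "Du X P \<noteq> 0"
    \<comment> \<open>If X_u were nonzero, suitable slopes would give c the values 1 and 2, whose
      squares differ.\<close>
    have "(1::real)\<^sup>2 = Dt T P" using main[of "(1 - Dx X P) / Du X P"] nz by simp
    moreover have "(2::real)\<^sup>2 = Dt T P" using main[of "(2 - Dx X P) / Du X P"] nz by simp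
    ultimately show False by simp
  qed
  obtain a b b' where "(Dt T P + a * Du T P) * (Dx X P + b * Du X P) - (Dx T P + b * Du T P) * (Dt X P + a * Du X P) \<noteq> 0"
    by (rule ex_transversal[OF assms])
  then show x: "Dx X P \<noteq> 0" using u T by auto
  then show "(Dx X P)\<^sup>2 = Dt T P" using main[of 0] by simp
qed

lemma X_second:
  assumes "P \<in> U"
  shows "Dx (Du X) P = 0" "Du (Du X) P = 0"
  using partial3_cong[OF open_U assms, of "Du X" "\<lambda>_. 0"] X_indep
  by (auto simp: Dx_def Du_def split: prod.splits)

text \<open>For u_t = 0 the second-order condition is a quadratic polynomial in the slope b = u_x
  that vanishes for every b. The three conclusions are the vanishing of its coefficients;
  \<open>XX\<close> removes the Hessian of X from it.\<close>

lemma determining_equations: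
  assumes "P \<in> U" and P: "P = (t0, x0, u0)"
    and XX: "Dx (Dx X) P = 0" "Du (Dx X) P = 0"
  shows "Du (Du V) P = 0"
    "Du (Dx V) P + Dx (Du V) P = - (Dt X P / Dx X P) * Du V P"
    "Dt V P - Dt X P / Dx X P * Dx V P = Dx (Dx V) P - \<mu> / x0\<^sup>2 * u0 * Du V P + \<mu> * (Dx X P)\<^sup>2 / (X P)\<^sup>2 * V P"
proof -
  note T = T_indep[OF assms(1)] T_second[OF assms(1)] and X = X_indep[OF assms(1)] X_second[OF assms(1)]
  define q where "q = Dt X P / Dx X P"
  define c where "c = Du (Dx V) P + Dx (Du V) P + q * Du V P"
  define r where "r = Dx (Dx V) P - \<mu> / x0\<^sup>2 * u0 * Du V P + \<mu> * (Dx X P)\<^sup>2 / (X P)\<^sup>2 * V P - Dt V P + q * Dx V P"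
  have main: "Du (Du V) P * b\<^sup>2 + c * b + r = 0" for b
  proof -
    have J: "(Dt T P + 0 * Du T P) * (Dx X P + b * Du X P) - (Dx T P + b * Du T P) * (Dt X P + 0 * Du X P) \<noteq> 0"
      using T X by simp
    obtain vT vX where 0: "vT * (Dt T P + 0 * Du T P) + vX * (Dt X P + 0 * Du X P) = Dt V P + 0 * Du V P"
      "vT * (Dx T P + b * Du T P) + vX * (Dx X P + b * Du X P) = Dx V P + b * Du V P"
      and S: "\<And>y z S. y * (Dt T P + 0 * Du T P) + z * (Dx T P + b * Du T P) = 0 \<Longrightarrow>
      S = (\<lambda>f. hess f P y z (y * 0 + z * b) + Du f P * (0 * y\<^sup>2 + (0 - \<mu> / x0\<^sup>2 * u0) * z\<^sup>2)) \<Longrightarrow>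
      (y * (Dt X P + 0 * Du X P) + z * (Dx X P + b * Du X P))\<^sup>2 * (vT - \<mu> / (X P)\<^sup>2 * V P)
        + vT * S T + vX * S X = S V"
      using jet_conditions[OF P assms(1) J, of 0] by blast
    have hT: "hess T P 0 1 b = 0" and hX: "hess X P 0 1 b = 0" by (simp_all add: hess_def T X XX)
    have S': "(Dx X P)\<^sup>2 * (vT - \<mu> / (X P)\<^sup>2 * V P) = hess V P 0 1 b - Du V P * (\<mu> / x0\<^sup>2 * u0)"
      using S[OF _ refl, of 0 1] T X hT hX by simp
    have vX: "vX = (Dx V P + b * Du V P) / Dx X P" using 0(2) T X by (simp add: field_simps)
    have "(Dx X P)\<^sup>2 * vT = Dt V P - vX * Dt X P" using 0(1) X by (simp add: algebra_simps)
    also have "vX * Dt X P = q * (Dx V P + b * Du V P)" by (simp add: vX q_def)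
    finally have "Dt V P - q * (Dx V P + b * Du V P) - (Dx X P)\<^sup>2 * (\<mu> / (X P)\<^sup>2 * V P) =
        hess V P 0 1 b - Du V P * (\<mu> / x0\<^sup>2 * u0)"
      using S' by (simp add: algebra_simps)
    then show ?thesis by (simp add: hess_def c_def r_def algebra_simps)
  qed
  \<comment> \<open>The values of the quadratic at b = 0, 1 and -1 determine its
    coefficients.\<close>
  have "r = 0" using main[of 0] by simp
  moreover have "Du (Du V) P + c + r = 0" "Du (Du V) P - c + r = 0" using main[of 1] main[of "-1"] by simp_all
  ultimately have 1: "Du (Du V) P = 0" "c = 0" "r = 0" by linarith+
  show "Du (Du V) P = 0" by (rule 1)
  show "Du (Dx V) P + Dx (Du V) P = - (Dt X P / Dx X P) * Du V P"
    using 1(2) unfolding c_def q_def by (simp add: algebra_simps)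
  show "Dt V P - Dt X P / Dx X P * Dx V P = Dx (Dx V) P - \<mu> / x0\<^sup>2 * u0 * Du V P + \<mu> * (Dx X P)\<^sup>2 / (X P)\<^sup>2 * V P"
    using 1(3) unfolding r_def q_def by (simp add: algebra_simps)
qed

end


section \<open>Solution of the determining equations\<close>

lemma smooth_on_DERIV:
  fixes f :: "real \<Rightarrow> real"
  assumes "smooth_on I f" "t \<in> I"
  shows "(f has_real_derivative deriv f t) (at t)"
  using smooth_on_imp_differentiable[OF assms] by (simp add: real_differentiable_def DERIV_deriv_iff_real_differentiable)

lemma smooth_on_deriv:
  fixes f :: "real \<Rightarrow> real"
  assumes "open I" "smooth_on I f"
  shows "smooth_on I (deriv f)"
proof (rule smooth_on_cong[OF assms(1) smooth_on_frechet_derivative[OF assms(2), of 1]])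
  fix t assume "t \<in> I"
  then have "(f has_derivative (*) (deriv f t)) (at t)"
    using smooth_on_DERIV[OF assms(2)] by (simp add: has_field_derivative_def)
  then show "frechet_derivative f (at t) 1 = deriv f t"
    by (metis frechet_derivative_at mult.right_neutral)
qed

lemma DERIV_zero_constant:
  fixes f :: "real \<Rightarrow> real"
  assumes "convex S" "\<And>x. x \<in> S \<Longrightarrow> (f has_real_derivative 0) (at x)" "x \<in> S" "y \<in> S"
  shows "f x = f y"
  using has_field_derivative_zero_constant[OF assms(1), of f] assms
  by (metis has_field_derivative_at_within)

lemma affine_if_DERIV_constant:
  fixes f :: "real \<Rightarrow> real"
  assumes "convex S" "\<And>x. x \<in> S \<Longrightarrow> (f has_real_derivative c) (at x)" "x \<in> S" "y \<in> S"
  shows "f x = f y + c * (x - y)"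
proof -
  have "f x - c * x = f y - c * y"
    by (rule DERIV_zero_constant[of S "\<lambda>x. f x - c * x"]) 
       (use assms in \<open>auto intro!: derivative_eq_intros\<close>)
  then show ?thesis by (simp add: algebra_simps)
qed

text \<open>Written as a logarithmic derivative times the function, in which the sign of g no longer
  appears.\<close>

lemma DERIV_sqrt_abs:
  assumes "(g has_real_derivative g') (at t)" "g t \<noteq> 0"
  shows "((\<lambda>t. sqrt \<bar>g t\<bar>) has_real_derivative g' / (2 * g t) * sqrt \<bar>g t\<bar>) (at t)"
proof -
  have "sgn (g t) / (2 * sqrt \<bar>g t\<bar>) = sqrt \<bar>g t\<bar> / (2 * g t)"
    using assms(2) by (simp add: field_simps sgn_if)
  then have *: "g' * sgn (g t) / (2 * sqrt \<bar>g t\<bar>) = g' / (2 * g t) * sqrt \<bar>g t\<bar>"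
    by (metis times_divide_eq_left times_divide_eq_right mult.commute)
  have "(abs has_real_derivative sgn y) (at y)" if "y \<noteq> 0" for y :: real
  proof (cases "y > 0")
    case True
    then have "((\<lambda>x. x) has_real_derivative sgn y) (at y)" using DERIV_ident by simp
    then show ?thesis
      by (rule has_field_derivative_transform_within_open[where S="{0<..}"]) (use True in auto)
  next
    case False
    then have "((\<lambda>x. - x) has_real_derivative sgn y) (at y)"
      using DERIV_minus[OF DERIV_ident, of y UNIV] that by simp
    then show ?thesis
      by (rule has_field_derivative_transform_within_open[where S="{..<0}"]) (use False that in auto)
  qed
  from DERIV_chain2[OF this[OF assms(2)] assms(1)]
  have "((\<lambda>t. \<bar>g t\<bar>) has_real_derivative g' * sgn (g t)) (at t)"
    by (simp add: mult.commute)
  then have "((\<lambda>t. sqrt \<bar>g t\<bar>) has_real_derivative inverse (sqrt \<bar>g t\<bar>) / 2 * (g' * sgn (g t))) (at t)"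
    using assms(2) by (intro DERIV_chain2[OF DERIV_real_sqrt]) auto
  then show ?thesis using * by (simp add: field_simps)
qed

text \<open>Clearing denominators gives a polynomial with infinitely many zeros, hence the zero
  polynomial. It may therefore be evaluated at the pole x = 0, where it reduces to c \<rho>^2; once
  \<rho> = 0, the values at 1, -1 and 2 determine the quadratic.\<close>

lemma inverse_square_shift_not_quadratic:
  fixes c \<rho> :: real
  assumes J: "open J" "J \<noteq> {}" and c: "c \<noteq> 0"
    and eq: "\<And>x. x \<in> J \<Longrightarrow> x \<noteq> 0 \<and> x + \<rho> \<noteq> 0 \<and> c / (x + \<rho>)\<^sup>2 - c / x\<^sup>2 = p2 * x\<^sup>2 + p1 * x + p0"
  shows "\<rho> = 0" "p2 = 0" "p1 = 0" "p0 = 0"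
proof -
  define p where "p = [:p0, p1, p2:] * [:0, 1:]^2 * [:\<rho>, 1:]^2 - (smult c ([:0, 1:]^2) - smult c ([:\<rho>, 1:]^2))"
  have pv: "poly p x = (p2 * x\<^sup>2 + p1 * x + p0) * x\<^sup>2 * (x + \<rho>)\<^sup>2 - (c * x\<^sup>2 - c * (x + \<rho>)\<^sup>2)" for x
    by (simp add: p_def power2_eq_square algebra_simps)
  have "poly p x = 0" if "x \<in> J" for x
  proof -
    have "(c / y\<^sup>2 - c / x\<^sup>2) * x\<^sup>2 * y\<^sup>2 = c * x\<^sup>2 - c * y\<^sup>2" if "x \<noteq> 0" "y \<noteq> 0" for y
      using that by (simp add: field_simps)
    from this[of "x + \<rho>"] eq[OF that] show ?thesis unfolding pv by (metis right_minus_eq)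
  qed
  moreover have "infinite J" using J empty_interior_finite interior_open by metis
  ultimately have "p = 0" using poly_roots_finite[of p] by (metis (mono_tags, lifting) finite_subset mem_Collect_eq subsetI)
  then have z: "(p2 * x\<^sup>2 + p1 * x + p0) * x\<^sup>2 * (x + \<rho>)\<^sup>2 - (c * x\<^sup>2 - c * (x + \<rho>)\<^sup>2) = 0" for x
    by (simp flip: pv)
  show r: "\<rho> = 0" using z[of 0] c by simp
  have "p2 + p1 + p0 = 0" "p2 - p1 + p0 = 0" "p2 * 4 + p1 * 2 + p0 = 0" using z[of 1] z[of "-1"] z[of 2] r by simp_all
  then show "p2 = 0" "p1 = 0" "p0 = 0" by linarith+
qed

section \<open>Product rules for partial derivatives\<close>

lemma dt_DERIV:
  "smooth_on D u \<Longrightarrow> (t, x) \<in> D \<Longrightarrow> ((\<lambda>s. u (s, x)) has_real_derivative dt u (t, x)) (at t)"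
  using partial2_frechet(1) partial2_eq_frechet(1) smooth_on_imp_differentiable by metis

lemma dx_DERIV:
  "smooth_on D u \<Longrightarrow> (t, x) \<in> D \<Longrightarrow> ((\<lambda>y. u (t, y)) has_real_derivative dx u (t, x)) (at x)"
  using partial2_frechet(2) partial2_eq_frechet(2) smooth_on_imp_differentiable by metis

lemma dt_mult:
  assumes "smooth_on D f" "smooth_on D g" "p \<in> D"
  shows "dt (\<lambda>q. f q * g q) p = dt f p * g p + f p * dt g p"
proof (cases p)
  case (Pair t x)
  then show ?thesis using dt_DERIV[of D f t x] dt_DERIV[of D g t x] assms
    by (auto intro!: dt_eqI derivative_eq_intros)
qed

lemma dx_mult:
  assumes "smooth_on D f" "smooth_on D g" "p \<in> D"
  shows "dx (\<lambda>q. f q * g q) p = dx f p * g p + f p * dx g p"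
proof (cases p)
  case (Pair t x)
  then show ?thesis using dx_DERIV[of D f t x] dx_DERIV[of D g t x] assms
    by (auto intro!: dx_eqI derivative_eq_intros)
qed

lemma dx_dx_mult:
  assumes "open D" "smooth_on D f" "smooth_on D g" "p \<in> D"
  shows "dx (dx (\<lambda>q. f q * g q)) p = dx (dx f) p * g p + 2 * dx f p * dx g p + f p * dx (dx g) p"
proof (cases p)
  case (Pair t x)
  have s: "smooth_on D (dx f)" "smooth_on D (dx g)" using smooth_on_partial2 assms by blast+
  have "dx (dx (\<lambda>q. f q * g q)) p = dx (\<lambda>p. dx f p * g p + f p * dx g p) p"
    by (rule partial_cong(2)[OF assms(1,4)]) (rule dx_mult[OF assms(2,3)])
  also have "\<dots> = dx (dx f) p * g p + 2 * dx f p * dx g p + f p * dx (dx g) p"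
    using dx_mult[OF s(1) assms(3,4)] dx_mult[OF assms(2) s(2) assms(4)] unfolding Pair
    by (intro dx_eqI DERIV_cong[OF DERIV_add[OF
            DERIV_mult[OF dx_DERIV[OF s(1)] dx_DERIV[OF assms(3)]]
            DERIV_mult[OF dx_DERIV[OF assms(2)] dx_DERIV[OF s(2)]]]])
       (use assms(4) Pair in auto)
  finally show ?thesis .
qed

text \<open>The symmetry is T = \<tau>(t), X = s(t) x + r(t), V = A u + B, and q = X_t / X_x.
  \<open>A1\<close> is an ordinary differential equation in x that fixes A up to a factor a(t).
  Inserted into \<open>A2\<close>, it leaves ordinary differential equations in t for s and a,
  together with r = 0. \<open>B\<close> then says that B/A solves the original equation.\<close>

lemma solve_determining_equations:
  fixes \<tau> s r :: "real \<Rightarrow> real" and A B :: "real \<times> real \<Rightarrow> real"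
  defines "q \<equiv> \<lambda>t x. (deriv s t * x + deriv r t) / s t"
  assumes \<mu>: "\<mu> \<noteq> 0"
    and I: "open I" "convex I" "I \<noteq> {}" and J: "open J" "convex J" "J \<noteq> {}" "0 \<notin> J"
    and smooth: "smooth_on I \<tau>" "smooth_on I s" "smooth_on I r" "smooth_on (I \<times> J) A" "smooth_on (I \<times> J) B"
    and s0: "\<And>t. t \<in> I \<Longrightarrow> s t \<noteq> 0" and \<tau>: "\<And>t. t \<in> I \<Longrightarrow> deriv \<tau> t = (s t)\<^sup>2"
    and X0: "\<And>t x. t \<in> I \<Longrightarrow> x \<in> J \<Longrightarrow> s t * x + r t \<noteq> 0"
    and A0: "\<And>t x. t \<in> I \<Longrightarrow> x \<in> J \<Longrightarrow> A (t, x) \<noteq> 0"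
    and A1: "\<And>t x. t \<in> I \<Longrightarrow> x \<in> J \<Longrightarrow> 2 * dx A (t, x) = - q t x * A (t, x)"
    and A2: "\<And>t x. t \<in> I \<Longrightarrow> x \<in> J \<Longrightarrow> dt A (t, x) - q t x * dx A (t, x) =
      dx (dx A) (t, x) - \<mu> / x\<^sup>2 * A (t, x) + \<mu> * (s t)\<^sup>2 / (s t * x + r t)\<^sup>2 * A (t, x)"
    and B: "\<And>t x. t \<in> I \<Longrightarrow> x \<in> J \<Longrightarrow> dt B (t, x) - q t x * dx B (t, x) =
      dx (dx B) (t, x) + \<mu> * (s t)\<^sup>2 / (s t * x + r t)\<^sup>2 * B (t, x)"
  obtains \<alpha> \<beta> \<gamma> \<delta> \<sigma> h where "\<alpha> * \<delta> - \<beta> * \<gamma> = 1" "\<sigma> \<noteq> 0" "heat_solution \<mu> (I \<times> J) h"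
    "\<And>t. t \<in> I \<Longrightarrow> \<gamma> * t + \<delta> \<noteq> 0 \<and> \<tau> t = (\<alpha> * t + \<beta>) / (\<gamma> * t + \<delta>) \<and> s t = 1 / (\<gamma> * t + \<delta>) \<and> r t = 0"
    "\<And>t x. t \<in> I \<Longrightarrow> x \<in> J \<Longrightarrow> A (t, x) = \<sigma> * sqrt \<bar>\<gamma> * t + \<delta>\<bar> * exp (\<gamma> * x\<^sup>2 / (4 * (\<gamma> * t + \<delta>))) \<and>
      B (t, x) = A (t, x) * h (t, x)"
proof -
  obtain t0 x0 where t0: "t0 \<in> I" and x0: "x0 \<in> J" using I J by blast
  have IJ: "open (I \<times> J)" using I J by (simp add: open_Times)
  define m where "m = (\<lambda>t. deriv s t / s t)"
  define n where "n = (\<lambda>t. deriv r t / s t)"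
  have q: "q t x = m t * x + n t" for t x by (simp add: q_def m_def n_def add_divide_distrib)
  have sm: "smooth_on I m" "smooth_on I n" unfolding m_def n_def
    by (intro smooth_intros smooth_on_deriv smooth I s0; assumption)+
  note dm = smooth_on_DERIV[OF sm(1)] and dn = smooth_on_DERIV[OF sm(2)]
  define a where "a = (\<lambda>t. A (t, x0))"
  define a' where "a' = (\<lambda>t. dt A (t, x0))"
  have da: "(a has_real_derivative a' t) (at t)" if "t \<in> I" for t
    using dt_DERIV[OF smooth(4), of t x0] that x0 by (simp add: a_def a'_def)
  \<comment> \<open>The antiderivative of q/2 in x that vanishes at x0, so that A1 integrates to A =
    a(t) exp(-E).\<close>
  define E where "E = (\<lambda>t x. (m t * (x\<^sup>2 - x0\<^sup>2) / 2 + n t * (x - x0)) / 2)"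
  have A: "A (t, x) = a t * exp (- E t x)" if t: "t \<in> I" and x: "x \<in> J" for t x
  proof -
    have "A (t, x) * exp (E t x) = A (t, x0) * exp (E t x0)"
    proof (rule DERIV_zero_constant[OF J(2) _ x x0])
      fix y assume y: "y \<in> J"
      have "((\<lambda>x. A (t, x) * exp (E t x)) has_real_derivative
          dx A (t, y) * exp (E t y) + A (t, y) * (exp (E t y) * (q t y / 2))) (at y)"
        unfolding E_def
        by (rule derivative_eq_intros dx_DERIV[OF smooth(4)] refl | use t y in \<open>simp add: q algebra_simps\<close>)+
      moreover have "dx A (t, y) * exp (E t y) + A (t, y) * (exp (E t y) * (q t y / 2)) =
         (2 * dx A (t, y) + q t y * A (t, y)) / 2 * exp (E t y)"
        by (simp add: algebra_simps)
      ultimately show "((\<lambda>x. A (t, x) * exp (E t x)) has_real_derivative 0) (at y)"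
        using A1[OF t y] by simp
    qed
    also have "E t x0 = 0" by (simp add: E_def)
    finally show ?thesis by (simp add: a_def exp_minus field_simps)
  qed
  have a0: "a t \<noteq> 0" if "t \<in> I" for t using A0[OF that x0] by (simp add: a_def)
  have dE: "((\<lambda>t. E t x) has_real_derivative (deriv m t * (x\<^sup>2 - x0\<^sup>2) / 2 + deriv n t * (x - x0)) / 2) (at t)"
    if t: "t \<in> I" for t x
    unfolding E_def by (rule derivative_eq_intros dm[OF t] dn[OF t] refl | simp)+
  have dtA: "dt A (t, x) = A (t, x) * (a' t / a t - (deriv m t * (x\<^sup>2 - x0\<^sup>2) / 2 + deriv n t * (x - x0)) / 2)"
    if t: "t \<in> I" and x: "x \<in> J" for t x
  proof -
    have "dt A (t, x) = dt (\<lambda>(t, x). a t * exp (- E t x)) (t, x)"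
      using partial_cong(1)[OF IJ, of "(t, x)" A "\<lambda>(t, x). a t * exp (- E t x)"] t x A by auto
    also have "\<dots> = a' t * exp (- E t x) - a t * (exp (- E t x) *
        ((deriv m t * (x\<^sup>2 - x0\<^sup>2) / 2 + deriv n t * (x - x0)) / 2))"
      by (rule dt_eqI, simp only: prod.case)
         (rule DERIV_cong[OF DERIV_mult[OF da[OF t] DERIV_chain2[OF DERIV_exp DERIV_minus[OF dE[OF t]]]]], simp)
    finally have d: "dt A (t, x) = a' t * exp (- E t x) - a t * (exp (- E t x) *
        ((deriv m t * (x\<^sup>2 - x0\<^sup>2) / 2 + deriv n t * (x - x0)) / 2))" .
    define k where "k = a' t / a t"
    have "a' t = a t * k" using a0[OF t] by (simp add: k_def)
    then show ?thesis unfolding A[OF t x] d k_def[symmetric] by (simp add: algebra_simps)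
  qed
  have dxA: "dx A (t, x) = - q t x * A (t, x) / 2" if "t \<in> I" "x \<in> J" for t x
    using A1[OF that] by simp
  have dxx: "dx (dx A) (t, x) = A (t, x) * ((q t x)\<^sup>2 / 4 - m t / 2)" if t: "t \<in> I" and x: "x \<in> J" for t x
  proof -
    have "dx (dx A) (t, x) = dx (\<lambda>(t, x). - q t x * A (t, x) / 2) (t, x)"
      using partial_cong(2)[OF IJ, of "(t, x)" "dx A" "\<lambda>(t, x). - q t x * A (t, x) / 2"] t x dxA by auto
    also have "\<dots> = - (m t * A (t, x) + q t x * dx A (t, x)) / 2"
    proof (rule dx_eqI, simp only: prod.case)
      have "((\<lambda>y. - q t y) has_real_derivative - m t) (at x)"
        unfolding q by (rule derivative_eq_intros refl | simp)+
      moreover have "((\<lambda>y. A (t, y)) has_real_derivative dx A (t, x)) (at x)"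
        using dx_DERIV[OF smooth(4)] t x by simp
      ultimately show "((\<lambda>y. - q t y * A (t, y) / 2) has_real_derivative
          - (m t * A (t, x) + q t x * dx A (t, x)) / 2) (at x)"
        by (intro DERIV_cong[OF DERIV_cdivide[OF DERIV_mult]]) (auto simp: field_simps)
    qed
    also note dxA[OF t x]
    finally show ?thesis by (simp add: power2_eq_square algebra_simps)
  qed
  \<comment> \<open>A2 divided by A. The derivatives of A contribute only polynomials in x of degree
    at most 2, which isolates the two inverse squares.\<close>
  have poly: "\<mu> / (x + r t / s t)\<^sup>2 - \<mu> / x\<^sup>2 = (- deriv m t / 4 + (m t)\<^sup>2 / 4) * x\<^sup>2
      + (- deriv n t / 2 + m t * n t / 2) * x
      + (a' t / a t + deriv m t * x0\<^sup>2 / 4 + deriv n t * x0 / 2 + m t / 2 + (n t)\<^sup>2 / 4)"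
    if t: "t \<in> I" and x: "x \<in> J" for t x
  proof -
    have "A (t, x) * (a' t / a t - (deriv m t * (x\<^sup>2 - x0\<^sup>2) / 2 + deriv n t * (x - x0)) / 2 + (q t x)\<^sup>2 / 2)
      = A (t, x) * ((q t x)\<^sup>2 / 4 - m t / 2 - \<mu> / x\<^sup>2 + \<mu> * (s t)\<^sup>2 / (s t * x + r t)\<^sup>2)"
      using A2[OF t x] unfolding dtA[OF t x] dxx[OF t x] dxA[OF t x] by (simp add: algebra_simps power2_eq_square)
    then have *: "a' t / a t - (deriv m t * (x\<^sup>2 - x0\<^sup>2) / 2 + deriv n t * (x - x0)) / 2 + (q t x)\<^sup>2 / 2
      = (q t x)\<^sup>2 / 4 - m t / 2 - \<mu> / x\<^sup>2 + \<mu> * (s t)\<^sup>2 / (s t * x + r t)\<^sup>2"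
      using A0[OF t x] by simp
    have "s t * x + r t = s t * (x + r t / s t)" using s0[OF t] by (simp add: field_simps)
    then have "\<mu> * (s t)\<^sup>2 / (s t * x + r t)\<^sup>2 = \<mu> / (x + r t / s t)\<^sup>2"
      using s0[OF t] by (simp add: power_mult_distrib)
    then have "\<mu> / (x + r t / s t)\<^sup>2 - \<mu> / x\<^sup>2 = 
       a' t / a t - (deriv m t * (x\<^sup>2 - x0\<^sup>2) / 2 + deriv n t * (x - x0)) / 2 + (q t x)\<^sup>2 / 4 + m t / 2"
      using * by linarith
    also have "k - (d * (x\<^sup>2 - x0\<^sup>2) / 2 + d' * (x - x0)) / 2 + (q t x)\<^sup>2 / 4 + m t / 2 =
        (- d / 4 + (m t)\<^sup>2 / 4) * x\<^sup>2 + (- d' / 2 + m t * n t / 2) * x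
      + (k + d * x0\<^sup>2 / 4 + d' * x0 / 2 + m t / 2 + (n t)\<^sup>2 / 4)" for k d d'
      by (simp add: q field_simps power2_eq_square)
    finally show ?thesis .
  qed
  have ne: "x \<noteq> 0 \<and> x + r t / s t \<noteq> 0" if "t \<in> I" "x \<in> J" for t x
  proof
    show "x \<noteq> 0" using that J by auto
    have "s t * (x + r t / s t) \<noteq> 0" using X0[OF that] s0[OF that(1)] by (simp add: algebra_simps)
    then show "x + r t / s t \<noteq> 0" by auto
  qed
  have shift: "r t / s t = 0" "- deriv m t / 4 + (m t)\<^sup>2 / 4 = 0"
    "a' t / a t + deriv m t * x0\<^sup>2 / 4 + deriv n t * x0 / 2 + m t / 2 + (n t)\<^sup>2 / 4 = 0" if "t \<in> I" for t
  proof -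
    note eq = conjI[OF ne[OF that, THEN conjunct1] conjI[OF ne[OF that, THEN conjunct2] poly[OF that]]]
    note * = inverse_square_shift_not_quadratic[OF J(1,3) \<mu> eq]
    show "r t / s t = 0" "- deriv m t / 4 + (m t)\<^sup>2 / 4 = 0"
      "a' t / a t + deriv m t * x0\<^sup>2 / 4 + deriv n t * x0 / 2 + m t / 2 + (n t)\<^sup>2 / 4 = 0"
      by (rule *(1), assumption+) (rule *(2), assumption+, rule *(4))
  qed
  have r0: "r t = 0" if "t \<in> I" for t using shift(1)[OF that] s0[OF that] by simp
  have "deriv r t = 0" if "t \<in> I" for t
  proof -
    have "((\<lambda>_. 0) has_real_derivative deriv r t) (at t)"
      by (rule has_field_derivative_transform_within_open[OF smooth_on_DERIV[OF smooth(3) that] I(1) that]) (rule r0)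
    then show ?thesis using DERIV_const DERIV_unique by blast
  qed
  then have n0: "n t = 0" if "t \<in> I" for t using that by (simp add: n_def)
  have dn0: "deriv n t = 0" if "t \<in> I" for t
  proof -
    have "((\<lambda>_. 0) has_real_derivative deriv n t) (at t)"
      by (rule has_field_derivative_transform_within_open[OF dn[OF that] I(1) that]) (rule n0)
    then show ?thesis using DERIV_const DERIV_unique by blast
  qed
  \<comment> \<open>The coefficient of x^2 gives a Riccati equation for m = s'/s, and the constant
    coefficient gives a linear equation for a.\<close>
  have m': "deriv m t = (m t)\<^sup>2" if "t \<in> I" for t using shift(2)[OF that] by simp
  have a': "a' t = - (m t / 2 + (m t)\<^sup>2 * x0\<^sup>2 / 4) * a t" if "t \<in> I" for t
    using shift(3)[OF that] a0[OF that] n0[OF that] dn0[OF that] m'[OF that] by (simp add: field_simps)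
  define g where "g = (\<lambda>t. 1 / s t)"
  have g0: "g t \<noteq> 0" if "t \<in> I" for t using s0[OF that] by (simp add: g_def)
  have dg: "(g has_real_derivative - (m t * g t)) (at t)" if "t \<in> I" for t
    unfolding g_def m_def
    by (rule derivative_eq_intros smooth_on_DERIV[OF smooth(2) that] refl s0[OF that])+ (simp add: s0[OF that])
  define \<gamma> where "\<gamma> = - (m t0 * g t0)"
  \<comment> \<open>For g = 1/s one has g' = -m g, and the Riccati equation makes this constant. So
    \<gamma> is the slope of g, and g is the denominator of the final formula.\<close>
  have g': "- (m t * g t) = \<gamma>" if "t \<in> I" for t
    unfolding \<gamma>_def
  proof (rule DERIV_zero_constant[OF I(2) _ that t0])
    fix t assume t: "t \<in> I"
    show "((\<lambda>t. - (m t * g t)) has_real_derivative 0) (at t)"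
      by (rule derivative_eq_intros dm[OF t] dg[OF t] refl)+ (simp add: m'[OF t] power2_eq_square)
  qed
  define \<delta> where "\<delta> = g t0 - \<gamma> * t0"
  have g: "g t = \<gamma> * t + \<delta>" if "t \<in> I" for t
    using affine_if_DERIV_constant[OF I(2) _ that t0, of g \<gamma>] dg g' by (simp add: \<delta>_def algebra_simps)
  have m: "m t = - \<gamma> / g t" if "t \<in> I" for t using g'[OF that] g0[OF that] by (simp add: field_simps)
  \<comment> \<open>The numerator of \<tau>. Since \<tau>' = 1/g^2 and g' = \<gamma>, its derivative
    1/g + \<gamma> \<tau> is constant, so N is affine and \<tau> is fractional linear.\<close>
  define N where "N = (\<lambda>t. \<tau> t * g t)"
  define N' where "N' = (\<lambda>t. 1 / g t + \<gamma> * \<tau> t)"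
  have d\<tau>: "(\<tau> has_real_derivative 1 / (g t)\<^sup>2) (at t)" if "t \<in> I" for t
    using smooth_on_DERIV[OF smooth(1) that] \<tau>[OF that] by (simp add: g_def power_divide)
  have dg': "(g has_real_derivative \<gamma>) (at t)" if "t \<in> I" for t using dg[OF that] g'[OF that] by simp
  have dN: "(N has_real_derivative N' t) (at t)" if t: "t \<in> I" for t
    unfolding N_def N'_def
    by (rule derivative_eq_intros d\<tau>[OF t] dg'[OF t] refl)+ (use g0[OF t] in \<open>simp add: field_simps power2_eq_square\<close>)
  have N': "N' t = N' t0" if "t \<in> I" for t
  proof (rule DERIV_zero_constant[OF I(2) _ that t0])
    fix t assume t: "t \<in> I"
    show "(N' has_real_derivative 0) (at t)" unfolding N'_def
      by (rule derivative_eq_intros d\<tau>[OF t] dg'[OF t] refl g0[OF t])+ (use g0[OF t] in \<open>simp add: field_simps power2_eq_square\<close>)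
  qed
  define \<alpha> where "\<alpha> = N' t0"
  define \<beta> where "\<beta> = N t0 - \<alpha> * t0"
  have N: "N t = \<alpha> * t + \<beta>" if "t \<in> I" for t
    using affine_if_DERIV_constant[OF I(2) _ that t0, of N \<alpha>] dN N' by (simp add: \<alpha>_def \<beta>_def algebra_simps)
  have "\<alpha> * g t0 - N t0 * \<gamma> = 1" using g0[OF t0] by (simp add: \<alpha>_def N'_def N_def algebra_simps)
  then have det: "\<alpha> * \<delta> - \<beta> * \<gamma> = 1" by (simp add: g[OF t0] N[OF t0] algebra_simps)
  \<comment> \<open>Absorbs the arbitrary base point x0 from the normalisation of E, so that A =
    b(t) exp(\<gamma> x^2 / (4 g)). Its equation b' = -(m/2) b is that of the square root of |g|,
    and the constant ratio is \<sigma>.\<close>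
  define b where "b = (\<lambda>t. a t * exp (m t * x0\<^sup>2 / 4))"
  have db: "(b has_real_derivative - m t / 2 * b t) (at t)" if t: "t \<in> I" for t
    unfolding b_def
    by (rule DERIV_cong[OF DERIV_mult[OF da[OF t] DERIV_chain2[OF DERIV_exp
            DERIV_cdivide[OF DERIV_cmult_right[OF dm[OF t]]]]]])
       (simp add: a'[OF t] m'[OF t] algebra_simps)
  define \<sigma> where "\<sigma> = b t0 / sqrt \<bar>g t0\<bar>"
  have \<sigma>0: "\<sigma> \<noteq> 0" using a0[OF t0] g0[OF t0] by (simp add: \<sigma>_def b_def)
  have b: "b t = \<sigma> * sqrt \<bar>g t\<bar>" if "t \<in> I" for t
  proof -
    have "b t / sqrt \<bar>g t\<bar> = \<sigma>" unfolding \<sigma>_def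
    proof (rule DERIV_zero_constant[OF I(2) _ that t0])
      fix t assume t: "t \<in> I"
      have "((\<lambda>t. b t / sqrt \<bar>g t\<bar>) has_real_derivative
        (- m t / 2 * b t * sqrt \<bar>g t\<bar> - b t * (\<gamma> / (2 * g t) * sqrt \<bar>g t\<bar>)) / (sqrt \<bar>g t\<bar> * sqrt \<bar>g t\<bar>)) (at t)"
        by (rule DERIV_divide[OF db[OF t] DERIV_sqrt_abs[OF dg'[OF t] g0[OF t]]]) (use g0[OF t] in simp)
      moreover have "- m t / 2 * b t * sqrt \<bar>g t\<bar> - b t * (\<gamma> / (2 * g t) * sqrt \<bar>g t\<bar>) = 0"
        using g0[OF t] by (simp add: m[OF t])
      ultimately show "((\<lambda>t. b t / sqrt \<bar>g t\<bar>) has_real_derivative 0) (at t)" by simp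
    qed
    then show ?thesis using g0[OF that] by (simp add: field_simps)
  qed
  have A': "A (t, x) = \<sigma> * sqrt \<bar>\<gamma> * t + \<delta>\<bar> * exp (\<gamma> * x\<^sup>2 / (4 * (\<gamma> * t + \<delta>)))" if t: "t \<in> I" and x: "x \<in> J" for t x
  proof -
    have "- E t x = m t * x0\<^sup>2 / 4 + \<gamma> * x\<^sup>2 / (4 * g t)"
      using g0[OF t] by (simp add: E_def n0[OF t] m[OF t] field_simps)
    then have "A (t, x) = b t * exp (\<gamma> * x\<^sup>2 / (4 * g t))"
      by (simp add: A[OF t x] b_def exp_add)
    then show ?thesis by (simp add: b[OF t] g[OF t])
  qed
  define h where "h = (\<lambda>p. B p / A p)"
  have A0': "A p \<noteq> 0" if "p \<in> I \<times> J" for p using A0 that by auto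
  have sh: "smooth_on (I \<times> J) h" unfolding h_def by (intro smooth_intros IJ smooth A0')
  have Bh: "B p = A p * h p" if "p \<in> I \<times> J" for p using A0'[OF that] by (simp add: h_def)
  have "heat_solution \<mu> (I \<times> J) h"
    unfolding heat_solution_iff
  proof (intro conjI ballI IJ sh)
    fix p assume p: "p \<in> I \<times> J"
    then show "snd p \<noteq> 0" using J by auto
    obtain t x where tx: "p = (t, x)" "t \<in> I" "x \<in> J" using p by auto
    have 1: "dt B p = dt A p * h p + A p * dt h p"
      using partial_cong(1)[OF IJ p Bh] dt_mult[OF smooth(4) sh p] by simp
    have 2: "dx B p = dx A p * h p + A p * dx h p"
      using partial_cong(2)[OF IJ p Bh] dx_mult[OF smooth(4) sh p] by simp
    have 3: "dx (dx B) p = dx (dx A) p * h p + 2 * dx A p * dx h p + A p * dx (dx h) p"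
    proof -
      have "dx B p = dx (\<lambda>q. A q * h q) p" if "p \<in> I \<times> J" for p using partial_cong(2)[OF IJ that Bh] by simp
      then show ?thesis using partial_cong(2)[OF IJ p, of "dx B" "dx (\<lambda>q. A q * h q)"] dx_dx_mult[OF IJ smooth(4) sh p] by simp
    qed
    define k where "k = \<mu> * (s t)\<^sup>2 / (s t * x + r t)\<^sup>2"
    have e: "dt A p - q t x * dx A p = dx (dx A) p - \<mu> / x\<^sup>2 * A p + k * A p" "2 * dx A p = - q t x * A p"
      "dt B p - q t x * dx B p = dx (dx B) p + k * (A p * h p)"
      using A1[OF tx(2,3)] A2[OF tx(2,3)] B[OF tx(2,3)] Bh[OF p] by (simp_all add: tx(1) k_def)
    \<comment> \<open>After B = A h is inserted, the equation for A removes the terms in h, apart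
      from the potential, and A1 removes those in h_x.\<close>
    have "A p * (dt h p - dx (dx h) p - \<mu> / x\<^sup>2 * h p) =
      (dt B p - q t x * dx B p - dx (dx B) p - k * (A p * h p))
      - (dt A p - q t x * dx A p - dx (dx A) p + \<mu> / x\<^sup>2 * A p - k * A p) * h p
      + (2 * dx A p + q t x * A p) * dx h p"
      unfolding 1 2 3 by (simp add: algebra_simps)
    also have "\<dots> = 0" using e by simp
    finally show "dt h p = dx (dx h) p + \<mu> / (snd p)\<^sup>2 * h p" using A0'[OF p] by (simp add: tx)
  qed
  moreover have "\<gamma> * t + \<delta> \<noteq> 0 \<and> \<tau> t = (\<alpha> * t + \<beta>) / (\<gamma> * t + \<delta>) \<and> s t = 1 / (\<gamma> * t + \<delta>) \<and> r t = 0"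
    if "t \<in> I" for t
  proof -
    have "s t = 1 / g t" by (simp add: g_def)
    moreover have "\<tau> t = N t / g t" using g0[OF that] by (simp add: N_def)
    ultimately show ?thesis using g0[OF that] r0[OF that] by (simp add: g[OF that] N[OF that])
  qed
  ultimately show thesis using that[OF det \<sigma>0, of h] A' Bh by blast
qed


section \<open>Local form of a symmetry\<close>

lemma partial3_affine:
  assumes "smooth_on D F" "smooth_on D G" "(t, x) \<in> D"
  shows "Dt (\<lambda>(t, x, u). F (t, x) * u + G (t, x)) (t, x, u) = dt F (t, x) * u + dt G (t, x)"
    "Dx (\<lambda>(t, x, u). F (t, x) * u + G (t, x)) (t, x, u) = dx F (t, x) * u + dx G (t, x)"
    "Du (\<lambda>(t, x, u). F (t, x) * u + G (t, x)) (t, x, u) = F (t, x)"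
proof -
  have "((\<lambda>s. F (s, x) * u + G (s, x)) has_real_derivative dt F (t, x) * u + dt G (t, x)) (at t)"
    by (intro DERIV_add DERIV_cmult_right dt_DERIV[OF assms(1)] dt_DERIV[OF assms(2)] assms(3))
  then show "Dt (\<lambda>(t, x, u). F (t, x) * u + G (t, x)) (t, x, u) = dt F (t, x) * u + dt G (t, x)"
    by (simp add: Dt_def DERIV_imp_deriv)
  have "((\<lambda>y. F (t, y) * u + G (t, y)) has_real_derivative dx F (t, x) * u + dx G (t, x)) (at x)"
    by (intro DERIV_add DERIV_cmult_right dx_DERIV[OF assms(1)] dx_DERIV[OF assms(2)] assms(3))
  then show "Dx (\<lambda>(t, x, u). F (t, x) * u + G (t, x)) (t, x, u) = dx F (t, x) * u + dx G (t, x)"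
    by (simp add: Dx_def DERIV_imp_deriv)
  have "((\<lambda>w. F (t, x) * w + G (t, x)) has_real_derivative F (t, x)) (at u)"
    by (auto intro!: derivative_eq_intros)
  then show "Du (\<lambda>(t, x, u). F (t, x) * u + G (t, x)) (t, x, u) = F (t, x)"
    by (simp add: Du_def DERIV_imp_deriv)
qed

lemma Dx_DERIV:
  "smooth_on D f \<Longrightarrow> (t, x, u) \<in> D \<Longrightarrow> ((\<lambda>y. f (t, y, u)) has_real_derivative Dx f (t, x, u)) (at x)"
  using partial3_frechet(2) partial3_eq_frechet(2) smooth_on_imp_differentiable by metis

lemma Du_DERIV:
  "smooth_on D f \<Longrightarrow> (t, x, u) \<in> D \<Longrightarrow> ((\<lambda>w. f (t, x, w)) has_real_derivative Du f (t, x, u)) (at u)"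
  using partial3_frechet(3) partial3_eq_frechet(3) smooth_on_imp_differentiable by metis

text \<open>In a box with convex sides a function whose partial derivative in one variable vanishes
  is independent of that variable.\<close>

lemma open_box:
  fixes U :: "point set"
  assumes "open U" "(t, x, u) \<in> U"
  obtains I J K where "open I" "convex I" "t \<in> I" "open J" "convex J" "x \<in> J" "open K" "convex K" "u \<in> K"
    "I \<times> J \<times> K \<subseteq> U"
proof -
  obtain I0 B where 1: "open I0" "open B" "(t, x, u) \<in> I0 \<times> B" "I0 \<times> B \<subseteq> U"
    using open_prod_elim[OF assms] by metis
  obtain J0 K0 where 2: "open J0" "open K0" "(x, u) \<in> J0 \<times> K0" "J0 \<times> K0 \<subseteq> B"
    using open_prod_elim[OF 1(2), of "(x, u)"] 1(3) by auto
  obtain d1 d2 d3 where "d1 > 0" "ball t d1 \<subseteq> I0" "d2 > 0" "ball x d2 \<subseteq> J0" "d3 > 0" "ball u d3 \<subseteq> K0"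
    using 1 2 by (metis mem_Sigma_iff open_contains_ball)
  moreover from this have "ball t d1 \<times> ball x d2 \<times> ball u d3 \<subseteq> U" using 1(4) 2(4) by blast
  ultimately show thesis
    using that[of "ball t d1" "ball x d2" "ball u d3"] by simp
qed

context heat_symmetry
begin

lemma local_symmetry_form:
  assumes \<mu>: "\<mu> \<noteq> 0" and P: "P \<in> U"
  obtains W where "open W" "P \<in> W" "W \<subseteq> U" "has_symmetry_form \<mu> W (\<lambda>p. (T p, X p, V p))"
proof -
  obtain t0 x0 u0 where P': "P = (t0, x0, u0)" by (cases P)
  obtain I J K where I: "open I" "convex I" "t0 \<in> I" and J: "open J" "convex J" "x0 \<in> J"
    and K: "open K" "convex K" "u0 \<in> K" and box: "I \<times> J \<times> K \<subseteq> U"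
    using open_box[OF open_U P[unfolded P']] by blast
  let ?W = "I \<times> J \<times> K"
  have W: "open ?W" using I J K by (simp add: open_Times)
  have IJ: "open (I \<times> J)" using I J by (simp add: open_Times)
  have inU: "(t, x, u) \<in> U" if "t \<in> I" "x \<in> J" "u \<in> K" for t x u using that box by auto
  have const_x: "f (t, x, u) = f (t, y, u)"
    if "smooth_on U f" "\<And>p. p \<in> ?W \<Longrightarrow> Dx f p = 0" "t \<in> I" "x \<in> J" "y \<in> J" "u \<in> K" for f t x y u
    by (rule DERIV_zero_constant[OF J(2), of "\<lambda>x. f (t, x, u)"])
       (use Dx_DERIV[OF that(1)] that inU in fastforce)+
  have const_u: "f (t, x, u) = f (t, x, w)"
    if "smooth_on U f" "\<And>p. p \<in> ?W \<Longrightarrow> Du f p = 0" "t \<in> I" "x \<in> J" "u \<in> K" "w \<in> K" for f t x u w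
    by (rule DERIV_zero_constant[OF K(2), of "\<lambda>u. f (t, x, u)"])
       (use Du_DERIV[OF that(1)] that inU in fastforce)+
  have const: "f (t, x, u) = f (t, x0, u0)"
    if "smooth_on U f" "\<And>p. p \<in> ?W \<Longrightarrow> Dx f p = 0" "\<And>p. p \<in> ?W \<Longrightarrow> Du f p = 0" "t \<in> I" "x \<in> J" "u \<in> K" for f t x u
    using const_x[OF that(1,2,4,5) J(3) that(6)] const_u[OF that(1,3,4) J(3) that(6) K(3)] by simp
  have slice: "smooth_on I (\<lambda>t. f (t, x, u))" if "smooth_on U f" "x \<in> J" "u \<in> K" for f :: "point \<Rightarrow> real" and x u
    by (intro smooth_on_compose[OF that(1) I(1) open_U] smooth_intros I) (use inU that in auto)
  have slice2: "smooth_on (I \<times> J) (\<lambda>p. f (fst p, snd p, u0))" if "smooth_on U f" for f :: "point \<Rightarrow> real"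
    by (intro smooth_on_compose[OF that IJ open_U] smooth_intros IJ) (use inU K in auto)

  define \<tau> where "\<tau> = (\<lambda>t. T (t, x0, u0))"
  have s\<tau>: "smooth_on I \<tau>" unfolding \<tau>_def by (rule slice[OF smooth(1) J(3) K(3)])
  have T: "T (t, x, u) = \<tau> t" if "t \<in> I" "x \<in> J" "u \<in> K" for t x u
    unfolding \<tau>_def by (rule const[OF smooth(1)]) (use T_indep[OF subsetD[OF box]] that in auto)
  have DtT: "Dt T p = deriv \<tau> (fst p)" if "p \<in> ?W" for p
    using partial3_cong(1)[OF W that, of T "\<lambda>(t, x, u). \<tau> t"] T by (auto simp: Dt_def split: prod.splits)

  have Xsq: "(Dx X p)\<^sup>2 = deriv \<tau> (fst p)" if "p \<in> ?W" for p
    using X_indep(2)[of p] DtT[OF that] that box by auto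
  note sDX = smooth_on_partial3[OF open_U smooth(2)] and sDV = smooth_on_partial3[OF open_U smooth(3)]
  \<comment> \<open>The square of X_x is a function of t alone. Differentiating the square, rather
    than a root of it, avoids fixing the sign of X_x; division by X_x then shows that X is affine in
    x.\<close>
  have XX: "Dx (Dx X) p = 0" "Du (Dx X) p = 0" if p: "p \<in> ?W" for p
  proof -
    obtain t x u where tx: "p = (t, x, u)" "t \<in> I" "x \<in> J" "u \<in> K" using p by auto
    have nz: "Dx X p \<noteq> 0" using X_indep(3)[of p] p box by auto
    have "((\<lambda>y. (Dx X (t, y, u))\<^sup>2) has_real_derivative 2 * Dx X p * Dx (Dx X) p) (at x)"
      using DERIV_power[OF Dx_DERIV[OF sDX(2), of t x u], of 2] tx inU by (simp add: mult_ac)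
    then have "((\<lambda>_. deriv \<tau> t) has_real_derivative 2 * Dx X p * Dx (Dx X) p) (at x)"
      by (rule has_field_derivative_transform_within_open[OF _ J(1) tx(3)]) (use Xsq tx in auto)
    then have "2 * Dx X p * Dx (Dx X) p = 0" using DERIV_const DERIV_unique by blast
    then show "Dx (Dx X) p = 0" using nz by simp
    have "((\<lambda>w. (Dx X (t, x, w))\<^sup>2) has_real_derivative 2 * Dx X p * Du (Dx X) p) (at u)"
      using DERIV_power[OF Du_DERIV[OF sDX(2), of t x u], of 2] tx inU by (simp add: mult_ac)
    then have "((\<lambda>_. deriv \<tau> t) has_real_derivative 2 * Dx X p * Du (Dx X) p) (at u)"
      by (rule has_field_derivative_transform_within_open[OF _ K(1) tx(4)]) (use Xsq tx in auto)
    then have "2 * Dx X p * Du (Dx X) p = 0" using DERIV_const DERIV_unique by blast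
    then show "Du (Dx X) p = 0" using nz by simp
  qed
  define s where "s = (\<lambda>t. Dx X (t, x0, u0))"
  have ss: "smooth_on I s" unfolding s_def by (rule slice[OF sDX(2) J(3) K(3)])
  have DxX: "Dx X (t, x, u) = s t" if "t \<in> I" "x \<in> J" "u \<in> K" for t x u
    unfolding s_def by (rule const[OF sDX(2)]) (use XX that in auto)
  define r where "r = (\<lambda>t. X (t, x0, u0) - s t * x0)"
  have sr: "smooth_on I r" unfolding r_def by (intro smooth_intros I ss slice[OF smooth(2) J(3) K(3)])
  have X: "X (t, x, u) = s t * x + r t" if "t \<in> I" "x \<in> J" "u \<in> K" for t x u
  proof -
    have "X (t, x, u) = X (t, x, u0)"
      by (rule const_u[OF smooth(2)]) (use X_indep[OF subsetD[OF box]] K that in auto)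
    also have "\<dots> = X (t, x0, u0) + s t * (x - x0)"
      by (rule affine_if_DERIV_constant[OF J(2) _ that(2) J(3)])
         (use Dx_DERIV[OF smooth(2)] inU DxX K that in metis)
    finally show ?thesis by (simp add: r_def algebra_simps)
  qed
  have DtX: "Dt X (t, x, u) = deriv s t * x + deriv r t" if "t \<in> I" "x \<in> J" "u \<in> K" for t x u
  proof -
    have "Dt X (t, x, u) = Dt (\<lambda>(t, x, u). s t * x + r t) (t, x, u)"
      by (rule partial3_cong(1)[OF W]) (use X that in auto)
    also have "\<dots> = deriv s t * x + deriv r t"
      using smooth_on_DERIV[OF ss that(1)] smooth_on_DERIV[OF sr that(1)]
      by (auto simp: Dt_def intro!: DERIV_imp_deriv derivative_eq_intros)
    finally show ?thesis .
  qed

  define A where "A = (\<lambda>p. Du V (fst p, snd p, u0))"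
  define B where "B = (\<lambda>p. V (fst p, snd p, u0) - A p * u0)"
  have sA: "smooth_on (I \<times> J) A" unfolding A_def by (rule slice2[OF sDV(3)])
  have sB: "smooth_on (I \<times> J) B" unfolding B_def by (intro smooth_intros IJ sA slice2[OF smooth(3)])
  note det = determining_equations[OF _ _ XX]
  have DuV: "Du V (t, x, u) = A (t, x)" if "t \<in> I" "x \<in> J" "u \<in> K" for t x u
    unfolding A_def using const_u[OF sDV(3), of t x u u0] det(1) inU that K by fastforce
  have V: "V (t, x, u) = A (t, x) * u + B (t, x)" if "t \<in> I" "x \<in> J" "u \<in> K" for t x u
  proof -
    have "V (t, x, u) = V (t, x, u0) + A (t, x) * (u - u0)"
      by (rule affine_if_DERIV_constant[OF K(2) _ that(3) K(3)])
         (use Du_DERIV[OF smooth(3)] inU DuV that in metis)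
    then show ?thesis by (simp add: B_def algebra_simps)
  qed
  let ?aff = "\<lambda>F G (t, x, u). F (t, x) * u + G (t, x)"
  have V': "V p = ?aff A B p" if "p \<in> ?W" for p using V that by auto
  note sdA = smooth_on_partial2[OF IJ sA] and sdB = smooth_on_partial2[OF IJ sB]
  have dV: "Dt V p = ?aff (dt A) (dt B) p" "Dx V p = ?aff (dx A) (dx B) p" "Du V p = ?aff (\<lambda>_. 0) A p"
    if "p \<in> ?W" for p
    using partial3_cong[OF W that V'] partial3_affine[OF sA sB] that by auto
  have ddV: "Dx (Dx V) p = ?aff (dx (dx A)) (dx (dx B)) p" "Du (Dx V) p = ?aff (\<lambda>_. 0) (dx A) p"
    "Dx (Du V) p = ?aff (\<lambda>_. 0) (dx A) p" if "p \<in> ?W" for p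
  proof -
    show "Dx (Dx V) p = ?aff (dx (dx A)) (dx (dx B)) p" "Du (Dx V) p = ?aff (\<lambda>_. 0) (dx A) p"
      using partial3_cong(2,3)[OF W that dV(2)] partial3_affine(2,3)[OF sdA(2) sdB(2)] that by auto
    have "Dx (Du V) p = Dx (?aff (\<lambda>_. 0) A) p" by (rule partial3_cong(2)[OF W that dV(3)])
    also have "\<dots> = ?aff (\<lambda>_. 0) (dx A) p"
      using partial3_affine(2)[OF smooth_on_const sA, of _ _ 0] that by (auto simp: dx_def)
    finally show "Dx (Du V) p = ?aff (\<lambda>_. 0) (dx A) p" .
  qed
  define q where "q = (\<lambda>t x. (deriv s t * x + deriv r t) / s t)"
  have A1: "2 * dx A (t, x) = - q t x * A (t, x)" if "t \<in> I" "x \<in> J" for t x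
  proof -
    have w: "(t, x, u0) \<in> ?W" using that K by simp
    show ?thesis using det(2)[OF inU refl w w] dV(3)[OF w] ddV(2,3)[OF w] that K
      by (simp add: DxX DtX q_def)
  qed
  have A2: "dt A (t, x) - q t x * dx A (t, x) =
      dx (dx A) (t, x) - \<mu> / x\<^sup>2 * A (t, x) + \<mu> * (s t)\<^sup>2 / (s t * x + r t)\<^sup>2 * A (t, x)"
    and B2: "dt B (t, x) - q t x * dx B (t, x) =
      dx (dx B) (t, x) + \<mu> * (s t)\<^sup>2 / (s t * x + r t)\<^sup>2 * B (t, x)" if "t \<in> I" "x \<in> J" for t x
  proof -
    define a where "a = dt A (t, x) - q t x * dx A (t, x) - (dx (dx A) (t, x) - \<mu> / x\<^sup>2 * A (t, x)
       + \<mu> * (s t)\<^sup>2 / (s t * x + r t)\<^sup>2 * A (t, x))"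
    define b where "b = dt B (t, x) - q t x * dx B (t, x) - (dx (dx B) (t, x)
       + \<mu> * (s t)\<^sup>2 / (s t * x + r t)\<^sup>2 * B (t, x))"
    \<comment> \<open>With V = A u + B the third determining equation is affine in u. It holds for
      all u in K, so the coefficient of u and the free term vanish separately: the equations for A
      and for B.\<close>
    have ab: "a * u + b = 0" if u: "u \<in> K" for u
    proof -
      have w: "(t, x, u) \<in> ?W" using \<open>t \<in> I\<close> \<open>x \<in> J\<close> u by simp
      have "(dt A (t, x) * u + dt B (t, x)) - q t x * (dx A (t, x) * u + dx B (t, x)) =
        (dx (dx A) (t, x) * u + dx (dx B) (t, x)) - \<mu> / x\<^sup>2 * u * A (t, x) + 
        \<mu> * (s t)\<^sup>2 / (s t * x + r t)\<^sup>2 * (A (t, x) * u + B (t, x))"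
        using det(3)[OF inU refl w w] dV[OF w] ddV[OF w] \<open>t \<in> I\<close> \<open>x \<in> J\<close> u
        by (simp add: DxX DtX X V q_def)
      then show ?thesis unfolding a_def b_def by (simp add: algebra_simps add_divide_distrib)
    qed
    obtain u1 where u1: "u1 \<in> K" "u1 \<noteq> u0"
      using K by (metis empty_iff insert_iff not_open_singleton subsetI subset_antisym)
    have "a * (u1 - u0) = (a * u1 + b) - (a * u0 + b)" by (simp add: algebra_simps)
    also have "\<dots> = 0" using ab[OF u1(1)] ab[OF K(3)] by simp
    finally have "a * (u1 - u0) = 0" .
    then have "a = 0" using u1 by simp
    moreover from this have "b = 0" using ab[OF K(3)] by simp
    ultimately show "dt A (t, x) - q t x * dx A (t, x) =
      dx (dx A) (t, x) - \<mu> / x\<^sup>2 * A (t, x) + \<mu> * (s t)\<^sup>2 / (s t * x + r t)\<^sup>2 * A (t, x)"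
     "dt B (t, x) - q t x * dx B (t, x) =
      dx (dx B) (t, x) + \<mu> * (s t)\<^sup>2 / (s t * x + r t)\<^sup>2 * B (t, x)"
      unfolding a_def b_def by simp_all
  qed
  have A0: "A (t, x) \<noteq> 0" if "t \<in> I" "x \<in> J" for t x
  proof
    assume a: "A (t, x) = 0"
    define p where "p = (t, x, u0)"
    have p: "p \<in> U" using inU that K by (simp add: p_def)
    have "Du V p = 0" using DuV that K a by (simp add: p_def)
    \<comment> \<open>With V_u = T_u = X_u = T_x = 0 the x-components force the factor V_x / X_x of
      dX, and the t-components then give the factor of dT.\<close>
    then show False
      using no_annihilator[OF p, of "(Dt V p - Dx V p / Dx X p * Dt X p) / Dt T p" "Dx V p / Dx X p"]
        T_indep[OF p] X_indep[OF p] by simp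
  qed
  have J0: "0 \<notin> J" using inU[OF I(3) _ K(3)] domain by (auto simp: equation_domain_def)
  have d\<tau>: "deriv \<tau> t = (s t)\<^sup>2" if "t \<in> I" for t
    using Xsq[of "(t, x0, u0)"] that J K by (simp add: DxX)
  have s0: "s t \<noteq> 0" if "t \<in> I" for t
    using X_indep(3)[OF inU[OF that J(3) K(3)]] that J K by (simp add: DxX)
  have X0: "s t * x + r t \<noteq> 0" if "t \<in> I" "x \<in> J" for t x
    using codomain[OF inU[OF that K(3)]] that K by (simp add: X)
  show thesis
  proof (rule solve_determining_equations[OF \<mu> I(1,2) _ J(1,2) _ J0 s\<tau> ss sr sA sB])
    show "I \<noteq> {}" "J \<noteq> {}" using I(3) J(3) by blast+
  next
    fix \<alpha> \<beta> \<gamma> \<delta> \<sigma> h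
    assume sol: "\<alpha> * \<delta> - \<beta> * \<gamma> = 1" "\<sigma> \<noteq> 0" "heat_solution \<mu> (I \<times> J) h"
    "\<And>t. t \<in> I \<Longrightarrow> \<gamma> * t + \<delta> \<noteq> 0 \<and> \<tau> t = (\<alpha> * t + \<beta>) / (\<gamma> * t + \<delta>) \<and> s t = 1 / (\<gamma> * t + \<delta>) \<and> r t = 0"
    "\<And>t x. t \<in> I \<Longrightarrow> x \<in> J \<Longrightarrow> A (t, x) = \<sigma> * sqrt \<bar>\<gamma> * t + \<delta>\<bar> * exp (\<gamma> * x\<^sup>2 / (4 * (\<gamma> * t + \<delta>))) \<and>
      B (t, x) = A (t, x) * h (t, x)"
    have "has_symmetry_form \<mu> ?W (\<lambda>p. (T p, X p, V p))"
      unfolding has_symmetry_form_def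
    proof (intro conjI W exI)
      show "?W \<subseteq> equation_domain" using box domain by blast
      show "\<alpha> * \<delta> - \<beta> * \<gamma> = 1" "\<sigma> \<noteq> 0" by (rule sol)+
      have "{(t, x). \<exists>u. (t, x, u) \<in> ?W} = I \<times> J" using K by auto
      then show "heat_solution \<mu> {(t, x). \<exists>u. (t, x, u) \<in> ?W} h" using sol(3) by simp
      show "\<forall>(t, x, u)\<in>?W. \<gamma> * t + \<delta> \<noteq> 0 \<and> (T (t, x, u), X (t, x, u), V (t, x, u)) =
         ((\<alpha> * t + \<beta>) / (\<gamma> * t + \<delta>), x / (\<gamma> * t + \<delta>),
          \<sigma> * sqrt \<bar>\<gamma> * t + \<delta>\<bar> * (u + h (t, x)) * exp (\<gamma> * x\<^sup>2 / (4 * (\<gamma> * t + \<delta>))))"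
      proof clarify
        fix t x u assume w: "t \<in> I" "x \<in> J" "u \<in> K"
        show "\<gamma> * t + \<delta> \<noteq> 0 \<and> (T (t, x, u), X (t, x, u), V (t, x, u)) =
         ((\<alpha> * t + \<beta>) / (\<gamma> * t + \<delta>), x / (\<gamma> * t + \<delta>),
          \<sigma> * sqrt \<bar>\<gamma> * t + \<delta>\<bar> * (u + h (t, x)) * exp (\<gamma> * x\<^sup>2 / (4 * (\<gamma> * t + \<delta>))))"
          using sol(4)[OF w(1)] sol(5)[OF w(1,2)] by (simp add: T[OF w] X[OF w] V[OF w] algebra_simps)
      qed
    qed
    then show thesis using that[OF W _ box] I J K P' by blast
  qed (fact s0 d\<tau> X0 A0 A1[unfolded q_def] A2[unfolded q_def] B2[unfolded q_def])+
qed

end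


section \<open>Invariance of the equation\<close>

definition symmetry_map ::
  "real \<Rightarrow> real \<Rightarrow> real \<Rightarrow> real \<Rightarrow> real \<Rightarrow> (real \<times> real \<Rightarrow> real) \<Rightarrow> point \<Rightarrow> point"
  where "symmetry_map \<alpha> \<beta> \<gamma> \<delta> \<sigma> h = (\<lambda>(t, x, u).
    ((\<alpha> * t + \<beta>) / (\<gamma> * t + \<delta>), x / (\<gamma> * t + \<delta>),
     \<sigma> * sqrt \<bar>\<gamma> * t + \<delta>\<bar> * (u + h (t, x)) * exp (\<gamma> * x\<^sup>2 / (4 * (\<gamma> * t + \<delta>)))))"

text \<open>Exposes the constants and \<open>h\<close>, which are bound by quantifiers in
  \<open>has_symmetry_form\<close>, so that they can be compared on overlapping sets.\<close>

definition symmetry_form_with ::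
  "real \<Rightarrow> point set \<Rightarrow> (point \<Rightarrow> point) \<Rightarrow> real \<times> real \<times> real \<times> real \<times> real \<Rightarrow> (real \<times> real \<Rightarrow> real) \<Rightarrow> bool"
  where "symmetry_form_with \<mu> W \<Phi> = (\<lambda>(\<alpha>, \<beta>, \<gamma>, \<delta>, \<sigma>) h. open W \<and> W \<subseteq> equation_domain \<and>
    \<alpha> * \<delta> - \<beta> * \<gamma> = 1 \<and> \<sigma> \<noteq> 0 \<and> heat_solution \<mu> {(t, x). \<exists>u. (t, x, u) \<in> W} h \<and>
    (\<forall>(t, x, u)\<in>W. \<gamma> * t + \<delta> \<noteq> 0 \<and> \<Phi> (t, x, u) = symmetry_map \<alpha> \<beta> \<gamma> \<delta> \<sigma> h (t, x, u)))"

lemma has_symmetry_form_iff: "has_symmetry_form \<mu> W \<Phi> \<longleftrightarrow> (\<exists>c h. symmetry_form_with \<mu> W \<Phi> c h)"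
  unfolding has_symmetry_form_def symmetry_form_with_def symmetry_map_def
  by (simp add: split_paired_Ex)

text \<open>The map turns \<open>u + h\<close> into a multiple of the pulled back \<open>v\<close>, and this multiplier intertwines
  the heat operators in the two sets of variables.\<close>

lemma symmetry_map_preserves_equation:
  fixes \<alpha> \<beta> \<gamma> \<delta> \<sigma> :: real
  assumes det: "\<alpha> * \<delta> - \<beta> * \<gamma> = 1" and \<sigma>: "\<sigma> \<noteq> 0"
    and h: "heat_solution \<mu> D h" and D: "open D" "p \<in> D" "smooth_on D u"
    and E: "open E" "smooth_on E v"
    and g0: "\<And>q. q \<in> D \<Longrightarrow> \<gamma> * fst q + \<delta> \<noteq> 0"
    and ME: "\<And>t x. (t, x) \<in> D \<Longrightarrow> ((\<alpha> * t + \<beta>) / (\<gamma> * t + \<delta>), x / (\<gamma> * t + \<delta>)) \<in> E"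
    and v: "\<And>t x. (t, x) \<in> D \<Longrightarrow> v ((\<alpha> * t + \<beta>) / (\<gamma> * t + \<delta>), x / (\<gamma> * t + \<delta>)) =
      \<sigma> * sqrt \<bar>\<gamma> * t + \<delta>\<bar> * (u (t, x) + h (t, x)) * exp (\<gamma> * x\<^sup>2 / (4 * (\<gamma> * t + \<delta>)))"
    and M: "M = ((\<alpha> * fst p + \<beta>) / (\<gamma> * fst p + \<delta>), snd p / (\<gamma> * fst p + \<delta>))"
  shows "dt u p = dx (dx u) p + \<mu> / (snd p)\<^sup>2 * u p \<longleftrightarrow>
    dt v M = dx (dx v) M + \<mu> / (snd M)\<^sup>2 * v M"
proof -
  define g where "g = (\<lambda>t. \<gamma> * t + \<delta>)"
  define m where "m = (\<lambda>q. ((\<alpha> * fst q + \<beta>) / g (fst q), snd q / g (fst q)))"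
  define A where "A = (\<lambda>q. \<sigma> * sqrt \<bar>g (fst q)\<bar> * exp (\<gamma> * (snd q)\<^sup>2 / (4 * g (fst q))))"
  define w where "w = (\<lambda>q. u q + h q)"
  have sh: "smooth_on D h" using h by (simp add: heat_solution_iff)
  have gD: "g (fst q) \<noteq> 0" if "q \<in> D" for q using g0[OF that] by (simp add: g_def)
  have sA: "smooth_on D A" unfolding A_def g_def
    by (intro smooth_intros D) (use gD in \<open>auto simp: g_def simp del: distrib_left_numeral\<close>)
  have sw: "smooth_on D w" unfolding w_def by (intro smooth_intros D sh)
  have mE: "m q \<in> E" if "q \<in> D" for q using ME that by (cases q) (simp add: m_def g_def)
  have vm: "v (m q) = A q * w q" if "q \<in> D" for q
    using v that by (cases q) (simp add: m_def A_def w_def g_def)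
  have dg: "(g has_real_derivative \<gamma>) (at t)" for t unfolding g_def by (auto intro!: derivative_eq_intros)
  have dtA: "dt A q = (\<gamma> / (2 * g (fst q)) - \<gamma>\<^sup>2 * (snd q)\<^sup>2 / (4 * (g (fst q))\<^sup>2)) * A q" if "q \<in> D" for q
  proof (cases q)
    case (Pair t x)
    then have g: "g t \<noteq> 0" using gD[OF that] by simp
    have "((\<lambda>t. \<gamma> * x\<^sup>2 / (4 * g t)) has_real_derivative - (\<gamma>\<^sup>2 * x\<^sup>2 / (4 * (g t)\<^sup>2))) (at t)"
      by (rule derivative_eq_intros dg refl | simp add: g)+ (simp add: g field_simps power2_eq_square)
    from DERIV_mult[OF DERIV_cmult[OF DERIV_sqrt_abs[OF dg g], of \<sigma>] DERIV_chain2[OF DERIV_exp this]]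
    show ?thesis unfolding Pair A_def
      by (intro dt_eqI) (simp add: algebra_simps)
  qed
  have dxA: "dx A q = \<gamma> * snd q / (2 * g (fst q)) * A q" if "q \<in> D" for q
  proof (cases q)
    case (Pair t x)
    then have g: "g t \<noteq> 0" using gD[OF that] by simp
    have "((\<lambda>x. \<gamma> * x\<^sup>2 / (4 * g t)) has_real_derivative \<gamma> * x / (2 * g t)) (at x)"
      by (rule derivative_eq_intros refl | simp add: g)+
    from DERIV_cmult[OF DERIV_chain2[OF DERIV_exp this], of "\<sigma> * sqrt \<bar>g t\<bar>"]
    show ?thesis unfolding Pair A_def
      by (intro dx_eqI) (simp add: algebra_simps)
  qed
  have dxxA: "dx (dx A) q = (\<gamma> / (2 * g (fst q)) + \<gamma>\<^sup>2 * (snd q)\<^sup>2 / (4 * (g (fst q))\<^sup>2)) * A q" if "q \<in> D" for q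
  proof (cases q)
    case (Pair t x)
    then have g: "g t \<noteq> 0" and tx: "(t, x) \<in> D" using gD[OF that] that by simp_all
    have "dx (dx A) q = dx (\<lambda>q. \<gamma> * snd q / (2 * g (fst q)) * A q) q"
      by (rule partial_cong(2)[OF D(1) that dxA])
    also have "((\<lambda>y. \<gamma> * y / (2 * g t)) has_real_derivative \<gamma> / (2 * g t)) (at x)"
      by (rule derivative_eq_intros refl | simp add: g)+
    from DERIV_mult[OF this dx_DERIV[OF sA tx]]
    have "dx (\<lambda>q. \<gamma> * snd q / (2 * g (fst q)) * A q) q =
        \<gamma> / (2 * g t) * A (t, x) + dx A (t, x) * (\<gamma> * x / (2 * g t))"
      unfolding Pair by (intro dx_eqI) simp
    finally show ?thesis using dxA[OF tx] by (simp add: Pair algebra_simps power2_eq_square)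
  qed
  have dv: "f differentiable at (m q)" if "smooth_on E f" "q \<in> D" for f :: "real \<times> real \<Rightarrow> real" and q
    using smooth_on_imp_differentiable[OF that(1) mE[OF that(2)]] .
  have dxm: "dx (\<lambda>q. f (m q)) q = dx f (m q) / g (fst q)" if "smooth_on E f" "q \<in> D" for f q
  proof (cases q)
    case (Pair t x)
    then have g: "g t \<noteq> 0" using gD[OF that(2)] by simp
    have "((\<lambda>y. f ((\<alpha> * t + \<beta>) / g t, y / g t)) has_real_derivative 
       dt f ((\<alpha> * t + \<beta>) / g t, x / g t) * 0 + dx f ((\<alpha> * t + \<beta>) / g t, x / g t) * (1 / g t)) (at x)"
      using DERIV_compose2[of f "\<lambda>_. (\<alpha> * t + \<beta>) / g t" x "\<lambda>y. y / g t" 0 "1 / g t"] dv[OF that]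
      by (simp add: Pair m_def DERIV_cdivide)
    then show ?thesis unfolding Pair by (intro dx_eqI) (simp add: m_def)
  qed
  have dtm: "dt (\<lambda>q. v (m q)) q = dt v (m q) / (g (fst q))\<^sup>2 - dx v (m q) * (\<gamma> * snd q / (g (fst q))\<^sup>2)" if "q \<in> D" for q
  proof (cases q)
    case (Pair t x)
    then have g: "g t \<noteq> 0" using gD[OF that] by simp
    have 1: "((\<lambda>t. (\<alpha> * t + \<beta>) / g t) has_real_derivative 1 / (g t)\<^sup>2) (at t)"
    proof (rule DERIV_cong[OF DERIV_divide[OF _ dg g]])
      show "((\<lambda>t. \<alpha> * t + \<beta>) has_real_derivative \<alpha>) (at t)" by (auto intro!: derivative_eq_intros)
      have "\<alpha> * g t - (\<alpha> * t + \<beta>) * \<gamma> = 1" using det by (simp add: g_def algebra_simps)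
      then show "(\<alpha> * g t - (\<alpha> * t + \<beta>) * \<gamma>) / (g t * g t) = 1 / (g t)\<^sup>2" by (simp add: power2_eq_square)
    qed
    have 2: "((\<lambda>t. x / g t) has_real_derivative - (\<gamma> * x / (g t)\<^sup>2)) (at t)"
      by (rule DERIV_cong[OF DERIV_divide[OF DERIV_const dg g]]) (simp add: power2_eq_square)
    show ?thesis unfolding Pair
      using DERIV_compose2[OF _ 1 2, of v] dv[OF E(2) that] by (intro dt_eqI) (simp add: Pair m_def)
  qed
  note F = partial_cong[OF D(1) _ vm]
  have sdv: "smooth_on E (dx v)" using smooth_on_partial2[OF E] by simp
  have dxxm: "dx (dx (\<lambda>q. v (m q))) p = dx (dx v) (m p) / (g (fst p))\<^sup>2"
  proof -
    have "dx (dx (\<lambda>q. v (m q))) p = dx (\<lambda>q. dx v (m q) / g (fst q)) p"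
      by (rule partial_cong(2)[OF D(1,2) dxm[OF E(2)]])
    also have "\<dots> = dx (\<lambda>q. dx v (m q)) p / g (fst p)"
    proof (cases p)
      case (Pair t x)
      have "((\<lambda>y. dx v ((\<alpha> * t + \<beta>) / g t, y / g t)) has_real_derivative 
       dt (dx v) ((\<alpha> * t + \<beta>) / g t, x / g t) * 0 + dx (dx v) ((\<alpha> * t + \<beta>) / g t, x / g t) * (1 / g t)) (at x)"
        using DERIV_compose2[of "dx v" "\<lambda>_. (\<alpha> * t + \<beta>) / g t" x "\<lambda>y. y / g t" 0 "1 / g t"] dv[OF sdv D(2)]
        by (simp add: Pair m_def DERIV_cdivide)
      from DERIV_cdivide[OF this, of "g t"] show ?thesis
        using dxm[OF sdv D(2)] unfolding Pair by (intro dx_eqI) (simp add: m_def)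
    qed
    also have "\<dots> = dx (dx v) (m p) / (g (fst p))\<^sup>2" by (simp add: dxm[OF sdv D(2)] power2_eq_square)
    finally show ?thesis .
  qed
  define G where "G = g (fst p)"
  define x where "x = snd p"
  have G: "G \<noteq> 0" using gD[OF D(2)] by (simp add: G_def)
  have Mm: "M = m p" by (simp add: M m_def g_def)
  have x0: "x \<noteq> 0" using h D(2) by (auto simp: heat_solution_iff x_def)
  have Ap: "A p \<noteq> 0" using \<sigma> G by (simp add: A_def G_def)
  \<comment> \<open>Each derivative of v(m) = A w is computed twice, by the chain rule on the left
    and by the product rule on the right.\<close>
  have 1: "dt v M / G\<^sup>2 - dx v M * (\<gamma> * x / G\<^sup>2) = (\<gamma> / (2 * G) - \<gamma>\<^sup>2 * x\<^sup>2 / (4 * G\<^sup>2)) * A p * w p + A p * dt w p"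
    using F(1)[OF D(2)] dtm[OF D(2)] dt_mult[OF sA sw D(2)] dtA[OF D(2)] by (simp add: Mm G_def x_def)
  have 2: "dx v M / G = \<gamma> * x / (2 * G) * A p * w p + A p * dx w p"
    using F(2)[OF D(2)] dxm[OF E(2) D(2)] dx_mult[OF sA sw D(2)] dxA[OF D(2)] by (simp add: Mm G_def x_def)
  have 3: "dx (dx v) M / G\<^sup>2 = (\<gamma> / (2 * G) + \<gamma>\<^sup>2 * x\<^sup>2 / (4 * G\<^sup>2)) * A p * w p
      + 2 * (\<gamma> * x / (2 * G) * A p) * dx w p + A p * dx (dx w) p"
    using partial_cong(2)[OF D(1,2) F(2)] dxxm dx_dx_mult[OF D(1) sA sw D(2)] dxA[OF D(2)] dxxA[OF D(2)]
    by (simp add: Mm G_def x_def)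
  have 4: "\<mu> / (snd M)\<^sup>2 * v M / G\<^sup>2 = \<mu> / x\<^sup>2 * (A p * w p)"
    using vm[OF D(2)] G by (simp add: Mm) (simp add: m_def G_def x_def power_divide)
  \<comment> \<open>The transport term that the time dependence of x/g adds to the t-derivative is
    compensated by the multiple of v_X; in terms of w this cancels the cross term 2 A_x w_x.\<close>
  have "(dt v M - dx (dx v) M - \<mu> / (snd M)\<^sup>2 * v M) / G\<^sup>2 =
     (dt v M / G\<^sup>2 - dx v M * (\<gamma> * x / G\<^sup>2)) + (\<gamma> * x / G) * (dx v M / G) - dx (dx v) M / G\<^sup>2 - \<mu> / (snd M)\<^sup>2 * v M / G\<^sup>2"
    by (simp add: diff_divide_distrib power2_eq_square)
  also have "\<dots> = A p * (dt w p - dx (dx w) p - \<mu> / x\<^sup>2 * w p)"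
    unfolding 1 2 3 4 using G by (simp add: field_simps power2_eq_square)
  \<comment> \<open>Adding h does not change the defect, because h solves the linear
    equation.\<close>
  also have "dt w p - dx (dx w) p - \<mu> / x\<^sup>2 * w p = dt u p - dx (dx u) p - \<mu> / x\<^sup>2 * u p"
  proof -
    note su = smooth_on_partial2[OF D(1,3)] and shd = smooth_on_partial2[OF D(1) sh]
    have a: "dt w q = dt u q + dt h q" "dx w q = dx u q + dx h q" if "q \<in> D" for q
      using that by (cases q; auto simp: w_def intro!: dt_eqI dx_eqI DERIV_add dt_DERIV dx_DERIV D(3) sh)+
    have "dx (dx w) p = dx (\<lambda>q. dx u q + dx h q) p"
      by (rule partial_cong(2)[OF D(1,2) a(2)])
    also have "\<dots> = dx (dx u) p + dx (dx h) p"
      using D(2) by (cases p) (auto intro!: dx_eqI DERIV_add dx_DERIV su shd)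
    finally show ?thesis using a[OF D(2)] h D(2) by (simp add: heat_solution_iff w_def x_def algebra_simps add_divide_distrib)
  qed
  finally have key: "(dt v M - dx (dx v) M - \<mu> / (snd M)\<^sup>2 * v M) / G\<^sup>2 = A p * (dt u p - dx (dx u) p - \<mu> / x\<^sup>2 * u p)" .
  have "dt u p = dx (dx u) p + \<mu> / (snd p)\<^sup>2 * u p \<longleftrightarrow> A p * (dt u p - dx (dx u) p - \<mu> / x\<^sup>2 * u p) = 0"
    using Ap by (auto simp: x_def)
  also have "\<dots> \<longleftrightarrow> dt v M = dx (dx v) M + \<mu> / (snd M)\<^sup>2 * v M"
    unfolding key[symmetric] using G by auto
  finally show ?thesis .
qed

text \<open>One graph may pass through several sets W carrying different parameters. The equivalence
  is therefore proved at a single point, after restricting u to the base points over which its graph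
  lies in W.\<close>

lemma symmetry_form_with_pointwise:
  assumes form: "symmetry_form_with \<mu> W \<Phi> c h"
    and D: "open D" "smooth_on D u" "(t, x) \<in> D" and E: "open E" "smooth_on E v"
    and img: "\<Phi> ` graph_over D u \<subseteq> graph_over E v" and W: "(t, x, u (t, x)) \<in> W"
    and M: "M = (fst (\<Phi> (t, x, u (t, x))), fst (snd (\<Phi> (t, x, u (t, x)))))"
  shows "M \<in> E" "snd M \<noteq> 0"
    "dt u (t, x) = dx (dx u) (t, x) + \<mu> / x\<^sup>2 * u (t, x) \<longleftrightarrow> dt v M = dx (dx v) M + \<mu> / (snd M)\<^sup>2 * v M"
proof -
  obtain \<alpha> \<beta> \<gamma> \<delta> \<sigma> where c: "c = (\<alpha>, \<beta>, \<gamma>, \<delta>, \<sigma>)" by (cases c)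
  have f: "open W" "W \<subseteq> equation_domain" "\<alpha> * \<delta> - \<beta> * \<gamma> = 1" "\<sigma> \<noteq> 0"
    "heat_solution \<mu> {(t, x). \<exists>u. (t, x, u) \<in> W} h"
    and \<Phi>: "\<And>t x u. (t, x, u) \<in> W \<Longrightarrow> \<gamma> * t + \<delta> \<noteq> 0 \<and> \<Phi> (t, x, u) = symmetry_map \<alpha> \<beta> \<gamma> \<delta> \<sigma> h (t, x, u)"
    using form unfolding symmetry_form_with_def c by auto
  define D0 where "D0 = D \<inter> (\<lambda>q. (fst q, snd q, u q)) -` W"
  have D0: "open D0" unfolding D0_def
    by (intro continuous_open_preimage smooth_on_imp_continuous_on smooth_intros D f)
  have W': "(s, y, u (s, y)) \<in> W" "(s, y) \<in> D" if "(s, y) \<in> D0" for s y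
    using that by (auto simp: D0_def)
  have graph: "(s, y, u (s, y)) \<in> graph_over D u" if "(s, y) \<in> D" for s y
    using that by (force simp: graph_over_def)
  have im: "\<Phi> (s, y, u (s, y)) \<in> graph_over E v" if "(s, y) \<in> D" for s y
    using img graph[OF that] by blast
  have gr: "(a, b) \<in> E \<and> v (a, b) = d" if "(a, b, d) \<in> graph_over E v" for a b d
    using that by (auto simp: graph_over_def)
  have p: "(t, x) \<in> D0" using D W by (simp add: D0_def)
  have M': "M = ((\<alpha> * fst (t, x) + \<beta>) / (\<gamma> * fst (t, x) + \<delta>), snd (t, x) / (\<gamma> * fst (t, x) + \<delta>))"
    using \<Phi>[OF W] by (simp add: M symmetry_map_def)
  have ME: "((\<alpha> * s + \<beta>) / (\<gamma> * s + \<delta>), y / (\<gamma> * s + \<delta>)) \<in> E \<and>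
      v ((\<alpha> * s + \<beta>) / (\<gamma> * s + \<delta>), y / (\<gamma> * s + \<delta>)) =
      \<sigma> * sqrt \<bar>\<gamma> * s + \<delta>\<bar> * (u (s, y) + h (s, y)) * exp (\<gamma> * y\<^sup>2 / (4 * (\<gamma> * s + \<delta>)))"
    if "(s, y) \<in> D0" for s y
    using im[OF W'(2)[OF that]] \<Phi>[OF W'(1)[OF that]] by (intro gr) (simp add: symmetry_map_def)
  show "M \<in> E" using ME[OF p] by (simp add: M')
  have "x \<noteq> 0" using W f(2) by (auto simp: equation_domain_def)
  then show "snd M \<noteq> 0" using \<Phi>[OF W] by (simp add: M')
  have h: "heat_solution \<mu> D0 h"
    by (rule heat_solution_subset[OF f(5) D0]) (use W' in auto)
  have "dt u (t, x) = dx (dx u) (t, x) + \<mu> / (snd (t, x))\<^sup>2 * u (t, x) \<longleftrightarrow>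
      dt v M = dx (dx v) M + \<mu> / (snd M)\<^sup>2 * v M"
  proof (rule symmetry_map_preserves_equation[OF f(3,4) h D0 p _ E _ _ _ M'])
    show "smooth_on D0 u" by (rule smooth_on_subset[OF D(2)]) (simp add: D0_def)
    show "\<gamma> * fst q + \<delta> \<noteq> 0" if "q \<in> D0" for q
      using that \<Phi>[OF W'(1), of "fst q" "snd q"] by simp
  qed (use ME in blast)+
  then show "dt u (t, x) = dx (dx u) (t, x) + \<mu> / x\<^sup>2 * u (t, x) \<longleftrightarrow>
      dt v M = dx (dx v) M + \<mu> / (snd M)\<^sup>2 * v M" by simp
qed

text \<open>The map M induced on base points carries D onto E, so the pointwise equivalences over D
  account for every point of E.\<close>

lemma local_form_imp_pseudogroup:
  assumes pt: "point_transformation U \<Phi>"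
    and loc: "\<And>p. p \<in> U \<Longrightarrow> \<exists>W. p \<in> W \<and> has_symmetry_form \<mu> W \<Phi>"
  shows "(U, \<Phi>) \<in> point_symmetry_pseudogroup \<mu>"
proof -
  have loc': "\<exists>W c h. p \<in> W \<and> symmetry_form_with \<mu> W \<Phi> c h" if "p \<in> U" for p
    using loc[OF that] by (auto simp: has_symmetry_form_iff)
  have dom: "p \<in> equation_domain \<and> \<Phi> p \<in> equation_domain" if p: "p \<in> U" for p
  proof -
    obtain t x u where tx: "p = (t, x, u)" by (cases p)
    obtain W \<alpha> \<beta> \<gamma> \<delta> \<sigma> h where W: "p \<in> W" "symmetry_form_with \<mu> W \<Phi> (\<alpha>, \<beta>, \<gamma>, \<delta>, \<sigma>) h"
      using loc'[OF p] by auto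
    then show ?thesis unfolding symmetry_form_with_def
      by (force simp: tx equation_domain_def symmetry_map_def)
  qed
  have "maps_equation_to_itself \<mu> U \<Phi>"
    unfolding maps_equation_to_itself_def
  proof (intro allI impI)
    fix D u E v
    assume D: "open D" and E: "open E" and su: "smooth_on D u" and sv: "smooth_on E v"
      and sub: "graph_over D u \<subseteq> U" and img: "\<Phi> ` graph_over D u = graph_over E v"
    define M where "M = (\<lambda>q. (fst (\<Phi> (fst q, snd q, u q)), fst (snd (\<Phi> (fst q, snd q, u q)))))"
    have graph: "(t, x, u (t, x)) \<in> graph_over D u" if "(t, x) \<in> D" for t x
      using that by (force simp: graph_over_def)
    have pw: "M q \<in> E \<and> snd (M q) \<noteq> 0 \<and> snd q \<noteq> 0 \<and>
      (dt u q = dx (dx u) q + \<mu> / (snd q)\<^sup>2 * u q \<longleftrightarrow> dt v (M q) = dx (dx v) (M q) + \<mu> / (snd (M q))\<^sup>2 * v (M q))"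
      if q: "q \<in> D" for q
    proof -
      obtain t x where tx: "q = (t, x)" by (cases q)
      have inU: "(t, x, u (t, x)) \<in> U" using graph sub q tx by blast
      obtain W c h where W: "(t, x, u (t, x)) \<in> W" "symmetry_form_with \<mu> W \<Phi> c h"
        using loc'[OF inU] by blast
      have "M q = (fst (\<Phi> (t, x, u (t, x))), fst (snd (\<Phi> (t, x, u (t, x)))))" by (simp add: M_def tx)
      note * = symmetry_form_with_pointwise[OF W(2) D su q[unfolded tx] E sv equalityD1[OF img] W(1) this]
      show ?thesis using * dom[OF inU] by (auto simp: tx equation_domain_def)
    qed
    have ME: "M ` D = E"
    proof
      show "M ` D \<subseteq> E" using pw by auto
      show "E \<subseteq> M ` D"
      proof clarify
        fix a b assume ab: "(a, b) \<in> E"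
        then have "(a, b, v (a, b)) \<in> graph_over E v" by (force simp: graph_over_def)
        then obtain t x where "(t, x) \<in> D" "\<Phi> (t, x, u (t, x)) = (a, b, v (a, b))"
          unfolding img[symmetric] by (auto simp: graph_over_def)
        then show "(a, b) \<in> M ` D" by (intro image_eqI[of _ _ "(t, x)"]) (auto simp: M_def)
      qed
    qed
    have all_E: "(\<forall>p\<in>E. Q p) \<longleftrightarrow> (\<forall>q\<in>D. Q (M q))" for Q using ME by blast
    show "heat_solution \<mu> D u \<longleftrightarrow> heat_solution \<mu> E v"
      unfolding heat_solution_iff all_E using D E su sv pw by blast
  qed
  then show ?thesis using pt dom by (auto simp: point_symmetry_pseudogroup_def)
qed

lemma pseudogroup_imp_local_form:
  assumes "\<mu> \<noteq> 0" "(U, \<Phi>) \<in> point_symmetry_pseudogroup \<mu>" "p \<in> U"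
  shows "\<exists>W. open W \<and> p \<in> W \<and> W \<subseteq> U \<and> has_symmetry_form \<mu> W \<Phi>"
proof -
  define T where "T = (\<lambda>p. fst (\<Phi> p))"
  define X where "X = (\<lambda>p. fst (snd (\<Phi> p)))"
  define V where "V = (\<lambda>p. snd (snd (\<Phi> p)))"
  have \<Phi>: "\<Phi> = (\<lambda>p. (T p, X p, V p))" by (simp add: T_def X_def V_def)
  have G: "point_transformation U \<Phi>" "U \<subseteq> equation_domain" "\<Phi> ` U \<subseteq> equation_domain"
    "maps_equation_to_itself \<mu> U \<Phi>"
    using assms(2) by (auto simp: point_symmetry_pseudogroup_def)
  interpret heat_symmetry \<mu> U T X V
  proof
    show "X p \<noteq> 0" if "p \<in> U" for p
      using imageI[OF that, of \<Phi>] G(3) by (auto simp: X_def equation_domain_def)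
  qed (use G \<Phi> in auto)
  show ?thesis using local_symmetry_form[OF assms(1,3)] unfolding \<Phi> by metis
qed

section \<open>From local forms to a global form\<close>

text \<open>The domain of h shrinks as well; it remains open, as a union of slices at fixed
  u.\<close>

lemma symmetry_form_with_subset:
  assumes "symmetry_form_with \<mu> W \<Phi> c h" "open O'" "O' \<subseteq> W"
  shows "symmetry_form_with \<mu> O' \<Phi> c h"
proof -
  have "open {(t, x). \<exists>u. (t, x, u) \<in> O'}"
  proof -
    have "{(t, x). \<exists>u. (t, x, u) \<in> O'} = (\<Union>u. (\<lambda>q. (fst q, snd q, u)) -` O')" by auto
    moreover have "open ((\<lambda>q. (fst q, snd q, u)) -` O')" for u :: real
      by (intro open_vimage assms continuous_intros)
    ultimately show ?thesis by auto
  qed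
  moreover have "{(t, x). \<exists>u. (t, x, u) \<in> O'} \<subseteq> {(t, x). \<exists>u. (t, x, u) \<in> W}" using assms(3) by auto
  ultimately show ?thesis
    using assms unfolding symmetry_form_with_def
    by (auto intro: heat_solution_subset)
qed

text \<open>Since x is nonzero, the second component determines \<gamma> t + \<delta>, and the first
  then \<alpha> t + \<beta>; two values of t separate the constants. Two values of u determine
  \<sigma>, as h cancels in the difference. The sign of the matrix is fixed too, because it changes
  the sign of the new x.\<close>

lemma symmetry_form_with_unique:
  assumes 1: "symmetry_form_with \<mu> W \<Phi> c h" and 2: "symmetry_form_with \<mu> W \<Phi> c' h'" and p: "p \<in> W"
  shows "c = c'"
proof -
  obtain \<alpha> \<beta> \<gamma> \<delta> \<sigma> where c: "c = (\<alpha>, \<beta>, \<gamma>, \<delta>, \<sigma>)" by (cases c)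
  obtain \<alpha>' \<beta>' \<gamma>' \<delta>' \<sigma>' where c': "c' = (\<alpha>', \<beta>', \<gamma>', \<delta>', \<sigma>')" by (cases c')
  obtain t0 x0 u0 where p': "p = (t0, x0, u0)" by (cases p)
  have W: "open W" using 1 by (auto simp: symmetry_form_with_def)
  obtain I J K where "open I" "convex I" "t0 \<in> I" "open J" "convex J" "x0 \<in> J" "open K" "convex K" "u0 \<in> K"
    and box: "I \<times> J \<times> K \<subseteq> W"
    by (rule open_box[OF W p[unfolded p']])
  then have I: "open I" "t0 \<in> I" and J: "open J" "x0 \<in> J" and K: "open K" "u0 \<in> K" by simp_all
  obtain t1 where t1: "t1 \<in> I" "t1 \<noteq> t0"
    using I by (metis empty_iff insert_iff not_open_singleton subsetI subset_antisym)
  obtain u1 where u1: "u1 \<in> K" "u1 \<noteq> u0"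
    using K by (metis empty_iff insert_iff not_open_singleton subsetI subset_antisym)
  have eq: "\<gamma> * t + \<delta> \<noteq> 0 \<and> \<gamma>' * t + \<delta>' \<noteq> 0 \<and> x \<noteq> 0 \<and>
      symmetry_map \<alpha> \<beta> \<gamma> \<delta> \<sigma> h (t, x, u) = symmetry_map \<alpha>' \<beta>' \<gamma>' \<delta>' \<sigma>' h' (t, x, u)"
    if "t \<in> I" "x \<in> J" "u \<in> K" for t x u
  proof -
    have w: "(t, x, u) \<in> W" using that box by auto
    then show ?thesis using 1 2 unfolding symmetry_form_with_def c c' equation_domain_def by force
  qed
  have g: "\<gamma> * t + \<delta> = \<gamma>' * t + \<delta>'" if "t \<in> I" for t
    using eq[OF that J(2) K(2)] by (auto simp: symmetry_map_def)
  have a: "\<alpha> * t + \<beta> = \<alpha>' * t + \<beta>'" if "t \<in> I" for t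
    using eq[OF that J(2) K(2)] g[OF that] by (auto simp: symmetry_map_def)
  have lin: "k = k' \<and> l = l'" if "k * t0 + l = k' * t0 + l'" "k * t1 + l = k' * t1 + l'" for k k' l l' :: real
  proof -
    have "(k - k') * (t1 - t0) = 0" using that by (simp add: algebra_simps)
    then show ?thesis using t1 that by auto
  qed
  have \<gamma>: "\<gamma> = \<gamma>'" "\<delta> = \<delta>'" using lin[OF g g] I t1 by auto
  have \<alpha>: "\<alpha> = \<alpha>'" "\<beta> = \<beta>'" using lin[OF a a] I t1 by auto
  define k where "k = sqrt \<bar>\<gamma> * t0 + \<delta>\<bar> * exp (\<gamma> * x0\<^sup>2 / (4 * (\<gamma> * t0 + \<delta>)))"
  have k: "k \<noteq> 0" using eq[OF I(2) J(2) K(2)] by (simp add: k_def)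
  have "\<sigma> * k * (u0 + h (t0, x0)) = \<sigma>' * k * (u0 + h' (t0, x0))"
    "\<sigma> * k * (u1 + h (t0, x0)) = \<sigma>' * k * (u1 + h' (t0, x0))"
    using eq[OF I(2) J(2) K(2)] eq[OF I(2) J(2) u1(1)] 
    by (auto simp: symmetry_map_def k_def \<gamma>[symmetric])
  then have "(\<sigma> - \<sigma>') * (k * (u1 - u0)) = 0" by (simp add: algebra_simps)
  then have "\<sigma> = \<sigma>'" using k u1 by simp
  then show ?thesis by (simp add: c c' \<alpha> \<gamma>)
qed

text \<open>Both the equation and smoothness depend only on the values near a point, so a function
  that agrees locally with solutions is a solution.\<close>

lemma heat_solution_local:
  assumes "\<And>p. p \<in> D \<Longrightarrow> \<exists>D' h'. p \<in> D' \<and> D' \<subseteq> D \<and> heat_solution \<mu> D' h' \<and> (\<forall>q\<in>D'. h q = h' q)"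
  shows "heat_solution \<mu> D h"
proof -
  have "\<exists>D'. p \<in> D' \<and> D' \<subseteq> D \<and> heat_solution \<mu> D' h" if "p \<in> D" for p
  proof -
    obtain D' h' where D': "p \<in> D'" "D' \<subseteq> D" "heat_solution \<mu> D' h'" "\<And>q. q \<in> D' \<Longrightarrow> h q = h' q"
      using assms[OF \<open>p \<in> D\<close>] by blast
    then have o: "open D'" and s: "smooth_on D' h'" by (auto simp: heat_solution_iff)
    have "heat_solution \<mu> D' h"
      unfolding heat_solution_iff
    proof (intro conjI ballI o)
      show "smooth_on D' h" using smooth_on_cong[OF o s] D'(4) by simp
      fix q assume q: "q \<in> D'"
      show "snd q \<noteq> 0" using D'(3) q by (auto simp: heat_solution_iff)
      show "dt h q = dx (dx h) q + \<mu> / (snd q)\<^sup>2 * h q"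
        using D'(3) q partial_cong[OF o _ D'(4)] partial_cong(2)[OF o q, of "dx h" "dx h'"] D'(4)[OF q]
        by (simp add: heat_solution_iff)
    qed
    then show ?thesis using D' by blast
  qed
  then have loc: "\<exists>D'. p \<in> D' \<and> D' \<subseteq> D \<and> heat_solution \<mu> D' h" if "p \<in> D" for p using that .
  have "open D"
  proof (subst open_subopen, intro ballI)
    fix p assume "p \<in> D"
    then obtain D' where "p \<in> D'" "D' \<subseteq> D" "heat_solution \<mu> D' h" using loc by blast
    then show "\<exists>T. open T \<and> p \<in> T \<and> T \<subseteq> D" by (auto simp: heat_solution_iff)
  qed
  moreover have "smooth_on D h"
  proof (rule smooth_on_local)
    fix p assume "p \<in> D"
    then obtain D' where "p \<in> D'" "D' \<subseteq> D" "heat_solution \<mu> D' h" using loc by blast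
    then show "\<exists>T. open T \<and> p \<in> T \<and> smooth_on T h" by (auto simp: heat_solution_iff)
  qed
  ultimately show ?thesis using loc unfolding heat_solution_iff by blast
qed

lemma local_form_imp_form:
  assumes U: "open U" "connected U" "\<And>t x. connected {u. (t, x, u) \<in> U}"
    and loc: "\<And>p. p \<in> U \<Longrightarrow> \<exists>W. open W \<and> p \<in> W \<and> W \<subseteq> U \<and> has_symmetry_form \<mu> W \<Phi>"
  shows "has_symmetry_form \<mu> U \<Phi>"
proof (cases "U = {}")
  case True
  have "heat_solution \<mu> {} (\<lambda>_. 0)" by (simp add: heat_solution_iff smooth_on_const)
  then have "symmetry_form_with \<mu> U \<Phi> (1, 0, 0, 1, 1) (\<lambda>_. 0)"
    by (simp add: symmetry_form_with_def True)
  then show ?thesis unfolding has_symmetry_form_iff by blast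
next
  case False
  define P where "P = (\<lambda>p c. \<exists>W h. p \<in> W \<and> W \<subseteq> U \<and> symmetry_form_with \<mu> W \<Phi> c h)"
  have ex: "\<exists>c. P p c" if "p \<in> U" for p
    using loc[OF that] unfolding P_def has_symmetry_form_iff by blast
  have uniq: "c = c'" if "P p c" "P p c'" for p c c'
  proof -
    obtain W h where W: "p \<in> W" "symmetry_form_with \<mu> W \<Phi> c h" using \<open>P p c\<close> by (auto simp: P_def)
    obtain W' h' where W': "p \<in> W'" "symmetry_form_with \<mu> W' \<Phi> c' h'" using \<open>P p c'\<close> by (auto simp: P_def)
    have "open (W \<inter> W')" using W W' by (auto simp: symmetry_form_with_def)
    then show ?thesis
      using symmetry_form_with_unique[OF symmetry_form_with_subset[OF W(2)] symmetry_form_with_subset[OF W'(2)], of "W \<inter> W'" p] W W'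
      by auto
  qed
  \<comment> \<open>A parameter tuple chosen at each point. By uniqueness it agrees with the tuple
    of any local form around the point, so it is locally constant.\<close>
  define C where "C = (\<lambda>p. SOME c. P p c)"
  have C: "P p (C p)" if "p \<in> U" for p unfolding C_def by (rule someI_ex[OF ex[OF that]])
  have "C constant_on U"
  proof (rule locally_constant_imp_constant[OF U(2)])
    fix p assume p: "p \<in> U"
    obtain W h where W: "p \<in> W" "W \<subseteq> U" "symmetry_form_with \<mu> W \<Phi> (C p) h" using C[OF p] by (auto simp: P_def)
    then have "open W" by (auto simp: symmetry_form_with_def)
    moreover have "C q = C p" if "q \<in> W" for q
    proof (rule uniq)
      show "P q (C q)" using C that W by blast
      show "P q (C p)" using W that by (auto simp: P_def)
    qed
    ultimately show "\<exists>T. openin (top_of_set U) T \<and> p \<in> T \<and> (\<forall>x\<in>T. C x = C p)"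
      using open_subset[OF W(2)] W(1) by blast
  qed
  then obtain c where c: "\<And>p. p \<in> U \<Longrightarrow> C p = c" by (auto simp: constant_on_def)
  obtain \<alpha> \<beta> \<gamma> \<delta> \<sigma> where c': "c = (\<alpha>, \<beta>, \<gamma>, \<delta>, \<sigma>)" by (cases c)
  have form: "\<exists>W h. p \<in> W \<and> W \<subseteq> U \<and> symmetry_form_with \<mu> W \<Phi> (\<alpha>, \<beta>, \<gamma>, \<delta>, \<sigma>) h" if "p \<in> U" for p
    using C[OF that] c[OF that] c' by (auto simp: P_def)
  have params: "\<alpha> * \<delta> - \<beta> * \<gamma> = 1" "\<sigma> \<noteq> 0" using form False by (auto simp: symmetry_form_with_def)
  \<comment> \<open>The third component solved for h. It depends on u a priori, since local forms at
    different heights over the same (t, x) may have different functions h.\<close>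
  define H where "H = (\<lambda>(t, x, u). snd (snd (\<Phi> (t, x, u))) /
     (\<sigma> * sqrt \<bar>\<gamma> * t + \<delta>\<bar> * exp (\<gamma> * x\<^sup>2 / (4 * (\<gamma> * t + \<delta>)))) - u)"
  have H: "H (t, x, u) = h (t, x)"
    if "symmetry_form_with \<mu> W \<Phi> (\<alpha>, \<beta>, \<gamma>, \<delta>, \<sigma>) h" "(t, x, u) \<in> W" for W h t x u
  proof -
    have "\<gamma> * t + \<delta> \<noteq> 0" "\<Phi> (t, x, u) = symmetry_map \<alpha> \<beta> \<gamma> \<delta> \<sigma> h (t, x, u)"
      using that by (auto simp: symmetry_form_with_def)
    then show ?thesis using params(2) by (simp add: H_def symmetry_map_def)
  qed
  have fibre: "H (t, x, u) = H (t, x, u')" if "(t, x, u) \<in> U" "(t, x, u') \<in> U" for t x u u'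
  proof -
    \<comment> \<open>Within one local form H does not depend on u, so it is locally constant along
      the fibre and connectedness applies.\<close>
    have "(\<lambda>u. H (t, x, u)) constant_on {u. (t, x, u) \<in> U}"
    proof (rule locally_constant_imp_constant[OF U(3)])
      fix u assume "u \<in> {u. (t, x, u) \<in> U}"
      then obtain W h where W: "(t, x, u) \<in> W" "W \<subseteq> U" "symmetry_form_with \<mu> W \<Phi> (\<alpha>, \<beta>, \<gamma>, \<delta>, \<sigma>) h"
        using form by blast
      have "open ((\<lambda>u. (t, x, u)) -` W)"
        using W(3) by (intro open_vimage continuous_intros) (auto simp: symmetry_form_with_def)
      then have "openin (top_of_set {u. (t, x, u) \<in> U}) ((\<lambda>u. (t, x, u)) -` W)"
        using W by (intro open_subset) auto
      then show "\<exists>T. openin (top_of_set {u. (t, x, u) \<in> U}) T \<and> u \<in> T \<and> (\<forall>w\<in>T. H (t, x, w) = H (t, x, u))"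
        using W H[OF W(3)] by (intro exI[of _ "(\<lambda>u. (t, x, u)) -` W"]) auto
    qed
    then show ?thesis using that unfolding constant_on_def by force
  qed
  \<comment> \<open>Any height over (t, x) may be chosen, since H is constant on the fibre.\<close>
  define h where "h = (\<lambda>(t, x). H (t, x, SOME u. (t, x, u) \<in> U))"
  have h: "H (t, x, u) = h (t, x)" if "(t, x, u) \<in> U" for t x u
    unfolding h_def using fibre[OF that someI[of "\<lambda>u. (t, x, u) \<in> U", OF that]] by simp
  have "heat_solution \<mu> {(t, x). \<exists>u. (t, x, u) \<in> U} h"
  proof (rule heat_solution_local)
    fix p assume "p \<in> {(t, x). \<exists>u. (t, x, u) \<in> U}"
    then obtain t x u where p: "p = (t, x)" "(t, x, u) \<in> U" by auto
    obtain W h' where W: "(t, x, u) \<in> W" "W \<subseteq> U" "symmetry_form_with \<mu> W \<Phi> (\<alpha>, \<beta>, \<gamma>, \<delta>, \<sigma>) h'"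
      using form[OF p(2)] by blast
    show "\<exists>D' h'. p \<in> D' \<and> D' \<subseteq> {(t, x). \<exists>u. (t, x, u) \<in> U} \<and> heat_solution \<mu> D' h' \<and> (\<forall>q\<in>D'. h q = h' q)"
    proof (intro exI conjI)
      show "p \<in> {(t, x). \<exists>u. (t, x, u) \<in> W}" using W p by auto
      show "{(t, x). \<exists>u. (t, x, u) \<in> W} \<subseteq> {(t, x). \<exists>u. (t, x, u) \<in> U}" using W by auto
      show "heat_solution \<mu> {(t, x). \<exists>u. (t, x, u) \<in> W} h'" using W(3) by (simp add: symmetry_form_with_def)
      show "\<forall>q\<in>{(t, x). \<exists>u. (t, x, u) \<in> W}. h q = h' q"
      proof clarify
        fix s y w assume w: "(s, y, w) \<in> W"
        then show "h (s, y) = h' (s, y)" using H[OF W(3) w] h[of s y w] W(2) by auto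
      qed
    qed
  qed
  moreover have "\<gamma> * t + \<delta> \<noteq> 0 \<and> x \<noteq> 0 \<and> \<Phi> (t, x, u) = symmetry_map \<alpha> \<beta> \<gamma> \<delta> \<sigma> h (t, x, u)" if p: "(t, x, u) \<in> U" for t x u
  proof -
    obtain W h' where W: "(t, x, u) \<in> W" "W \<subseteq> U" "symmetry_form_with \<mu> W \<Phi> (\<alpha>, \<beta>, \<gamma>, \<delta>, \<sigma>) h'"
      using form[OF p] by blast
    have "h' (t, x) = h (t, x)" using H[OF W(3,1)] h[OF p] by simp
    then show ?thesis using W unfolding symmetry_form_with_def by (force simp: symmetry_map_def equation_domain_def)
  qed
  ultimately have "symmetry_form_with \<mu> U \<Phi> (\<alpha>, \<beta>, \<gamma>, \<delta>, \<sigma>) h"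
    using params U(1) unfolding symmetry_form_with_def by (auto simp: equation_domain_def)
  then show ?thesis unfolding has_symmetry_form_iff by blast
qed

text \<open>The inverse is explicit: the inverse matrix acts on t and x, and u is recovered by
  dividing by the multiplier and subtracting h at the recovered base point. With injectivity,
  invariance of domain makes the image open.\<close>

lemma form_imp_point_transformation:
  assumes "has_symmetry_form \<mu> U \<Phi>"
  shows "point_transformation U \<Phi>"
proof -
  obtain \<alpha> \<beta> \<gamma> \<delta> \<sigma> h where "symmetry_form_with \<mu> U \<Phi> (\<alpha>, \<beta>, \<gamma>, \<delta>, \<sigma>) h"
    using assms by (auto simp: has_symmetry_form_iff)
  then have U: "open U" and det: "\<alpha> * \<delta> - \<beta> * \<gamma> = 1" and \<sigma>: "\<sigma> \<noteq> 0"
    and h: "heat_solution \<mu> {(t, x). \<exists>u. (t, x, u) \<in> U} h"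
    and \<Phi>: "\<And>t x u. (t, x, u) \<in> U \<Longrightarrow> \<gamma> * t + \<delta> \<noteq> 0 \<and> \<Phi> (t, x, u) = symmetry_map \<alpha> \<beta> \<gamma> \<delta> \<sigma> h (t, x, u)"
    by (auto simp: symmetry_form_with_def)
  let ?D = "{(t, x). \<exists>u. (t, x, u) \<in> U}"
  have D: "open ?D" "smooth_on ?D h" using h by (auto simp: heat_solution_iff)
  have "smooth_on U (\<lambda>p. ((\<alpha> * fst p + \<beta>) / (\<gamma> * fst p + \<delta>), fst (snd p) / (\<gamma> * fst p + \<delta>),
     \<sigma> * sqrt \<bar>\<gamma> * fst p + \<delta>\<bar> * (snd (snd p) + h (fst p, fst (snd p))) *
       exp (\<gamma> * (fst (snd p))\<^sup>2 / (4 * (\<gamma> * fst p + \<delta>)))))"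
    by (intro smooth_intros smooth_on_compose[OF D(2) U D(1)] U) (use \<Phi> in \<open>auto simp del: distrib_left_numeral\<close>)
  then have s\<Phi>: "smooth_on U \<Phi>"
    by (rule smooth_on_cong[OF U]) (use \<Phi> in \<open>auto simp: symmetry_map_def\<close>)
  \<comment> \<open>The matrix with rows (\<delta>, -\<beta>) and (-\<gamma>, \<alpha>) is the
    inverse one, so k is the denominator of the inverse map; on the image it equals 1 / (\<gamma> t
    + \<delta>).\<close>
  define \<Psi> where "\<Psi> = (\<lambda>p. let k = - \<gamma> * fst p + \<alpha> in ((\<delta> * fst p - \<beta>) / k, fst (snd p) / k,
     snd (snd p) * sqrt \<bar>k\<bar> / \<sigma> * exp (- (\<gamma> * (fst (snd p))\<^sup>2 / (4 * k))) - h ((\<delta> * fst p - \<beta>) / k, fst (snd p) / k)))"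
  have k: "- \<gamma> * fst (\<Phi> (t, x, u)) + \<alpha> = 1 / (\<gamma> * t + \<delta>)" if "(t, x, u) \<in> U" for t x u
  proof -
    have "\<alpha> * (\<gamma> * t + \<delta>) - \<gamma> * (\<alpha> * t + \<beta>) = 1" using det by (simp add: algebra_simps)
    then show ?thesis using \<Phi>[OF that] by (simp add: symmetry_map_def field_simps)
  qed
  have base: "(\<delta> * fst (\<Phi> (t, x, u)) - \<beta>) / (- \<gamma> * fst (\<Phi> (t, x, u)) + \<alpha>) = t"
    "fst (snd (\<Phi> (t, x, u))) / (- \<gamma> * fst (\<Phi> (t, x, u)) + \<alpha>) = x" if "(t, x, u) \<in> U" for t x u
  proof -
    have "\<delta> * (\<alpha> * t + \<beta>) - \<beta> * (\<gamma> * t + \<delta>) = (\<alpha> * \<delta> - \<beta> * \<gamma>) * t" by (simp add: algebra_simps)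
    then have "(\<delta> * ((\<alpha> * t + \<beta>) / (\<gamma> * t + \<delta>)) - \<beta>) * (\<gamma> * t + \<delta>) = t"
      using det \<Phi>[OF that] by (simp add: field_simps)
    then show "(\<delta> * fst (\<Phi> (t, x, u)) - \<beta>) / (- \<gamma> * fst (\<Phi> (t, x, u)) + \<alpha>) = t"
      unfolding k[OF that] using \<Phi>[OF that] by (simp add: symmetry_map_def)
    show "fst (snd (\<Phi> (t, x, u))) / (- \<gamma> * fst (\<Phi> (t, x, u)) + \<alpha>) = x"
      unfolding k[OF that] using \<Phi>[OF that] by (simp add: symmetry_map_def)
  qed
  have inv: "\<Psi> (\<Phi> p) = p" if "p \<in> U" for p
  proof -
    obtain t x u where p: "p = (t, x, u)" by (cases p)
    then have w: "(t, x, u) \<in> U" using that by simp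
    let ?g = "\<gamma> * t + \<delta>"
    have g: "?g \<noteq> 0" using \<Phi>[OF w] by simp
    have "snd (snd (\<Phi> (t, x, u))) * sqrt \<bar>1 / ?g\<bar> / \<sigma> * exp (- (\<gamma> * (fst (snd (\<Phi> (t, x, u))))\<^sup>2 / (4 * (1 / ?g)))) = u + h (t, x)"
    proof -
      \<comment> \<open>The multipliers of \<Phi> and \<Psi> are reciprocal: the square roots
        because k = 1/G, the exponentials because (x/G)^2 / (4/G) = x^2 / (4 G).\<close>
      have alg: "\<sigma> * sqrt \<bar>G\<bar> * w * exp (\<gamma> * x\<^sup>2 / (4 * G)) * sqrt \<bar>1 / G\<bar> / \<sigma> *
          exp (- (\<gamma> * (x / G)\<^sup>2 / (4 * (1 / G)))) = w" if "G \<noteq> 0" for G w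
      proof -
        have e: "\<gamma> * (x / G)\<^sup>2 / (4 * (1 / G)) = \<gamma> * x\<^sup>2 / (4 * G)"
          using that by (simp add: field_simps power2_eq_square)
        have s: "sqrt \<bar>G\<bar> * sqrt \<bar>1 / G\<bar> = 1"
          using that by (simp flip: real_sqrt_mult abs_mult)
        have exp: "exp y * exp (- y) = 1" for y :: real by (simp flip: exp_add)
        have rearrange: "\<sigma> * s * w * e * s' / \<sigma> * e' = w * (s * s') * (e * e')" for s e s' e'
          using \<sigma> by simp
        show ?thesis unfolding e unfolding rearrange s exp by simp
      qed
      show ?thesis using alg[OF g, of "u + h (t, x)"] \<Phi>[OF w]
        by (simp only: symmetry_map_def prod.case fst_conv snd_conv)
    qed
    then show ?thesis unfolding p \<Psi>_def Let_def base[OF w] unfolding k[OF w] by simp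
  qed
  have "open (\<Phi> ` U)"
    by (rule invariance_of_domain[OF smooth_on_imp_continuous_on[OF s\<Phi>] U]) (metis inv inj_on_inverseI)
  moreover have "smooth_on (\<Phi> ` U) \<Psi>"
    unfolding \<Psi>_def Let_def
  proof (intro smooth_intros smooth_on_compose[OF D(2) _ D(1)] \<open>open (\<Phi> ` U)\<close>)
    show "- \<gamma> * fst p + \<alpha> \<noteq> 0" if "p \<in> \<Phi> ` U" for p
      using that k \<Phi> by fastforce
    show "((\<delta> * fst p - \<beta>) / (- \<gamma> * fst p + \<alpha>), fst (snd p) / (- \<gamma> * fst p + \<alpha>)) \<in> ?D" if "p \<in> \<Phi> ` U" for p
      using that base by fastforce
  qed (use \<sigma> k \<Phi> in \<open>fastforce+\<close>)
  ultimately show ?thesis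
    unfolding point_transformation_def using U s\<Phi> inv by blast
qed

text \<open>On a disconnected U the constants may differ between components, and over a disconnected
  fibre h may take several values. The first part is therefore local; the second gives the displayed
  form itself on domains that exclude both phenomena.\<close>

theorem theorem9:
  fixes \<mu> :: real
  assumes "\<mu> \<noteq> 0"
  shows "(\<forall>U \<Phi>. (U, \<Phi>) \<in> point_symmetry_pseudogroup \<mu> \<longleftrightarrow>
            point_transformation U \<Phi> \<and>
            (\<forall>p\<in>U. \<exists>W. open W \<and> p \<in> W \<and> W \<subseteq> U \<and> has_symmetry_form \<mu> W \<Phi>)) \<and>
         (\<forall>U \<Phi>. open U \<and> connected U \<and> (\<forall>t x. connected {u. (t, x, u) \<in> U}) \<longrightarrow>
            ((U, \<Phi>) \<in> point_symmetry_pseudogroup \<mu> \<longleftrightarrow> has_symmetry_form \<mu> U \<Phi>))"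
proof (intro conjI allI impI)
  fix U :: "point set" and \<Phi> :: "point \<Rightarrow> point"
  show "(U, \<Phi>) \<in> point_symmetry_pseudogroup \<mu> \<longleftrightarrow> point_transformation U \<Phi> \<and>
            (\<forall>p\<in>U. \<exists>W. open W \<and> p \<in> W \<and> W \<subseteq> U \<and> has_symmetry_form \<mu> W \<Phi>)"
  proof (intro iffI conjI ballI)
    assume G: "(U, \<Phi>) \<in> point_symmetry_pseudogroup \<mu>"
    then show "point_transformation U \<Phi>" by (simp add: point_symmetry_pseudogroup_def)
    show "\<exists>W. open W \<and> p \<in> W \<and> W \<subseteq> U \<and> has_symmetry_form \<mu> W \<Phi>" if "p \<in> U" for p
      by (rule pseudogroup_imp_local_form[OF assms G that])
  qed (auto intro!: local_form_imp_pseudogroup)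
next
  fix U :: "point set" and \<Phi> :: "point \<Rightarrow> point"
  assume U: "open U \<and> connected U \<and> (\<forall>t x. connected {u. (t, x, u) \<in> U})"
  show "(U, \<Phi>) \<in> point_symmetry_pseudogroup \<mu> \<longleftrightarrow> has_symmetry_form \<mu> U \<Phi>"
  proof
    assume "(U, \<Phi>) \<in> point_symmetry_pseudogroup \<mu>"
    then show "has_symmetry_form \<mu> U \<Phi>"
      using U pseudogroup_imp_local_form[OF assms] by (intro local_form_imp_form) auto
  next
    assume "has_symmetry_form \<mu> U \<Phi>"
    then show "(U, \<Phi>) \<in> point_symmetry_pseudogroup \<mu>"
      using local_form_imp_pseudogroup[OF form_imp_point_transformation] by blast
  qed
qed

end
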